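(* Let $(M,g,(V_i)_{i\in\mathbb{Z}_r^s},\nabla)$ be a locally Witt symmetric space, with $\nabla$ its canonical Witt connection, $T$ and $R$ the torsion and curvature of $\nabla$. Then $$[V_+,V_+]\subset V_+,\qquad T(V_-,V_-)\subset V_+,\qquad T(V_+,V_-)\subset V_-,\qquad R(X,Y)=0\ \text{ for } X\in V_+,\ Y\in V_-,$$ and $$\nabla_XR=0,\qquad \nabla_XT=0\qquad\text{for all } X\in V_-.$$
   Context: **Witt structures.** $(M,g)$ is a smooth pseudo-Riemannian manifold. Let $r,s\geq 1$ be integers, let $q_1,\dots,q_r$ be negative integers and $p_1,p_1^*,\dots,p_s,p_s^*$ non-negative integers, all distinct; put $\mathbb{Z}^s=\{p_1,p_1^*,\dots,p_s,p_s^*\}$ and $\mathbb{Z}_r^s=\{q_1,\dots,q_r\}\cup\mathbb{Z}^s$. A Witt structure on $TM$ is a family of subbundles $(V_i)_{i\in\mathbb{Z}_r^s}$ such that: (i) $TM=(V_{p_s}\oplus V_{p_s^*})\oplus\cdots\oplus(V_{p_1}\oplus V_{p_1^*})\oplus V_{q_1}\oplus\cdots\oplus V_{q_r}$ with the blocks $V_{p_k}\oplus V_{p_k^*}$ and $V_{q_l}$ mutually $g$-orthogonal; (ii) $V_{p_k}$, $V_{p_k^*}$ have the same rank, are totally isotropic, and $g|_{V_{p_k}\times V_{p_k^*}}$ is non-degenerate; (iii) each $V_{q_l}$ is anisotropic (no nonzero null vectors). Standing assumption: $\mathbb{Z}_r^s$ contains both even and odd integers, and $p_k\equiv p_k^*$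 mod $2$ for each $k$. **Canonical Witt connection.** $i^*=q_l$ if $i=q_l$; $i^*=p_k^*$ if $i=p_k$; $i^*=p_k$ if $i=p_k^*$. $\pi^k_x:T_xM\to V_{k,x}$ is the projection, $X_k=\pi^k(X)$, $\alpha^\sharp_k=\pi^k(\alpha^\sharp)$; $\flat,\sharp$ are the musical isomorphisms of $g$. For $X_i\in\Gamma(V_i)$, $Y_j\in\Gamma(V_j)$, $\mathcal{T}_k(X_i,Y_j)\in V_k$ is: $0$ if $i=j$; $\frac12\big((\mathcal{L}_{X_i}Y_j^\flat+\mathcal{L}_{Y_j}X_i^\flat)^\sharp_k-[X_i,Y_j]_k-(d(g(X_i,Y_j)))^\sharp_k\big)$ if $i\ne j=k$, $i=j^*$ ($j\in\mathbb{Z}^s$); $\frac12\big((\mathcal{L}_{X_i}Y_j^\flat)^\sharp_k-[X_i,Y_j]_k\big)$ if $i\ne j=k$, $i\neq j^*$; $0$ if $i\neq j$, $j\ne k$. The canonical Witt connection $\nabla$ is the unique connection on $TM$ with $\nabla g=0$, preserving every $V_i$, and with torsion $T(X,Y)=\nabla_XY-\nabla_YX-[X,Y]$ given by $$T(X_i,Y_j)=-\sum_{k\ne i,\,k\ne j}[X_i,Y_j]_k+\mathcal{T}_j(X_i,Y_j)-\mathcal{T}_i(Y_j,X_i).$$ Curvature: $R(X,Y)=[\nabla_X,\nabla_Y]-\nabla_{[X,Y]}$. **Witt symmetric spaces.** For $x\in M$ let $\delta_x=\sum_{i\in\mathbb{Z}_r^s}(-1)^i\pi^i_x$, a linear isometric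 involution of $T_xM$. Let $\exp^\nabla_x$ be the exponential map of $\nabla$ at $x$, a diffeomorphism from a suitable neighbourhood of $0_x$ onto a neighbourhood $U_x$ of $x$. The local Witt symmetry at $x$ is $\psi_x=\exp^\nabla_x\circ\delta_x\circ(\exp^\nabla_x)^{-1}:U_x\to U_x$. A local Witt isometry is a local diffeomorphism $\psi$ with $\psi^*g=g$ and $d\psi(V_i)\subset V_i$ for all $i$. $(M,g,(V_i),\nabla)$ is a locally Witt symmetric space if for every $x\in M$, $\psi_x$ is a local Witt isometry. Finally $V_\pm$ is the vector bundle with fibre $V_{\pm,x}=\ker(\delta_x\mp \mathrm{id}_x)$, i.e. $V_+=\bigoplus_{i\text{ even}}V_i$ and $V_-=\bigoplus_{i\text{ odd}}V_i$; $[V_+,V_+]\subset V_+$ means $[\Gamma(V_+),\Gamma(V_+)]\subset\Gamma(V_+)$. *)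

theory Defs
  imports "HOL-Analysis.Analysis" "HOL-Library.Function_Algebras"
begin

section \<open>Pointwise real vector space structure on function types\<close>

instantiation "fun" :: (type, real_vector) real_vector
begin

definition scaleR_fun_def: "scaleR a f = (\<lambda>x. a *\<^sub>R f x)"

instance
  by standard (simp_all add: scaleR_fun_def fun_eq_iff scaleR_add_right scaleR_add_left)

end

lemma scaleR_fun_apply [simp]: "(a *\<^sub>R f) x = a *\<^sub>R f x"
  by (simp add: scaleR_fun_def)


section \<open>Smooth manifolds\<close>

text \<open>The next two notions are meant for open sets \<open>S\<close>.\<close>

primrec Ck_on ::
  "nat \<Rightarrow> 'a::euclidean_space set \<Rightarrow> ('a \<Rightarrow> 'b::euclidean_space) \<Rightarrow> bool" where
  "Ck_on 0 S f \<longleftrightarrow> continuous_on S f"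
| "Ck_on (Suc k) S f \<longleftrightarrow> (\<forall>x\<in>S. f differentiable (at x)) \<and>
      (\<forall>v. Ck_on k S (\<lambda>x. frechet_derivative f (at x) v))"

definition smooth_on :: "'a::euclidean_space set \<Rightarrow> ('a \<Rightarrow> 'b::euclidean_space) \<Rightarrow> bool" where
  "smooth_on S f \<longleftrightarrow> (\<forall>k. Ck_on k S f)"

text \<open>A chart is a pair of a domain and a coordinate map; the values of the coordinate map outside
  the domain are irrelevant. The manifold is the whole type \<open>'m\<close>; the Hausdorff property and
  second countability enter as type classes.\<close>

type_synonym ('m, 'e) chart = "'m set \<times> ('m \<Rightarrow> 'e)"

abbreviation chart_inv :: "('m, 'e) chart \<Rightarrow> 'e \<Rightarrow> 'm" where
  "chart_inv c \<equiv> inv_into (fst c) (snd c)"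

definition smooth_atlas ::
  "('m::{t2_space, second_countable_topology}, 'e::euclidean_space) chart set \<Rightarrow> bool" where
  "smooth_atlas A \<longleftrightarrow>
     (\<forall>c\<in>A. open (fst c) \<and> open (snd c ` fst c) \<and>
        homeomorphism (fst c) (snd c ` fst c) (snd c) (chart_inv c)) \<and>
     (\<Union>c\<in>A. fst c) = UNIV \<and>
     (\<forall>c\<in>A. \<forall>d\<in>A. smooth_on (snd c ` (fst c \<inter> fst d)) (snd d \<circ> chart_inv c))"

definition std_atlas :: "('e::euclidean_space, 'e) chart set" where
  "std_atlas = {(UNIV, id)}"

definition smooth_map ::
  "('m::topological_space, 'e::euclidean_space) chart set \<Rightarrow>
   ('n::topological_space, 'f::euclidean_space) chart set \<Rightarrow> 'm set \<Rightarrow> ('m \<Rightarrow> 'n) \<Rightarrow> bool" where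
  "smooth_map A B U F \<longleftrightarrow> continuous_on U F \<and>
     (\<forall>c\<in>A. \<forall>d\<in>B. smooth_on (snd c ` (U \<inter> fst c \<inter> F -` fst d)) (snd d \<circ> F \<circ> chart_inv c))"

definition diffeo ::
  "('m::topological_space, 'e::euclidean_space) chart set \<Rightarrow>
   ('n::topological_space, 'f::euclidean_space) chart set \<Rightarrow>
   'm set \<Rightarrow> 'n set \<Rightarrow> ('m \<Rightarrow> 'n) \<Rightarrow> bool" where
  "diffeo A B U W F \<longleftrightarrow> open U \<and> open W \<and> bij_betw F U W \<and>
     smooth_map A B U F \<and> smooth_map B A W (inv_into U F)"

definition local_diffeo ::
  "('m::topological_space, 'e::euclidean_space) chart set \<Rightarrow> 'm set \<Rightarrow> ('m \<Rightarrow> 'm) \<Rightarrow> bool" where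
  "local_diffeo A U F \<longleftrightarrow>
     open U \<and> (\<forall>x\<in>U. \<exists>W W'. x \<in> W \<and> W \<subseteq> U \<and> diffeo A A W W' F)"

definition smooth_fun ::
  "('m::topological_space, 'e::euclidean_space) chart set \<Rightarrow> 'm set \<Rightarrow> ('m \<Rightarrow> real) \<Rightarrow> bool" where
  "smooth_fun A U f \<longleftrightarrow> smooth_map A std_atlas U f"

definition smooth_at ::
  "('m::topological_space, 'e::euclidean_space) chart set \<Rightarrow> 'm \<Rightarrow> ('m \<Rightarrow> real) \<Rightarrow> bool" where
  "smooth_at A x f \<longleftrightarrow> (\<exists>U. open U \<and> x \<in> U \<and> smooth_fun A U f)"


section \<open>Tangent vectors and vector fields\<close>

text \<open>Tangent vectors at \<open>x\<close> are derivations on the functions that are smooth near \<open>x\<close>. A function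
  that is not smooth near \<open>x\<close> is sent to \<open>0\<close>, so that equality of tangent vectors is equality of
  functionals. Leibniz' rule applied to indicator functions of open sets shows that
  a derivation only depends on the germ of its argument.\<close>

type_synonym 'm tangent = "('m \<Rightarrow> real) \<Rightarrow> real"
type_synonym 'm vfield = "'m \<Rightarrow> 'm tangent"
type_synonym 'm form = "'m \<Rightarrow> 'm tangent \<Rightarrow> real"

definition tangent_space ::
  "('m::topological_space, 'e::euclidean_space) chart set \<Rightarrow> 'm \<Rightarrow> 'm tangent set" where
  "tangent_space A x = {v.
     (\<forall>f. \<not> smooth_at A x f \<longrightarrow> v f = 0) \<and>
     (\<forall>f h a b. smooth_at A x f \<longrightarrow> smooth_at A x h \<longrightarrow>
        v (\<lambda>y. a * f y + b * h y) = a * v f + b * v h) \<and>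
     (\<forall>f h. smooth_at A x f \<longrightarrow> smooth_at A x h \<longrightarrow>
        v (\<lambda>y. f y * h y) = f x * v h + h x * v f)}"

definition differential ::
  "('m::topological_space, 'e::euclidean_space) chart set \<Rightarrow> ('m \<Rightarrow> 'm) \<Rightarrow> 'm \<Rightarrow> 'm tangent \<Rightarrow>
   'm tangent" where
  "differential A F x v = (\<lambda>f. if smooth_at A (F x) f then v (f \<circ> F) else 0)"

text \<open>Sections are local: a section over an open set \<open>U\<close> is a function on the whole manifold whose
  values outside \<open>U\<close> are irrelevant. Global sections are the case \<open>U = UNIV\<close>.\<close>

definition vfields ::
  "('m::topological_space, 'e::euclidean_space) chart set \<Rightarrow> 'm set \<Rightarrow> 'm vfield set" where
  "vfields A U = {X. (\<forall>x\<in>U. X x \<in> tangent_space A x) \<and>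
     (\<forall>W f. open W \<longrightarrow> W \<subseteq> U \<longrightarrow> smooth_fun A W f \<longrightarrow> smooth_fun A W (\<lambda>x. X x f))}"

definition sections ::
  "('m::topological_space, 'e::euclidean_space) chart set \<Rightarrow> 'm set \<Rightarrow> ('m \<Rightarrow> 'm tangent set) \<Rightarrow>
   'm vfield set" where
  "sections A U E = {X \<in> vfields A U. \<forall>x\<in>U. X x \<in> E x}"

definition smooth_subbundle ::
  "('m::topological_space, 'e::euclidean_space) chart set \<Rightarrow> ('m \<Rightarrow> 'm tangent set) \<Rightarrow> bool" where
  "smooth_subbundle A E \<longleftrightarrow> (\<exists>k::nat. \<forall>x. \<exists>U X. open U \<and> x \<in> U \<and>
     (\<forall>j<k. X j \<in> vfields A U) \<and>
     (\<forall>y\<in>U. inj_on (\<lambda>j. X j y) {..<k} \<and> independent ((\<lambda>j. X j y) ` {..<k}) \<and>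
        span ((\<lambda>j. X j y) ` {..<k}) = E y))"

definition lie_bracket ::
  "('m::topological_space, 'e::euclidean_space) chart set \<Rightarrow> 'm vfield \<Rightarrow> 'm vfield \<Rightarrow>
   'm vfield" where
  "lie_bracket A X Y x =
     (\<lambda>f. if smooth_at A x f then X x (\<lambda>y. Y y f) - Y x (\<lambda>y. X y f) else 0)"

definition fun_differential :: "('m \<Rightarrow> real) \<Rightarrow> 'm form" where
  "fun_differential f = (\<lambda>x v. v f)"

text \<open>\<open>(\<L>\<^sub>X \<alpha>)(Z) = X (\<alpha> Z) - \<alpha> [X, Z]\<close>, evaluated on a tangent vector
  \<open>w\<close> by means of any local vector field \<open>Z\<close> extending \<open>w\<close>.\<close>

definition lie_form ::
  "('m::topological_space, 'e::euclidean_space) chart set \<Rightarrow> 'm vfield \<Rightarrow> 'm form \<Rightarrow>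
   'm form" where
  "lie_form A X \<alpha> x w = (THE a. \<exists>U Z. open U \<and> x \<in> U \<and> Z \<in> vfields A U \<and> Z x = w \<and>
     a = X x (\<lambda>y. \<alpha> y (Z y)) - \<alpha> x (lie_bracket A X Z x))"


section \<open>Pseudo-Riemannian metrics\<close>

type_synonym 'm metric_field = "'m \<Rightarrow> 'm tangent \<Rightarrow> 'm tangent \<Rightarrow> real"

definition pseudo_riemannian_metric ::
  "('m::topological_space, 'e::euclidean_space) chart set \<Rightarrow> 'm metric_field \<Rightarrow> bool" where
  "pseudo_riemannian_metric A g \<longleftrightarrow>
     (\<forall>x. \<forall>u\<in>tangent_space A x. \<forall>v\<in>tangent_space A x. \<forall>w\<in>tangent_space A x. \<forall>a b.
        g x (a *\<^sub>R u + b *\<^sub>R v) w = a * g x u w + b * g x v w) \<and>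
     (\<forall>x. \<forall>u\<in>tangent_space A x. \<forall>v\<in>tangent_space A x. g x u v = g x v u) \<and>
     (\<forall>x. \<forall>u\<in>tangent_space A x. (\<forall>v\<in>tangent_space A x. g x u v = 0) \<longrightarrow> u = 0) \<and>
     (\<forall>U X Y. open U \<longrightarrow> X \<in> vfields A U \<longrightarrow> Y \<in> vfields A U \<longrightarrow>
        smooth_fun A U (\<lambda>x. g x (X x) (Y x)))"

definition flat :: "'m metric_field \<Rightarrow> 'm vfield \<Rightarrow> 'm form" where
  "flat g X = (\<lambda>x w. g x (X x) w)"

definition sharp ::
  "('m::topological_space, 'e::euclidean_space) chart set \<Rightarrow> 'm metric_field \<Rightarrow> 'm form \<Rightarrow>
   'm vfield" where
  "sharp A g \<alpha> x =
     (THE v. v \<in> tangent_space A x \<and> (\<forall>w\<in>tangent_space A x. g x v w = \<alpha> x w))"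


section \<open>Connections, torsion and curvature\<close>

text \<open>A connection acts on vector fields over arbitrary open sets. Its compatibility with
  restriction to smaller open sets is a consequence of the function-linearity and of Leibniz' rule,
  applied to indicator functions of open sets.\<close>

type_synonym 'm connection = "'m vfield \<Rightarrow> 'm vfield \<Rightarrow> 'm vfield"

definition is_connection ::
  "('m::topological_space, 'e::euclidean_space) chart set \<Rightarrow> 'm connection \<Rightarrow> bool" where
  "is_connection A D \<longleftrightarrow> (\<forall>U. open U \<longrightarrow>
     (\<forall>X\<in>vfields A U. \<forall>Y\<in>vfields A U. D X Y \<in> vfields A U) \<and>
     (\<forall>X\<in>vfields A U. \<forall>X'\<in>vfields A U. \<forall>Y\<in>vfields A U. \<forall>x\<in>U.
        D (X + X') Y x = D X Y x + D X' Y x) \<and>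
     (\<forall>X\<in>vfields A U. \<forall>Y\<in>vfields A U. \<forall>Y'\<in>vfields A U. \<forall>x\<in>U.
        D X (Y + Y') x = D X Y x + D X Y' x) \<and>
     (\<forall>f X Y. smooth_fun A U f \<longrightarrow> X \<in> vfields A U \<longrightarrow> Y \<in> vfields A U \<longrightarrow> (\<forall>x\<in>U.
        D (\<lambda>y. f y *\<^sub>R X y) Y x = f x *\<^sub>R D X Y x \<and>
        D X (\<lambda>y. f y *\<^sub>R Y y) x = f x *\<^sub>R D X Y x + X x f *\<^sub>R Y x)))"

definition metric_connection ::
  "('m::topological_space, 'e::euclidean_space) chart set \<Rightarrow> 'm metric_field \<Rightarrow> 'm connection \<Rightarrow>
   bool" where
  "metric_connection A g D \<longleftrightarrow>
     (\<forall>U. open U \<longrightarrow> (\<forall>X\<in>vfields A U. \<forall>Y\<in>vfields A U. \<forall>Z\<in>vfields A U. \<forall>x\<in>U.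
        X x (\<lambda>y. g y (Y y) (Z y)) = g x (D X Y x) (Z x) + g x (Y x) (D X Z x)))"

definition preserves_subbundle ::
  "('m::topological_space, 'e::euclidean_space) chart set \<Rightarrow> 'm connection \<Rightarrow>
   ('m \<Rightarrow> 'm tangent set) \<Rightarrow> bool" where
  "preserves_subbundle A D E \<longleftrightarrow>
     (\<forall>U. open U \<longrightarrow> (\<forall>X\<in>vfields A U. \<forall>Y\<in>sections A U E. D X Y \<in> sections A U E))"

definition torsion ::
  "('m::topological_space, 'e::euclidean_space) chart set \<Rightarrow> 'm connection \<Rightarrow>
   'm vfield \<Rightarrow> 'm vfield \<Rightarrow> 'm vfield" where
  "torsion A D X Y = D X Y - D Y X - lie_bracket A X Y"

definition curvature ::
  "('m::topological_space, 'e::euclidean_space) chart set \<Rightarrow> 'm connection \<Rightarrow>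
   'm vfield \<Rightarrow> 'm vfield \<Rightarrow> 'm vfield \<Rightarrow> 'm vfield" where
  "curvature A D X Y Z = D X (D Y Z) - D Y (D X Z) - D (lie_bracket A X Y) Z"

text \<open>\<open>(\<nabla>\<^sub>X T)(Y, Z)\<close> and \<open>(\<nabla>\<^sub>X R)(Y, Z) W\<close>.\<close>

definition cov_torsion ::
  "('m::topological_space, 'e::euclidean_space) chart set \<Rightarrow> 'm connection \<Rightarrow>
   'm vfield \<Rightarrow> 'm vfield \<Rightarrow> 'm vfield \<Rightarrow> 'm vfield" where
  "cov_torsion A D X Y Z =
     D X (torsion A D Y Z) - torsion A D (D X Y) Z - torsion A D Y (D X Z)"

definition cov_curvature ::
  "('m::topological_space, 'e::euclidean_space) chart set \<Rightarrow> 'm connection \<Rightarrow>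
   'm vfield \<Rightarrow> 'm vfield \<Rightarrow> 'm vfield \<Rightarrow> 'm vfield \<Rightarrow> 'm vfield" where
  "cov_curvature A D X Y Z W =
     D X (curvature A D Y Z W) - curvature A D (D X Y) Z W - curvature A D Y (D X Z) W
       - curvature A D Y Z (D X W)"


section \<open>Geodesics and the exponential map\<close>

text \<open>The coordinate vector field of the chart \<open>c\<close> in the direction \<open>b\<close>, and the component of a
  tangent vector along it.\<close>

definition coord_field ::
  "('m::topological_space, 'e::euclidean_space) chart set \<Rightarrow> ('m, 'e) chart \<Rightarrow> 'e \<Rightarrow>
   'm vfield" where
  "coord_field A c b = (\<lambda>y f. if smooth_at A y f
     then frechet_derivative (f \<circ> chart_inv c) (at (snd c y)) b else 0)"

definition coord_comp :: "('m, 'e::euclidean_space) chart \<Rightarrow> 'e \<Rightarrow> 'm tangent \<Rightarrow> real" where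
  "coord_comp c b v = v (\<lambda>y. snd c y \<bullet> b)"

definition velocity ::
  "('m::topological_space, 'e::euclidean_space) chart set \<Rightarrow> (real \<Rightarrow> 'm) \<Rightarrow> real \<Rightarrow>
   'm tangent" where
  "velocity A \<gamma> t = (\<lambda>f. if smooth_at A (\<gamma> t) f then deriv (f \<circ> \<gamma>) t else 0)"

text \<open>The covariant derivative of a vector field \<open>v\<close> along the curve \<open>\<gamma>\<close>, computed in the chart
  \<open>c\<close>: if \<open>v = \<Sum>\<^sub>b v\<^sup>b E\<^sub>b\<close> with coordinate fields \<open>E\<^sub>b\<close>, it is
  \<open>\<Sum>\<^sub>b (v\<^sup>b)' E\<^sub>b + v\<^sup>b \<nabla>\<^bsub>\<gamma>'\<^esub> E\<^sub>b\<close>.\<close>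

definition cov_deriv_along ::
  "('m::topological_space, 'e::euclidean_space) chart set \<Rightarrow> 'm connection \<Rightarrow> ('m, 'e) chart \<Rightarrow>
   (real \<Rightarrow> 'm) \<Rightarrow> (real \<Rightarrow> 'm tangent) \<Rightarrow> real \<Rightarrow> 'm tangent" where
  "cov_deriv_along A D c \<gamma> v t =
     (\<Sum>b\<in>Basis. deriv (\<lambda>s. coord_comp c b (v s)) t *\<^sub>R coord_field A c b (\<gamma> t) +
        coord_comp c b (v t) *\<^sub>R (\<Sum>a\<in>Basis. coord_comp c a (velocity A \<gamma> t) *\<^sub>R
           D (coord_field A c a) (coord_field A c b) (\<gamma> t)))"

definition geodesic ::
  "('m::topological_space, 'e::euclidean_space) chart set \<Rightarrow> 'm connection \<Rightarrow> real set \<Rightarrow>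
   (real \<Rightarrow> 'm) \<Rightarrow> bool" where
  "geodesic A D I \<gamma> \<longleftrightarrow> open I \<and> is_interval I \<and> smooth_map std_atlas A I \<gamma> \<and>
     (\<forall>t\<in>I. \<forall>c\<in>A. \<gamma> t \<in> fst c \<longrightarrow> cov_deriv_along A D c \<gamma> (velocity A \<gamma>) t = 0)"

text \<open>\<open>y\<close> is the value at time \<open>1\<close> of the geodesic starting at \<open>x\<close> with velocity \<open>v\<close>.\<close>

definition geodesic_endpoint ::
  "('m::topological_space, 'e::euclidean_space) chart set \<Rightarrow> 'm connection \<Rightarrow> 'm \<Rightarrow> 'm tangent \<Rightarrow>
   'm \<Rightarrow> bool" where
  "geodesic_endpoint A D x v y \<longleftrightarrow> (\<exists>I \<gamma>. geodesic A D I \<gamma> \<and> {0..1} \<subseteq> I \<and>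
     \<gamma> 0 = x \<and> velocity A \<gamma> 0 = v \<and> \<gamma> 1 = y)"

definition exp_domain ::
  "('m::topological_space, 'e::euclidean_space) chart set \<Rightarrow> 'm connection \<Rightarrow> 'm \<Rightarrow>
   'm tangent set" where
  "exp_domain A D x = {v \<in> tangent_space A x. \<exists>y. geodesic_endpoint A D x v y}"

definition exp_map ::
  "('m::topological_space, 'e::euclidean_space) chart set \<Rightarrow> 'm connection \<Rightarrow> 'm \<Rightarrow> 'm tangent \<Rightarrow>
   'm" where
  "exp_map A D x v = (THE y. geodesic_endpoint A D x v y)"

text \<open>The exponential map at \<open>x\<close> is a diffeomorphism from the neighbourhood \<open>N\<close> of \<open>0\<close> in the
  tangent space onto the neighbourhood \<open>U\<close> of \<open>x\<close>. The smooth structure of the tangent space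
  comes from a linear isomorphism \<open>L\<close> with the model space (the choice of \<open>L\<close> is irrelevant).\<close>

definition exp_diffeo ::
  "('m::topological_space, 'e::euclidean_space) chart set \<Rightarrow> 'm connection \<Rightarrow> 'm \<Rightarrow>
   'm tangent set \<Rightarrow> 'm set \<Rightarrow> bool" where
  "exp_diffeo A D x N U \<longleftrightarrow> 0 \<in> N \<and> N \<subseteq> exp_domain A D x \<and>
     (\<exists>(L :: 'e \<Rightarrow> 'm tangent) B. linear L \<and> bij_betw L UNIV (tangent_space A x) \<and> L ` B = N \<and>
        diffeo std_atlas A B U (exp_map A D x \<circ> L))"


section \<open>Witt structures\<close>

text \<open>The integers \<open>q\<^sub>l\<close>, \<open>p\<^sub>k\<close>, \<open>p\<^sub>k\<^sup>*\<close> are given by the functions \<open>q\<close>, \<open>p\<close>, \<open>ps\<close>. The last three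
  conditions are the standing parity assumptions.\<close>

definition witt_index ::
  "nat \<Rightarrow> nat \<Rightarrow> (nat \<Rightarrow> int) \<Rightarrow> (nat \<Rightarrow> int) \<Rightarrow> (nat \<Rightarrow> int) \<Rightarrow> int set" where
  "witt_index r s q p ps = q ` {1..r} \<union> (p ` {1..s} \<union> ps ` {1..s})"

definition witt_star ::
  "nat \<Rightarrow> (nat \<Rightarrow> int) \<Rightarrow> (nat \<Rightarrow> int) \<Rightarrow> int \<Rightarrow> int" where
  "witt_star s p ps i =
     (if i \<in> p ` {1..s} then ps (inv_into {1..s} p i)
      else if i \<in> ps ` {1..s} then p (inv_into {1..s} ps i)
      else i)"

definition witt_indices ::
  "nat \<Rightarrow> nat \<Rightarrow> (nat \<Rightarrow> int) \<Rightarrow> (nat \<Rightarrow> int) \<Rightarrow> (nat \<Rightarrow> int) \<Rightarrow> bool" where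
  "witt_indices r s q p ps \<longleftrightarrow> 1 \<le> r \<and> 1 \<le> s \<and>
     (\<forall>l\<in>{1..r}. q l < 0) \<and> (\<forall>k\<in>{1..s}. 0 \<le> p k \<and> 0 \<le> ps k) \<and>
     inj_on q {1..r} \<and> inj_on p {1..s} \<and> inj_on ps {1..s} \<and> p ` {1..s} \<inter> ps ` {1..s} = {} \<and>
     (\<exists>i\<in>witt_index r s q p ps. even i) \<and> (\<exists>i\<in>witt_index r s q p ps. odd i) \<and>
     (\<forall>k\<in>{1..s}. even (p k) \<longleftrightarrow> even (ps k))"

definition direct_sum_decomposition ::
  "int set \<Rightarrow> (int \<Rightarrow> 'm tangent set) \<Rightarrow> 'm tangent set \<Rightarrow> bool" where
  "direct_sum_decomposition I E S \<longleftrightarrow> (\<forall>i\<in>I. E i \<subseteq> S) \<and>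
     (\<forall>v\<in>S. \<exists>!u. u \<in> (\<Pi>\<^sub>E i\<in>I. E i) \<and> v = (\<Sum>i\<in>I. u i))"

text \<open>The blocks are \<open>V i\<close> with \<open>i = i\<^sup>*\<close> and \<open>V i \<oplus> V i\<^sup>*\<close> with \<open>i \<noteq> i\<^sup>*\<close>, so two indices \<open>i\<close>, \<open>j\<close> lie in different
  blocks if and only if \<open>j \<noteq> i\<close> and \<open>j \<noteq> i\<^sup>*\<close>.\<close>

definition witt_structure ::
  "('m::topological_space, 'e::euclidean_space) chart set \<Rightarrow> 'm metric_field \<Rightarrow>
   nat \<Rightarrow> nat \<Rightarrow> (nat \<Rightarrow> int) \<Rightarrow> (nat \<Rightarrow> int) \<Rightarrow> (nat \<Rightarrow> int) \<Rightarrow>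
   (int \<Rightarrow> 'm \<Rightarrow> 'm tangent set) \<Rightarrow> bool" where
  "witt_structure A g r s q p ps V \<longleftrightarrow>
     witt_indices r s q p ps \<and>
     (\<forall>i\<in>witt_index r s q p ps. smooth_subbundle A (V i)) \<and>
     (\<forall>x. direct_sum_decomposition (witt_index r s q p ps) (\<lambda>i. V i x) (tangent_space A x)) \<and>
     (\<forall>i\<in>witt_index r s q p ps. \<forall>j\<in>witt_index r s q p ps. j \<noteq> i \<longrightarrow> j \<noteq> witt_star s p ps i \<longrightarrow>
        (\<forall>x. \<forall>u\<in>V i x. \<forall>w\<in>V j x. g x u w = 0)) \<and>
     (\<forall>k\<in>{1..s}. \<forall>x.
        dim (V (p k) x) = dim (V (ps k) x) \<and>
        (\<forall>u\<in>V (p k) x. \<forall>w\<in>V (p k) x. g x u w = 0) \<and>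
        (\<forall>u\<in>V (ps k) x. \<forall>w\<in>V (ps k) x. g x u w = 0) \<and>
        (\<forall>u\<in>V (p k) x. (\<forall>w\<in>V (ps k) x. g x u w = 0) \<longrightarrow> u = 0) \<and>
        (\<forall>w\<in>V (ps k) x. (\<forall>u\<in>V (p k) x. g x u w = 0) \<longrightarrow> w = 0)) \<and>
     (\<forall>l\<in>{1..r}. \<forall>x. \<forall>u\<in>V (q l) x. g x u u = 0 \<longrightarrow> u = 0)"

text \<open>The projection of \<open>v\<close>, tangent at \<open>x\<close>, onto \<open>V k x\<close>.\<close>

definition witt_proj ::
  "int set \<Rightarrow> (int \<Rightarrow> 'm \<Rightarrow> 'm tangent set) \<Rightarrow> int \<Rightarrow> 'm \<Rightarrow> 'm tangent \<Rightarrow> 'm tangent" where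
  "witt_proj I V k x v = (THE u. u \<in> (\<Pi>\<^sub>E i\<in>I. V i x) \<and> v = (\<Sum>i\<in>I. u i)) k"


section \<open>The canonical Witt connection\<close>

text \<open>\<open>witt_T A g I star V k i X j Y\<close> is the term \<open>\<T>\<^sub>k(X\<^sub>i, Y\<^sub>j)\<close> for sections \<open>X\<close> of \<open>V i\<close>
  and \<open>Y\<close> of \<open>V j\<close>.\<close>

definition witt_T ::
  "('m::topological_space, 'e::euclidean_space) chart set \<Rightarrow> 'm metric_field \<Rightarrow>
   int set \<Rightarrow> (int \<Rightarrow> int) \<Rightarrow> (int \<Rightarrow> 'm \<Rightarrow> 'm tangent set) \<Rightarrow>
   int \<Rightarrow> int \<Rightarrow> 'm vfield \<Rightarrow> int \<Rightarrow> 'm vfield \<Rightarrow> 'm vfield" where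
  "witt_T A g I star V k i X j Y x =
     (if i = j \<or> j \<noteq> k then 0
      else if i = star j then
        (1/2) *\<^sub>R (witt_proj I V k x
                     (sharp A g (lie_form A X (flat g Y) + lie_form A Y (flat g X)) x)
                 - witt_proj I V k x (lie_bracket A X Y x)
                 - witt_proj I V k x
                     (sharp A g (fun_differential (\<lambda>y. g y (X y) (Y y))) x))
      else
        (1/2) *\<^sub>R (witt_proj I V k x (sharp A g (lie_form A X (flat g Y)) x)
                 - witt_proj I V k x (lie_bracket A X Y x)))"

definition canonical_witt_connection ::
  "('m::topological_space, 'e::euclidean_space) chart set \<Rightarrow> 'm metric_field \<Rightarrow>
   int set \<Rightarrow> (int \<Rightarrow> int) \<Rightarrow> (int \<Rightarrow> 'm \<Rightarrow> 'm tangent set) \<Rightarrow> 'm connection \<Rightarrow> bool" where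
  "canonical_witt_connection A g I star V D \<longleftrightarrow>
     is_connection A D \<and> metric_connection A g D \<and> (\<forall>i\<in>I. preserves_subbundle A D (V i)) \<and>
     (\<forall>U. open U \<longrightarrow> (\<forall>i\<in>I. \<forall>j\<in>I. \<forall>X\<in>sections A U (V i). \<forall>Y\<in>sections A U (V j). \<forall>x\<in>U.
        torsion A D X Y x =
          - (\<Sum>k\<in>I - {i, j}. witt_proj I V k x (lie_bracket A X Y x))
          + witt_T A g I star V j i X j Y x - witt_T A g I star V i j Y i X x))"


section \<open>Locally Witt symmetric spaces\<close>

definition witt_delta ::
  "int set \<Rightarrow> (int \<Rightarrow> 'm \<Rightarrow> 'm tangent set) \<Rightarrow> 'm \<Rightarrow> 'm tangent \<Rightarrow> 'm tangent" where
  "witt_delta I V x v = (\<Sum>i\<in>I. ((-1) powi i :: real) *\<^sub>R witt_proj I V i x v)"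

definition V_plus ::
  "('m::topological_space, 'e::euclidean_space) chart set \<Rightarrow> int set \<Rightarrow>
   (int \<Rightarrow> 'm \<Rightarrow> 'm tangent set) \<Rightarrow> 'm \<Rightarrow> 'm tangent set" where
  "V_plus A I V x = {v \<in> tangent_space A x. witt_delta I V x v = v}"

definition V_minus ::
  "('m::topological_space, 'e::euclidean_space) chart set \<Rightarrow> int set \<Rightarrow>
   (int \<Rightarrow> 'm \<Rightarrow> 'm tangent set) \<Rightarrow> 'm \<Rightarrow> 'm tangent set" where
  "V_minus A I V x = {v \<in> tangent_space A x. witt_delta I V x v = - v}"

definition local_witt_isometry ::
  "('m::topological_space, 'e::euclidean_space) chart set \<Rightarrow> 'm metric_field \<Rightarrow>
   int set \<Rightarrow> (int \<Rightarrow> 'm \<Rightarrow> 'm tangent set) \<Rightarrow> 'm set \<Rightarrow> ('m \<Rightarrow> 'm) \<Rightarrow> bool" where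
  "local_witt_isometry A g I V U \<psi> \<longleftrightarrow> local_diffeo A U \<psi> \<and>
     (\<forall>x\<in>U. \<forall>v\<in>tangent_space A x. \<forall>w\<in>tangent_space A x.
        g (\<psi> x) (differential A \<psi> x v) (differential A \<psi> x w) = g x v w) \<and>
     (\<forall>i\<in>I. \<forall>x\<in>U. differential A \<psi> x ` V i x \<subseteq> V i (\<psi> x))"

text \<open>The local Witt symmetry at \<open>x\<close>, on the image of the neighbourhood \<open>N\<close> of \<open>0\<close>.\<close>

definition witt_symmetry ::
  "('m::topological_space, 'e::euclidean_space) chart set \<Rightarrow>
   int set \<Rightarrow> (int \<Rightarrow> 'm \<Rightarrow> 'm tangent set) \<Rightarrow> 'm connection \<Rightarrow> 'm \<Rightarrow> 'm tangent set \<Rightarrow>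
   'm \<Rightarrow> 'm" where
  "witt_symmetry A I V D x N = exp_map A D x \<circ> witt_delta I V x \<circ> inv_into N (exp_map A D x)"

text \<open>The condition \<open>\<delta>\<^sub>x(N) = N\<close> makes the symmetry a map from \<open>U\<close> to \<open>U\<close>.\<close>

definition locally_witt_symmetric ::
  "('m::topological_space, 'e::euclidean_space) chart set \<Rightarrow> 'm metric_field \<Rightarrow>
   int set \<Rightarrow> (int \<Rightarrow> 'm \<Rightarrow> 'm tangent set) \<Rightarrow> 'm connection \<Rightarrow> bool" where
  "locally_witt_symmetric A g I V D \<longleftrightarrow>
     (\<forall>x. \<exists>N U. exp_diffeo A D x N U \<and> witt_delta I V x ` N = N \<and>
        local_witt_isometry A g I V U (witt_symmetry A I V D x N))"

end

theory Submission
  imports Defs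
begin

text \<open>
  The local symmetry \<open>\<psi>\<close> at a point \<open>x\<close> is an isometry that preserves the subbundles \<open>V i\<close>, and the
  canonical connection is determined by the metric and these subbundles. So \<open>\<psi>\<close> preserves the connection
  and everything derived from it: torsion \<open>T\<close>, curvature \<open>R\<close>, \<open>\<nabla>T\<close> and \<open>\<nabla>R\<close>. The differential of \<open>\<psi>\<close>
  at \<open>x\<close> is \<open>\<delta>\<close>, with eigenbundles \<open>V\<^sub>+\<close> and \<open>V\<^sub>-\<close>; invariance at \<open>x\<close> therefore says that each
  of these tensors multiplies the eigenvalues of its arguments (\<open>torsion_E\<close>, \<open>curvature_E\<close>,
  \<open>cov_torsion_delta\<close>, \<open>cov_curvature_delta\<close>). This gives the two statements on \<open>T\<close>, and also
  \<open>T(V\<^sub>+, V\<^sub>+) \<subseteq> V\<^sub>+\<close>. On the other hand \<open>V\<^sub>+\<close> and \<open>V\<^sub>-\<close> are orthogonal complements of each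
  other, so the connection, being metric, preserves them (\<open>D_E\<close>). Then \<open>[X, Y] = \<nabla>\<^sub>X Y - \<nabla>\<^sub>Y X - T(X, Y)\<close>
  lies in \<open>V\<^sub>+\<close> for \<open>X\<close>, \<open>Y\<close> in \<open>V\<^sub>+\<close>. Moreover \<open>R(X, Y)Z\<close> has the parity of \<open>Z\<close>, while invariance
  gives it the opposite parity if \<open>X\<close> is in \<open>V\<^sub>+\<close> and \<open>Y\<close> in \<open>V\<^sub>-\<close>, so it vanishes. Likewise \<open>\<nabla>\<^sub>X T\<close> and
  \<open>\<nabla>\<^sub>X R\<close> have the same parity as \<open>T\<close> and \<open>R\<close>, and for \<open>X\<close> in \<open>V\<^sub>-\<close> the opposite one.

  Two points need work. The first is that \<open>\<psi>\<close> preserves the connection (\<open>related_D\<close>). The difference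
  between the connection and its transport by \<open>\<psi>\<close> is function-linear and skew for the metric, preserves
  each \<open>V i\<close>, and is symmetric on sections of the subbundles, since the formula for the torsion consists of natural
  operations. On \<open>V i \<times> V j\<close> with \<open>i \<noteq> j\<close> it takes values in \<open>V i \<inter> V j = 0\<close>; on \<open>V i \<times> V i\<close> it
  vanishes by the pairing of \<open>V i\<close> with its dual or, for anisotropic \<open>V i\<close>, by the braid argument
  known from the uniqueness of the Levi-Civita connection.

  The second is that \<open>\<delta>\<close> is the differential of \<open>\<psi>\<close> at \<open>x\<close> (\<open>witt_symmetry_differential\<close>). It
  follows from the fact that the exponential map has the identity as its differential at the origin, which
  rests on the uniqueness of geodesics (\<open>geodesic_endpoint_unique\<close>): without it the exponential map,
  a definite description, would carry no information.

  Multiplication by the indicator function of an open set, which is smooth on that set, turns local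
  identities into identities of functions on the whole manifold. It shows that function-linear maps may be evaluated
  at a point on any local sections with prescribed values (\<open>tensorial_pointwise\<close>), and so reduces
  every claim about tensors to sections of the subbundles (\<open>tensorial_sections_zero\<close>).
\<close>

section \<open>Calculus of smooth functions on Euclidean spaces\<close>

lemma frechet_derivative_cong_open:
  assumes "open S" "x \<in> S" "\<And>y. y \<in> S \<Longrightarrow> f y = h y"
  shows "frechet_derivative f (at x) = frechet_derivative h (at x)"
proof -
  have "(f has_derivative f') (at x) \<longleftrightarrow> (h has_derivative f') (at x)" for f'
    using assms has_derivative_transform_within_open[of f f' x UNIV S h]
      has_derivative_transform_within_open[of h f' x UNIV S f] by auto
  then show ?thesis by (simp add: frechet_derivative_def)
qed

lemma differentiable_cong_open:
  assumes "open S" "x \<in> S" "\<And>y. y \<in> S \<Longrightarrow> f y = h y" "f differentiable (at x)"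
  shows "h differentiable (at x)"
  using assms has_derivative_transform_within_open[of f _ x UNIV S h]
  unfolding differentiable_def by blast

lemma Ck_on_cong:
  assumes "open S" "\<And>y. y \<in> S \<Longrightarrow> f y = h y" "Ck_on k S f"
  shows "Ck_on k S h"
  using assms(2,3)
proof (induction k arbitrary: f h)
  case 0
  then show ?case by (simp cong: continuous_on_cong)
next
  case (Suc k)
  have d: "frechet_derivative f (at x) = frechet_derivative h (at x)" if "x \<in> S" for x
    using frechet_derivative_cong_open[OF assms(1) that] Suc.prems(1) by blast
  have "Ck_on k S (\<lambda>x. frechet_derivative h (at x) v)" for v
    using Suc.prems(2) Suc.IH[of "\<lambda>x. frechet_derivative f (at x) v" "\<lambda>x. frechet_derivative h (at x) v"] d by simp
  moreover have "h differentiable (at x)" if "x \<in> S" for x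
    using differentiable_cong_open[OF assms(1) that, of f h] Suc.prems that by simp
  ultimately show ?case by simp
qed

lemma Ck_on_subset: "Ck_on k S f \<Longrightarrow> T \<subseteq> S \<Longrightarrow> Ck_on k T f"
  by (induction k arbitrary: f) (auto intro: continuous_on_subset)

lemma Ck_on_SucD: "Ck_on (Suc k) S f \<Longrightarrow> Ck_on k S f"
proof (induction k arbitrary: f)
  case 0
  then show ?case
    by (auto intro!: continuous_at_imp_continuous_on differentiable_imp_continuous_within)
next
  case (Suc k)
  show ?case using Suc.prems Suc.IH by (simp only: Ck_on.simps) blast
qed

lemma Ck_on_local:
  assumes "\<And>x. x \<in> S \<Longrightarrow> \<exists>T. open T \<and> x \<in> T \<and> Ck_on k T f"
  shows "Ck_on k S f"
  using assms
proof (induction k arbitrary: f)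
  case 0
  show ?case
  proof (simp only: Ck_on.simps, rule continuous_at_imp_continuous_on, rule ballI)
    fix x assume "x \<in> S"
    then obtain T where "open T" "x \<in> T" "continuous_on T f" using 0 by auto
    then show "isCont f x" using continuous_on_eq_continuous_at by blast
  qed
next
  case (Suc k)
  have "Ck_on k S (\<lambda>x. frechet_derivative f (at x) v)" for v
    by (rule Suc.IH) (use Suc.prems in \<open>simp, blast\<close>)
  then show ?case using Suc.prems by auto
qed

lemma Ck_on_const: "Ck_on k S (\<lambda>x. c)"
  by (induction k arbitrary: c) simp_all

lemma Ck_on_linear:
  assumes "bounded_linear f" shows "Ck_on k S f"
proof (cases k)
  case 0
  then show ?thesis using assms by (simp add: linear_continuous_on)
next
  case (Suc j)
  have "frechet_derivative f (at x) = f" for x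
    using frechet_derivative_at[OF bounded_linear_imp_has_derivative[OF assms]] by (rule sym)
  then show ?thesis using Suc assms
    by (simp add: Ck_on_const bounded_linear_imp_differentiable)
qed

lemma Ck_on_add:
  assumes "open S" "Ck_on k S f" "Ck_on k S h"
  shows "Ck_on k S (\<lambda>x. f x + h x)"
  using assms(2,3)
proof (induction k arbitrary: f h)
  case 0
  then show ?case by (simp add: continuous_on_add)
next
  case (Suc k)
  have d: "frechet_derivative (\<lambda>x. f x + h x) (at x) v
      = frechet_derivative f (at x) v + frechet_derivative h (at x) v" if "x \<in> S" for x v
  proof -
    have "((\<lambda>x. f x + h x) has_derivative
        (\<lambda>v. frechet_derivative f (at x) v + frechet_derivative h (at x) v)) (at x)"
      using Suc.prems that by (intro has_derivative_add) (simp_all add: frechet_derivative_works)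
    from fun_cong[OF frechet_derivative_at[OF this], of v] show ?thesis by (rule sym)
  qed
  have "Ck_on k S (\<lambda>x. frechet_derivative (\<lambda>x. f x + h x) (at x) v)" for v
    by (rule Ck_on_cong[OF assms(1) _ Suc.IH[of "\<lambda>x. frechet_derivative f (at x) v"
          "\<lambda>x. frechet_derivative h (at x) v"]]) (use Suc.prems d in auto)
  then show ?case using Suc.prems by (auto intro: differentiable_add)
qed

lemma Ck_on_bilinear:
  fixes f :: "'a::euclidean_space \<Rightarrow> 'b::euclidean_space" and h :: "'a \<Rightarrow> 'c::euclidean_space"
    and bil :: "'b \<Rightarrow> 'c \<Rightarrow> 'd::euclidean_space"
  assumes "open S" "bounded_bilinear bil" "Ck_on k S f" "Ck_on k S h"
  shows "Ck_on k S (\<lambda>x. bil (f x) (h x))"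
  using assms(3,4)
proof (induction k arbitrary: f h)
  case 0
  then show ?case using bounded_bilinear.continuous_on[OF assms(2)] by auto
next
  case (Suc k)
  have D: "((\<lambda>x. bil (f x) (h x)) has_derivative
        (\<lambda>v. bil (f x) (frechet_derivative h (at x) v) + bil (frechet_derivative f (at x) v) (h x))) (at x)"
    if "x \<in> S" for x
    using Suc.prems that
    by (intro bounded_bilinear.FDERIV[OF assms(2)]) (simp_all add: frechet_derivative_works)
  have d: "frechet_derivative (\<lambda>x. bil (f x) (h x)) (at x) v
      = bil (f x) (frechet_derivative h (at x) v) + bil (frechet_derivative f (at x) v) (h x)"
    if "x \<in> S" for x v
    using fun_cong[OF frechet_derivative_at[OF D[OF that]], of v] by (rule sym)
  have "Ck_on k S (\<lambda>x. frechet_derivative (\<lambda>x. bil (f x) (h x)) (at x) v)" for v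
    by (rule Ck_on_cong[OF assms(1) _ Ck_on_add[OF assms(1)
          Suc.IH[of f "\<lambda>x. frechet_derivative h (at x) v"]
          Suc.IH[of "\<lambda>x. frechet_derivative f (at x) v" h]]])
      (use Suc.prems d Suc.prems[THEN Ck_on_SucD] in auto)
  then show ?case using D by (auto simp: differentiable_def)
qed

lemma Ck_on_sum:
  assumes "open S" "\<And>i. i \<in> J \<Longrightarrow> Ck_on k S (f i)"
  shows "Ck_on k S (\<lambda>x. \<Sum>i\<in>J. f i x)"
  using assms(2) by (induction J rule: infinite_finite_induct)
    (simp_all add: Ck_on_const Ck_on_add[OF assms(1)])

text \<open>By the chain rule the directional derivatives of \<open>f (h x)\<close> are sums of products of a coordinate of a
  derivative of \<open>h\<close> and a partial derivative of \<open>f\<close> composed with \<open>h\<close>. The latter is why the induction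
  has to run over all outer functions.\<close>

lemma Ck_on_compose:
  fixes f :: "'b::euclidean_space \<Rightarrow> 'c::euclidean_space" and h :: "'a::euclidean_space \<Rightarrow> 'b"
  assumes "open S" "open T" "h ` S \<subseteq> T" "Ck_on k S h" "Ck_on k T f"
  shows "Ck_on k S (\<lambda>x. f (h x))"
  using assms(4,5)
proof (induction k arbitrary: f)
  case 0
  then show ?case using assms(3) continuous_on_compose2 by auto
next
  case (Suc k)
  have D: "((\<lambda>x. f (h x)) has_derivative
        (\<lambda>v. frechet_derivative f (at (h x)) (frechet_derivative h (at x) v))) (at x)" if "x \<in> S" for x
    using has_derivative_compose[of h _ x UNIV f "frechet_derivative f (at (h x))"]
      Suc.prems that assms(3) by (auto simp: frechet_derivative_works)
  have d: "frechet_derivative (\<lambda>x. f (h x)) (at x) v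
      = (\<Sum>b\<in>Basis. (frechet_derivative h (at x) v \<bullet> b) *\<^sub>R frechet_derivative f (at (h x)) b)"
    if "x \<in> S" for x v
  proof -
    have lin: "linear (frechet_derivative f (at (h x)))"
      using Suc.prems that assms(3) by (intro linear_frechet_derivative) auto
    have "frechet_derivative (\<lambda>x. f (h x)) (at x) v
        = frechet_derivative f (at (h x)) (\<Sum>b\<in>Basis. (frechet_derivative h (at x) v \<bullet> b) *\<^sub>R b)"
      using fun_cong[OF frechet_derivative_at[OF D[OF that]], of v, symmetric]
      by (simp only: euclidean_representation)
    then show ?thesis by (simp add: linear_sum[OF lin] linear_scale[OF lin])
  qed
  have h: "Ck_on k S (\<lambda>x. frechet_derivative h (at x) v \<bullet> b)" for v b
    using Ck_on_bilinear[OF assms(1) bounded_bilinear_inner, of k _ "\<lambda>_. b"] Suc.prems(1)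
    by (simp add: Ck_on_const)
  have f: "Ck_on k S (\<lambda>x. frechet_derivative f (at (h x)) b)" for b
    using Suc.IH[of "\<lambda>y. frechet_derivative f (at y) b"] Suc.prems Suc.prems(1)[THEN Ck_on_SucD]
    by auto
  have "Ck_on k S (\<lambda>x. frechet_derivative (\<lambda>x. f (h x)) (at x) v)" for v
    by (rule Ck_on_cong[OF assms(1) _ Ck_on_sum[OF assms(1)
          Ck_on_bilinear[OF assms(1) bounded_bilinear_scaleR h f]]]) (simp add: d)
  then show ?case using D by (auto simp: differentiable_def)
qed

lemma smooth_on_cong:
  "open S \<Longrightarrow> (\<And>y. y \<in> S \<Longrightarrow> f y = h y) \<Longrightarrow> smooth_on S f \<Longrightarrow> smooth_on S h"
  unfolding smooth_on_def using Ck_on_cong by blast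

lemma smooth_on_subset: "smooth_on S f \<Longrightarrow> T \<subseteq> S \<Longrightarrow> smooth_on T f"
  unfolding smooth_on_def using Ck_on_subset by blast

lemma smooth_on_local:
  assumes "\<And>x. x \<in> S \<Longrightarrow> \<exists>T. open T \<and> x \<in> T \<and> smooth_on T f"
  shows "smooth_on S f"
  unfolding smooth_on_def by (meson Ck_on_local assms smooth_on_def)

lemma smooth_on_const: "smooth_on S (\<lambda>x. c)"
  by (simp add: smooth_on_def Ck_on_const)

lemma smooth_on_linear: "bounded_linear f \<Longrightarrow> smooth_on S f"
  by (simp add: smooth_on_def Ck_on_linear)

lemma smooth_on_add: "open S \<Longrightarrow> smooth_on S f \<Longrightarrow> smooth_on S h \<Longrightarrow> smooth_on S (\<lambda>x. f x + h x)"
  by (simp add: smooth_on_def Ck_on_add)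

lemma smooth_on_bilinear:
  fixes f :: "'a::euclidean_space \<Rightarrow> 'b::euclidean_space" and h :: "'a \<Rightarrow> 'c::euclidean_space"
    and bil :: "'b \<Rightarrow> 'c \<Rightarrow> 'd::euclidean_space"
  shows "bounded_bilinear bil \<Longrightarrow> open S \<Longrightarrow> smooth_on S f \<Longrightarrow> smooth_on S h
    \<Longrightarrow> smooth_on S (\<lambda>x. bil (f x) (h x))"
  by (simp add: smooth_on_def Ck_on_bilinear)

lemmas smooth_on_mult = smooth_on_bilinear[OF bounded_bilinear_mult]
  and smooth_on_scaleR = smooth_on_bilinear[OF bounded_bilinear_scaleR]
  and smooth_on_inner = smooth_on_bilinear[OF bounded_bilinear_inner]

lemma smooth_on_sum:
  "open S \<Longrightarrow> (\<And>i. i \<in> J \<Longrightarrow> smooth_on S (f i)) \<Longrightarrow> smooth_on S (\<lambda>x. \<Sum>i\<in>J. f i x)"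
  by (simp add: smooth_on_def Ck_on_sum)

lemma smooth_on_compose:
  "open S \<Longrightarrow> open T \<Longrightarrow> h ` S \<subseteq> T \<Longrightarrow> smooth_on S h \<Longrightarrow> smooth_on T f \<Longrightarrow> smooth_on S (\<lambda>x. f (h x))"
  by (simp add: smooth_on_def Ck_on_compose)

lemma smooth_on_continuous: "smooth_on S f \<Longrightarrow> continuous_on S f"
  unfolding smooth_on_def by (metis Ck_on.simps(1))

lemma smooth_on_differentiable: "smooth_on S f \<Longrightarrow> x \<in> S \<Longrightarrow> f differentiable (at x)"
  unfolding smooth_on_def by (metis Ck_on.simps(2))

lemma smooth_on_frechet: "smooth_on S f \<Longrightarrow> smooth_on S (\<lambda>x. frechet_derivative f (at x) v)"
  unfolding smooth_on_def by (metis Ck_on.simps(2))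

section \<open>Smooth functions on a manifold\<close>

locale smooth_manifold =
  fixes A :: "('m::{t2_space, second_countable_topology}, 'e::euclidean_space) chart set"
  assumes atlas: "smooth_atlas A"
begin

lemma chart_dom_open: "c \<in> A \<Longrightarrow> open (fst c)"
  using atlas by (auto simp: smooth_atlas_def)

lemma chart_homeo:
  "c \<in> A \<Longrightarrow> homeomorphism (fst c) (snd c ` fst c) (snd c) (chart_inv c)"
  using atlas by (auto simp: smooth_atlas_def)

lemma chart_inv_chart [simp]: "c \<in> A \<Longrightarrow> y \<in> fst c \<Longrightarrow> chart_inv c (snd c y) = y"
  using chart_homeo homeomorphism_apply1 by blast

lemma chart_continuous: "c \<in> A \<Longrightarrow> continuous_on (fst c) (snd c)"
  using chart_homeo homeomorphism_cont1 by blast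

lemma chart_inv_continuous: "c \<in> A \<Longrightarrow> continuous_on (snd c ` fst c) (chart_inv c)"
  using chart_homeo homeomorphism_cont2 by blast

lemma chart_image_open:
  assumes "c \<in> A" "open W" shows "open (snd c ` (W \<inter> fst c))"
proof -
  have "snd c ` (W \<inter> fst c) = snd c ` fst c \<inter> chart_inv c -` W"
    using assms(1) by auto
  moreover have "open (snd c ` fst c)" using atlas assms(1) by (auto simp: smooth_atlas_def)
  ultimately show ?thesis
    using continuous_on_open_vimage[of "snd c ` fst c" "chart_inv c"] chart_inv_continuous[OF assms(1)] assms
    by (metis Int_commute)
qed

lemma chart_cover: obtains c where "c \<in> A" "x \<in> fst c"
  using atlas unfolding smooth_atlas_def by blast

lemma chart_change:
  "c \<in> A \<Longrightarrow> d \<in> A \<Longrightarrow> smooth_on (snd c ` (fst c \<inter> fst d)) (\<lambda>z. snd d (chart_inv c z))"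
  using atlas unfolding smooth_atlas_def comp_def by blast

lemma smooth_fun_iff:
  "smooth_fun A W f \<longleftrightarrow> continuous_on W f \<and>
     (\<forall>c\<in>A. smooth_on (snd c ` (W \<inter> fst c)) (\<lambda>z. f (chart_inv c z)))"
  by (simp add: smooth_fun_def smooth_map_def std_atlas_def comp_def)

lemma smooth_fun_chart:
  "smooth_fun A W f \<Longrightarrow> c \<in> A \<Longrightarrow> smooth_on (snd c ` (W \<inter> fst c)) (\<lambda>z. f (chart_inv c z))"
  by (simp add: smooth_fun_iff)

text \<open>Chart changes are smooth, so smoothness near a point can be tested in a single chart.\<close>

lemma smooth_funI:
  assumes "\<And>x. x \<in> W \<Longrightarrow> \<exists>c\<in>A. \<exists>G. open G \<and> x \<in> G \<inter> fst c \<and>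
      smooth_on (snd c ` (G \<inter> fst c)) (\<lambda>z. f (chart_inv c z))"
  shows "smooth_fun A W f"
  unfolding smooth_fun_iff
proof (intro conjI ballI)
  show "continuous_on W f"
  proof (rule continuous_at_imp_continuous_on, rule ballI)
    fix x assume "x \<in> W"
    then obtain c G where c: "c \<in> A" "open G" "x \<in> G \<inter> fst c"
      and s: "smooth_on (snd c ` (G \<inter> fst c)) (\<lambda>z. f (chart_inv c z))"
      using assms by blast
    have "continuous_on (G \<inter> fst c) (\<lambda>y. f (chart_inv c (snd c y)))"
      by (rule continuous_on_compose2[OF smooth_on_continuous[OF s]])
        (auto intro: continuous_on_subset[OF chart_continuous[OF c(1)]])
    then have "continuous_on (G \<inter> fst c) f"
      by (rule continuous_on_eq) (use c in auto)
    then show "isCont f x"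
      using c chart_dom_open continuous_on_eq_continuous_at by (metis open_Int)
  qed
next
  fix d assume d: "d \<in> A"
  show "smooth_on (snd d ` (W \<inter> fst d)) (\<lambda>z. f (chart_inv d z))"
  proof (rule smooth_on_local)
    fix z assume "z \<in> snd d ` (W \<inter> fst d)"
    then obtain x where x: "x \<in> W" "x \<in> fst d" "z = snd d x" by blast
    then obtain c G where c: "c \<in> A" "open G" "x \<in> G \<inter> fst c"
      and s: "smooth_on (snd c ` (G \<inter> fst c)) (\<lambda>z. f (chart_inv c z))"
      using assms by blast
    define T where "T = snd d ` ((G \<inter> fst c) \<inter> fst d)"
    have T: "open T" unfolding T_def using d c chart_dom_open by (intro chart_image_open open_Int)
    have "smooth_on T (\<lambda>z. snd c (chart_inv d z))"
      by (rule smooth_on_subset[OF chart_change[OF d c(1)]]) (auto simp: T_def)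
    note t = this
    have "smooth_on T (\<lambda>z. f (chart_inv c (snd c (chart_inv d z))))"
    proof (rule smooth_on_compose[OF T chart_image_open[OF c(1,2)] _ t s])
      show "(\<lambda>z. snd c (chart_inv d z)) ` T \<subseteq> snd c ` (G \<inter> fst c)"
      proof (rule image_subsetI)
        fix z assume "z \<in> T"
        then have "chart_inv d z \<in> G \<inter> fst c" using d by (auto simp: T_def)
        then show "snd c (chart_inv d z) \<in> snd c ` (G \<inter> fst c)" by (rule imageI)
      qed
    qed
    then have "smooth_on T (\<lambda>z. f (chart_inv d z))"
      by (rule smooth_on_cong[OF T, rotated]) (use d c in \<open>auto simp: T_def\<close>)
    then show "\<exists>T. open T \<and> z \<in> T \<and> smooth_on T (\<lambda>z. f (chart_inv d z))"
      using T c x by (auto simp: T_def)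
  qed
qed

lemma smooth_fun_subset: "smooth_fun A W f \<Longrightarrow> W' \<subseteq> W \<Longrightarrow> smooth_fun A W' f"
  unfolding smooth_fun_iff
  by (auto intro: continuous_on_subset smooth_on_subset[OF _ image_mono[OF Int_mono]])

lemma smooth_fun_cong:
  assumes "open W" "\<And>y. y \<in> W \<Longrightarrow> f y = h y" "smooth_fun A W f"
  shows "smooth_fun A W h"
proof -
  have "smooth_on (snd c ` (W \<inter> fst c)) (\<lambda>z. h (chart_inv c z))" if "c \<in> A" for c
    by (rule smooth_on_cong[OF chart_image_open[OF that assms(1)] _ smooth_fun_chart[OF assms(3) that]])
      (use that assms(2) in auto)
  moreover have "continuous_on W h"
    using assms(2,3) continuous_on_eq unfolding smooth_fun_iff by blast
  ultimately show ?thesis by (simp add: smooth_fun_iff)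
qed

lemma smooth_fun_const: "smooth_fun A W (\<lambda>x. a)"
  by (simp add: smooth_fun_iff smooth_on_const)

lemma smooth_fun_add:
  "open W \<Longrightarrow> smooth_fun A W f \<Longrightarrow> smooth_fun A W h \<Longrightarrow> smooth_fun A W (\<lambda>x. f x + h x)"
  unfolding smooth_fun_iff by (auto intro!: continuous_on_add smooth_on_add chart_image_open)

lemma smooth_fun_mult:
  "open W \<Longrightarrow> smooth_fun A W f \<Longrightarrow> smooth_fun A W h \<Longrightarrow> smooth_fun A W (\<lambda>x. f x * h x)"
  unfolding smooth_fun_iff by (auto intro!: continuous_on_mult smooth_on_mult chart_image_open)

lemma smooth_fun_diff:
  "open W \<Longrightarrow> smooth_fun A W f \<Longrightarrow> smooth_fun A W h \<Longrightarrow> smooth_fun A W (\<lambda>x. f x - h x)"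
  using smooth_fun_add[of W f "\<lambda>x. (-1) * h x"] smooth_fun_mult[of W "\<lambda>_. -1" h] smooth_fun_const[of W "-1"]
  by simp

lemma smooth_fun_coord: "c \<in> A \<Longrightarrow> smooth_fun A (fst c) (\<lambda>y. snd c y \<bullet> b)"
proof (rule smooth_funI)
  fix x assume c: "c \<in> A" and x: "x \<in> fst c"
  have o: "open (snd c ` (fst c \<inter> fst c))" using c chart_dom_open by (intro chart_image_open)
  have "smooth_on (snd c ` (fst c \<inter> fst c)) (\<lambda>z. z \<bullet> b)"
    by (intro smooth_on_linear bounded_linear_inner_left)
  then have "smooth_on (snd c ` (fst c \<inter> fst c)) (\<lambda>z. snd c (chart_inv c z) \<bullet> b)"
    by (rule smooth_on_cong[OF o, rotated]) (use c in auto)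
  then show "\<exists>c'\<in>A. \<exists>G. open G \<and> x \<in> G \<inter> fst c' \<and>
      smooth_on (snd c' ` (G \<inter> fst c')) (\<lambda>z. snd c (chart_inv c' z) \<bullet> b)"
    using c x chart_dom_open[OF c] by (intro bexI[of _ c] exI[of _ "fst c"]) auto
qed

lemma smooth_fun_from_chart:
  assumes "c \<in> A" "open W" "W \<subseteq> fst c" "smooth_on (snd c ` W) k"
  shows "smooth_fun A W (\<lambda>y. k (snd c y))"
proof (rule smooth_funI)
  fix x assume x: "x \<in> W"
  have W: "W \<inter> fst c = W" using assms(3) by blast
  have "smooth_on (snd c ` W) (\<lambda>z. k (snd c (chart_inv c z)))"
    using assms chart_image_open[OF assms(1,2)] W by (intro smooth_on_cong[OF _ _ assms(4)]) auto
  then show "\<exists>c'\<in>A. \<exists>G. open G \<and> x \<in> G \<inter> fst c' \<and>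
      smooth_on (snd c' ` (G \<inter> fst c')) (\<lambda>z. k (snd c (chart_inv c' z)))"
    using x assms W by (intro bexI[of _ c] exI[of _ W]) auto
qed

lemma smooth_fun_pullback:
  assumes "open W" "smooth_map A A W \<psi>" "open G" "smooth_fun A G f"
  shows "open (W \<inter> \<psi> -` G)" "smooth_fun A (W \<inter> \<psi> -` G) (\<lambda>y. f (\<psi> y))"
proof -
  have o: "open (W \<inter> \<psi> -` H)" if "open H" for H
    using assms(1,2) that continuous_on_open_vimage[of W \<psi>] unfolding smooth_map_def by (metis Int_commute)
  then show "open (W \<inter> \<psi> -` G)" using assms(3) .
  show "smooth_fun A (W \<inter> \<psi> -` G) (\<lambda>y. f (\<psi> y))"
  proof (rule smooth_funI)
    fix x assume x: "x \<in> W \<inter> \<psi> -` G"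
    obtain c where c: "c \<in> A" "x \<in> fst c" using chart_cover .
    obtain d where d: "d \<in> A" "\<psi> x \<in> fst d" using chart_cover .
    define H where "H = W \<inter> \<psi> -` (G \<inter> fst d)"
    have H: "open H" unfolding H_def using o assms(3) chart_dom_open d(1) by blast
    have oc: "open (snd c ` (H \<inter> fst c))" using chart_image_open[OF c(1) H] .
    have s: "smooth_on (snd c ` (H \<inter> fst c)) (\<lambda>z. snd d (\<psi> (chart_inv c z)))"
    proof (rule smooth_on_subset)
      show "smooth_on (snd c ` (W \<inter> fst c \<inter> \<psi> -` fst d)) (\<lambda>z. snd d (\<psi> (chart_inv c z)))"
        using assms(2) c(1) d(1) unfolding smooth_map_def comp_def by blast
    qed (auto simp: H_def)
    have "smooth_on (snd c ` (H \<inter> fst c)) (\<lambda>z. f (chart_inv d (snd d (\<psi> (chart_inv c z)))))"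
    proof (rule smooth_on_compose[OF oc chart_image_open[OF d(1) assms(3)] _ s smooth_fun_chart[OF assms(4) d(1)]])
      show "(\<lambda>z. snd d (\<psi> (chart_inv c z))) ` snd c ` (H \<inter> fst c) \<subseteq> snd d ` (G \<inter> fst d)"
      proof (rule image_subsetI)
        fix z assume "z \<in> snd c ` (H \<inter> fst c)"
        then have "\<psi> (chart_inv c z) \<in> G \<inter> fst d" using c(1) by (auto simp: H_def)
        then show "snd d (\<psi> (chart_inv c z)) \<in> snd d ` (G \<inter> fst d)" by (rule imageI)
      qed
    qed
    then have "smooth_on (snd c ` (H \<inter> fst c)) (\<lambda>z. f (\<psi> (chart_inv c z)))"
      by (rule smooth_on_cong[OF oc, rotated]) (use c d in \<open>auto simp: H_def\<close>)
    then show "\<exists>c\<in>A. \<exists>G. open G \<and> x \<in> G \<inter> fst c \<and>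
      smooth_on (snd c ` (G \<inter> fst c)) (\<lambda>z. f (\<psi> (chart_inv c z)))"
      using x c d H by (intro bexI[of _ c] exI[of _ H]) (auto simp: H_def)
  qed
qed

lemma smooth_on_pullback:
  fixes F :: "'a::euclidean_space \<Rightarrow> 'm"
  assumes "open W" "smooth_map std_atlas A W F" "open G" "smooth_fun A G f"
  shows "open (W \<inter> F -` G)" "smooth_on (W \<inter> F -` G) (\<lambda>y. f (F y))"
proof -
  have o: "open (W \<inter> F -` H)" if "open H" for H
    using assms(1,2) that continuous_on_open_vimage[of W F] unfolding smooth_map_def by (metis Int_commute)
  then show "open (W \<inter> F -` G)" using assms(3) .
  show "smooth_on (W \<inter> F -` G) (\<lambda>y. f (F y))"
  proof (rule smooth_on_local)
    fix x assume x: "x \<in> W \<inter> F -` G"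
    obtain d where d: "d \<in> A" "F x \<in> fst d" using chart_cover .
    define H where "H = W \<inter> F -` (G \<inter> fst d)"
    have H: "open H" unfolding H_def using o assms(3) chart_dom_open d(1) by blast
    have s: "smooth_on H (\<lambda>z. snd d (F z))"
    proof (rule smooth_on_subset)
      show "smooth_on (W \<inter> F -` fst d) (\<lambda>z. snd d (F z))"
        using assms(2) d(1) by (simp add: smooth_map_def std_atlas_def comp_def)
    qed (auto simp: H_def)
    have "smooth_on H (\<lambda>z. f (chart_inv d (snd d (F z))))"
    proof (rule smooth_on_compose[OF H chart_image_open[OF d(1) assms(3)] _ s smooth_fun_chart[OF assms(4) d(1)]])
      show "(\<lambda>z. snd d (F z)) ` H \<subseteq> snd d ` (G \<inter> fst d)"
      proof (rule image_subsetI)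
        fix z assume "z \<in> H"
        then have "F z \<in> G \<inter> fst d" by (simp add: H_def)
        then show "snd d (F z) \<in> snd d ` (G \<inter> fst d)" by (rule imageI)
      qed
    qed
    then have "smooth_on H (\<lambda>z. f (F z))"
      by (rule smooth_on_cong[OF H, rotated]) (use d in \<open>auto simp: H_def\<close>)
    then show "\<exists>T. open T \<and> x \<in> T \<and> smooth_on T (\<lambda>y. f (F y))"
      using x d H by (intro exI[of _ H]) (auto simp: H_def)
  qed
qed

lemma smooth_atI: "open W \<Longrightarrow> x \<in> W \<Longrightarrow> smooth_fun A W f \<Longrightarrow> smooth_at A x f"
  unfolding smooth_at_def by blast

lemma smooth_at_add: "smooth_at A x f \<Longrightarrow> smooth_at A x h \<Longrightarrow> smooth_at A x (\<lambda>y. f y + h y)"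
  unfolding smooth_at_def
  by (elim exE conjE, rule_tac x="U \<inter> Ua" in exI) (auto intro: smooth_fun_add smooth_fun_subset)

lemma smooth_at_mult: "smooth_at A x f \<Longrightarrow> smooth_at A x h \<Longrightarrow> smooth_at A x (\<lambda>y. f y * h y)"
  unfolding smooth_at_def
  by (elim exE conjE, rule_tac x="U \<inter> Ua" in exI) (auto intro: smooth_fun_mult smooth_fun_subset)

lemma smooth_at_const: "smooth_at A x (\<lambda>y. a)"
  using smooth_atI[OF open_UNIV UNIV_I smooth_fun_const] .

lemma smooth_at_cong:
  assumes "open G" "x \<in> G" "\<And>y. y \<in> G \<Longrightarrow> f y = h y"
  shows "smooth_at A x f \<longleftrightarrow> smooth_at A x h"
proof -
  have "smooth_at A x h'" if f': "smooth_at A x f'" and eq: "\<And>y. y \<in> G \<Longrightarrow> f' y = h' y" for f' h'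
  proof -
    obtain W where W: "open W" "x \<in> W" "smooth_fun A W f'"
      using f' unfolding smooth_at_def by blast
    have "smooth_fun A (W \<inter> G) h'"
      using smooth_fun_cong[of "W \<inter> G" f' h'] smooth_fun_subset[OF W(3), of "W \<inter> G"] W(1) assms(1) eq
      by auto
    then show ?thesis using W(1,2) assms(1,2) by (intro smooth_atI[of "W \<inter> G"]) auto
  qed
  from this[of f h] this[of h f] show ?thesis using assms(3) by auto
qed

lemma smooth_at_coord: "c \<in> A \<Longrightarrow> x \<in> fst c \<Longrightarrow> smooth_at A x (\<lambda>y. snd c y \<bullet> b)"
  using smooth_atI chart_dom_open smooth_fun_coord by blast

end

lemma sum_fun_apply: "(\<Sum>i\<in>J. f i) x = (\<Sum>i\<in>J. f i x)"
  by (induction J rule: infinite_finite_induct) simp_all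

text \<open>Vector fields are local and their values outside their domain are arbitrary, so linearity over the
  smooth functions is required on every open subset \<open>W\<close> of \<open>U\<close>. The values lie in any vector space,
  which covers real-valued expressions such as \<open>Z \<mapsto> (\<L>\<^sub>X \<alpha>)(Z)\<close> as well as vector-valued ones.\<close>

definition tensorial ::
  "('m::topological_space, 'e::euclidean_space) chart set \<Rightarrow> 'm set \<Rightarrow>
   ('m vfield \<Rightarrow> 'm \<Rightarrow> 'v::real_vector) \<Rightarrow> bool" where
  "tensorial A U F \<longleftrightarrow> (\<forall>W. open W \<longrightarrow> W \<subseteq> U \<longrightarrow>
     (\<forall>X\<in>vfields A W. \<forall>Y\<in>vfields A W. \<forall>x\<in>W. F (X + Y) x = F X x + F Y x) \<and>
     (\<forall>f X. smooth_fun A W f \<longrightarrow> X \<in> vfields A W \<longrightarrow> (\<forall>x\<in>W.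
        F (\<lambda>y. f y *\<^sub>R X y) x = f x *\<^sub>R F X x)))"

context smooth_manifold
begin

section \<open>Tangent vectors\<close>

lemma tangent_nonsmooth: "v \<in> tangent_space A x \<Longrightarrow> \<not> smooth_at A x f \<Longrightarrow> v f = 0"
  by (simp add: tangent_space_def)

lemma tangent_lincomb:
  "v \<in> tangent_space A x \<Longrightarrow> smooth_at A x f \<Longrightarrow> smooth_at A x h \<Longrightarrow>
    v (\<lambda>y. a * f y + b * h y) = a * v f + b * v h"
  by (simp add: tangent_space_def)

lemma tangent_mult:
  "v \<in> tangent_space A x \<Longrightarrow> smooth_at A x f \<Longrightarrow> smooth_at A x h \<Longrightarrow>
    v (\<lambda>y. f y * h y) = f x * v h + h x * v f"
  by (simp add: tangent_space_def)

lemma tangent_add: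
  "v \<in> tangent_space A x \<Longrightarrow> smooth_at A x f \<Longrightarrow> smooth_at A x h \<Longrightarrow>
    v (\<lambda>y. f y + h y) = v f + v h"
  using tangent_lincomb[of v x f h 1 1] by simp

lemma tangent_const: assumes "v \<in> tangent_space A x" shows "v (\<lambda>y. a) = 0"
proof -
  have "v (\<lambda>y. 1) = 0" using tangent_mult[OF assms smooth_at_const smooth_at_const, of 1 1] by simp
  then show ?thesis
    using tangent_lincomb[OF assms smooth_at_const smooth_at_const, of a 1 0 1] by simp
qed

text \<open>The indicator function of an open neighbourhood of \<open>x\<close> is smooth near \<open>x\<close> and equal to its
  square, so every derivation annihilates it; multiplying by it cuts functions down to their germs.\<close>

lemma tangent_germ:
  assumes v: "v \<in> tangent_space A x" and G: "open G" "x \<in> G" and eq: "\<And>y. y \<in> G \<Longrightarrow> f y = h y"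
  shows "v f = v h"
proof (cases "smooth_at A x f")
  case True
  then have h: "smooth_at A x h" using smooth_at_cong[OF G eq] by simp
  define i :: "'m \<Rightarrow> real" where "i = indicator G"
  have i: "smooth_at A x i"
    using smooth_at_cong[OF G, of i "\<lambda>_. 1"] smooth_at_const by (simp add: i_def)
  have ix: "i x = 1" using G by (simp add: i_def)
  have "(\<lambda>y. i y * i y) = i" by (auto simp: i_def indicator_def)
  then have "v i = 0" using tangent_mult[OF v i i] ix by simp
  then have cut: "v (\<lambda>y. k y * i y) = v k" if "smooth_at A x k" for k
    using tangent_mult[OF v that i] ix by simp
  have "(\<lambda>y. f y * i y) = (\<lambda>y. h y * i y)" using eq by (auto simp: i_def indicator_def)
  then show ?thesis using cut[OF True] cut[OF h] by simp
next
  case False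
  then have "\<not> smooth_at A x h" using smooth_at_cong[OF G eq] by simp
  then show ?thesis using False tangent_nonsmooth[OF v] by simp
qed

lemma tangent_spaceI:
  assumes "\<And>f. \<not> smooth_at A x f \<Longrightarrow> v f = 0"
    and "\<And>f h a b. smooth_at A x f \<Longrightarrow> smooth_at A x h \<Longrightarrow>
        v (\<lambda>y. a * f y + b * h y) = a * v f + b * v h"
    and "\<And>f h. smooth_at A x f \<Longrightarrow> smooth_at A x h \<Longrightarrow>
        v (\<lambda>y. f y * h y) = f x * v h + h x * v f"
  shows "v \<in> tangent_space A x"
  using assms by (simp add: tangent_space_def)

lemma tangent_subspace: "subspace (tangent_space A x)"
  by (auto simp: subspace_def tangent_space_def algebra_simps)

lemma tangent_zero [simp]: "0 \<in> tangent_space A x"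
  by (rule subspace_0[OF tangent_subspace])
lemma tangent_plus: "v \<in> tangent_space A x \<Longrightarrow> w \<in> tangent_space A x \<Longrightarrow> v + w \<in> tangent_space A x"
  by (rule subspace_add[OF tangent_subspace])
lemma tangent_minus: "v \<in> tangent_space A x \<Longrightarrow> w \<in> tangent_space A x \<Longrightarrow> v - w \<in> tangent_space A x"
  by (rule subspace_diff[OF tangent_subspace])
lemma tangent_scale: "v \<in> tangent_space A x \<Longrightarrow> a *\<^sub>R v \<in> tangent_space A x"
  by (rule subspace_scale[OF tangent_subspace])
lemma tangent_sum: "(\<And>i. i \<in> J \<Longrightarrow> v i \<in> tangent_space A x) \<Longrightarrow> (\<Sum>i\<in>J. v i) \<in> tangent_space A x"
  by (rule subspace_sum[OF tangent_subspace])

section \<open>Vector fields\<close>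

lemma vf_tangent: "X \<in> vfields A U \<Longrightarrow> x \<in> U \<Longrightarrow> X x \<in> tangent_space A x"
  by (simp add: vfields_def)

lemma vf_smooth: "X \<in> vfields A U \<Longrightarrow> open W \<Longrightarrow> W \<subseteq> U \<Longrightarrow> smooth_fun A W f \<Longrightarrow> smooth_fun A W (\<lambda>x. X x f)"
  by (simp add: vfields_def)

lemma vf_smooth_at:
  assumes "X \<in> vfields A U" "open U" "x \<in> U" "smooth_at A x f"
  shows "smooth_at A x (\<lambda>y. X y f)"
proof -
  obtain W where W: "open W" "x \<in> W" "smooth_fun A W f" using assms(4) unfolding smooth_at_def by blast
  then have "smooth_fun A (U \<inter> W) (\<lambda>y. X y f)"
    using assms by (intro vf_smooth[OF assms(1)] smooth_fun_subset[OF W(3)]) auto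
  then show ?thesis using W assms by (intro smooth_atI[of "U \<inter> W"]) auto
qed

lemma vfieldsI:
  assumes "\<And>x. x \<in> U \<Longrightarrow> X x \<in> tangent_space A x"
    and "\<And>W f. open W \<Longrightarrow> W \<subseteq> U \<Longrightarrow> smooth_fun A W f \<Longrightarrow> smooth_fun A W (\<lambda>x. X x f)"
  shows "X \<in> vfields A U"
  using assms by (simp add: vfields_def)

lemma vfields_subset: "X \<in> vfields A U \<Longrightarrow> W \<subseteq> U \<Longrightarrow> X \<in> vfields A W"
  unfolding vfields_def by auto

lemma vf_plus: "X \<in> vfields A U \<Longrightarrow> Y \<in> vfields A U \<Longrightarrow> X + Y \<in> vfields A U"
  by (rule vfieldsI) (simp_all add: vf_tangent tangent_plus vf_smooth smooth_fun_add)

lemma vf_minus: "X \<in> vfields A U \<Longrightarrow> Y \<in> vfields A U \<Longrightarrow> X - Y \<in> vfields A U"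
  by (rule vfieldsI) (simp_all add: vf_tangent tangent_minus vf_smooth smooth_fun_diff)

lemma vf_zero: "0 \<in> vfields A U"
  by (rule vfieldsI) (simp_all add: smooth_fun_const)

lemma vf_scale: "smooth_fun A U f \<Longrightarrow> X \<in> vfields A U \<Longrightarrow> (\<lambda>y. f y *\<^sub>R X y) \<in> vfields A U"
  by (rule vfieldsI) (auto simp: vf_tangent tangent_scale vf_smooth intro!: smooth_fun_mult intro: smooth_fun_subset)

lemma vf_scaleR: "X \<in> vfields A U \<Longrightarrow> (\<lambda>y. a *\<^sub>R X y) \<in> vfields A U"
  by (rule vf_scale[OF smooth_fun_const])

lemma vf_sum: "(\<And>i. i \<in> J \<Longrightarrow> X i \<in> vfields A U) \<Longrightarrow> (\<Sum>i\<in>J. X i) \<in> vfields A U"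
  by (induction J rule: infinite_finite_induct) (simp_all add: vf_zero vf_plus)

lemma smooth_atE:
  assumes "smooth_at A x f" "open U" "x \<in> U"
  obtains W where "open W" "x \<in> W" "W \<subseteq> U" "smooth_fun A W f" "\<And>y. y \<in> W \<Longrightarrow> smooth_at A y f"
proof -
  obtain W where W: "open W" "x \<in> W" "smooth_fun A W f" using assms(1) unfolding smooth_at_def by blast
  have "smooth_fun A (W \<inter> U) f" using W(3) smooth_fun_subset by blast
  then show thesis using that[of "W \<inter> U"] W assms smooth_atI[of "W \<inter> U" _ f] by auto
qed

lemma lie_bracket_apply:
  "smooth_at A x f \<Longrightarrow> lie_bracket A X Y x f = X x (\<lambda>y. Y y f) - Y x (\<lambda>y. X y f)"
  by (simp add: lie_bracket_def)

lemma vf_lincomb_at: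
  assumes "X \<in> vfields A U" "Y \<in> vfields A U" "open U" "x \<in> U" "smooth_at A x f" "smooth_at A x h"
  shows "X x (\<lambda>y. Y y (\<lambda>z. a * f z + b * h z)) = a * X x (\<lambda>y. Y y f) + b * X x (\<lambda>y. Y y h)"
proof -
  obtain W where W: "open W" "x \<in> W" "W \<subseteq> U" "\<And>y. y \<in> W \<Longrightarrow> smooth_at A y f"
    using smooth_atE[OF assms(5,3,4)] by metis
  obtain W' where W': "open W'" "x \<in> W'" "W' \<subseteq> W" "\<And>y. y \<in> W' \<Longrightarrow> smooth_at A y h"
    using smooth_atE[OF assms(6) W(1,2)] by metis
  have "X x (\<lambda>y. Y y (\<lambda>z. a * f z + b * h z)) = X x (\<lambda>y. a * Y y f + b * Y y h)"
  proof (rule tangent_germ[OF vf_tangent[OF assms(1,4)] W'(1,2)])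
    fix y assume y: "y \<in> W'"
    then have "y \<in> U" using W'(3) W(3) by blast
    then show "Y y (\<lambda>z. a * f z + b * h z) = a * Y y f + b * Y y h"
      using y W' W by (intro tangent_lincomb[OF vf_tangent[OF assms(2)]]) auto
  qed
  also have "\<dots> = a * X x (\<lambda>y. Y y f) + b * X x (\<lambda>y. Y y h)"
    using assms by (intro tangent_lincomb[OF vf_tangent[OF assms(1)]] vf_smooth_at[OF assms(2)]) auto
  finally show ?thesis .
qed

lemma vf_mult_at:
  assumes "X \<in> vfields A U" "Y \<in> vfields A U" "open U" "x \<in> U" "smooth_at A x f" "smooth_at A x h"
  shows "X x (\<lambda>y. Y y (\<lambda>z. f z * h z)) = f x * X x (\<lambda>y. Y y h) + Y x h * X x f
     + (h x * X x (\<lambda>y. Y y f) + Y x f * X x h)"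
proof -
  obtain W where W: "open W" "x \<in> W" "W \<subseteq> U" "\<And>y. y \<in> W \<Longrightarrow> smooth_at A y f"
    using smooth_atE[OF assms(5,3,4)] by metis
  obtain W' where W': "open W'" "x \<in> W'" "W' \<subseteq> W" "\<And>y. y \<in> W' \<Longrightarrow> smooth_at A y h"
    using smooth_atE[OF assms(6) W(1,2)] by metis
  have sf: "smooth_at A x (\<lambda>y. Y y f)" and sh: "smooth_at A x (\<lambda>y. Y y h)"
    using assms by (auto intro: vf_smooth_at)
  have "X x (\<lambda>y. Y y (\<lambda>z. f z * h z)) = X x (\<lambda>y. f y * Y y h + h y * Y y f)"
  proof (rule tangent_germ[OF vf_tangent[OF assms(1,4)] W'(1,2)])
    fix y assume y: "y \<in> W'"
    then have "y \<in> U" using W'(3) W(3) by blast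
    then show "Y y (\<lambda>z. f z * h z) = f y * Y y h + h y * Y y f"
      using y W' W by (intro tangent_mult vf_tangent[OF assms(2)]) auto
  qed
  also have "\<dots> = X x (\<lambda>y. f y * Y y h) + X x (\<lambda>y. h y * Y y f)"
    using assms sf sh by (intro tangent_add[OF vf_tangent[OF assms(1,4)]] smooth_at_mult) auto
  finally show ?thesis
    using tangent_mult[OF vf_tangent[OF assms(1,4)]] assms sf sh by simp
qed

lemma vf_lie_bracket:
  assumes "open U" "X \<in> vfields A U" "Y \<in> vfields A U"
  shows "lie_bracket A X Y \<in> vfields A U"
proof (rule vfieldsI)
  fix x assume x: "x \<in> U"
  show "lie_bracket A X Y x \<in> tangent_space A x"
  proof (rule tangent_spaceI)
    fix f h a b assume fh: "smooth_at A x f" "smooth_at A x h"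
    have "smooth_at A x (\<lambda>y. a * f y + b * h y)"
      using fh by (intro smooth_at_add smooth_at_mult smooth_at_const)
    then show "lie_bracket A X Y x (\<lambda>y. a * f y + b * h y)
        = a * lie_bracket A X Y x f + b * lie_bracket A X Y x h"
      using fh by (simp add: lie_bracket_apply vf_lincomb_at[OF assms(2,3,1) x fh]
          vf_lincomb_at[OF assms(3,2,1) x fh] algebra_simps)
    show "lie_bracket A X Y x (\<lambda>y. f y * h y)
        = f x * lie_bracket A X Y x h + h x * lie_bracket A X Y x f"
      using fh by (simp add: lie_bracket_apply smooth_at_mult vf_mult_at[OF assms(2,3,1) x fh]
          vf_mult_at[OF assms(3,2,1) x fh] algebra_simps)
  qed (simp add: lie_bracket_def)
next
  fix W f assume W: "open W" "W \<subseteq> U" "smooth_fun A W f"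
  have "smooth_fun A W (\<lambda>x. X x (\<lambda>y. Y y f) - Y x (\<lambda>y. X y f))"
    using W assms by (intro smooth_fun_diff vf_smooth[OF assms(2)] vf_smooth[OF assms(3)])
  then show "smooth_fun A W (\<lambda>x. lie_bracket A X Y x f)"
    by (rule smooth_fun_cong[OF W(1), rotated]) (use W smooth_atI in \<open>auto simp: lie_bracket_apply\<close>)
qed

lemma vf_eqI:
  assumes "v \<in> tangent_space A x" "w \<in> tangent_space A x"
    and "\<And>f. smooth_at A x f \<Longrightarrow> v f = w f"
  shows "v = w"
  using assms tangent_nonsmooth by (metis ext)

lemma lie_bracket_skew: "lie_bracket A X Y x = - lie_bracket A Y X x"
  by (rule ext) (simp add: lie_bracket_def)

lemma lie_bracket_add_right:
  assumes "open U" "x \<in> U" "X \<in> vfields A U" "Y \<in> vfields A U" "Z \<in> vfields A U"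
  shows "lie_bracket A X (Y + Z) x = lie_bracket A X Y x + lie_bracket A X Z x"
proof
  fix f
  show "lie_bracket A X (Y + Z) x f = (lie_bracket A X Y x + lie_bracket A X Z x) f"
  proof (cases "smooth_at A x f")
    case True
    then have "X x (\<lambda>y. Y y f + Z y f) = X x (\<lambda>y. Y y f) + X x (\<lambda>y. Z y f)"
      using assms vf_smooth_at by (intro tangent_add[OF vf_tangent[OF assms(3,2)]]) blast+
    then show ?thesis using True by (simp add: lie_bracket_apply)
  qed (simp add: lie_bracket_def)
qed

lemma lie_bracket_scale_right:
  assumes "open U" "x \<in> U" "X \<in> vfields A U" "Y \<in> vfields A U" "smooth_fun A U f"
  shows "lie_bracket A X (\<lambda>y. f y *\<^sub>R Y y) x = f x *\<^sub>R lie_bracket A X Y x + X x f *\<^sub>R Y x"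
proof
  fix h
  have f: "smooth_at A x f" using assms smooth_atI by blast
  show "lie_bracket A X (\<lambda>y. f y *\<^sub>R Y y) x h = (f x *\<^sub>R lie_bracket A X Y x + X x f *\<^sub>R Y x) h"
  proof (cases "smooth_at A x h")
    case True
    have "X x (\<lambda>y. f y * Y y h) = f x * X x (\<lambda>y. Y y h) + Y x h * X x f"
      using assms True f vf_smooth_at by (intro tangent_mult[OF vf_tangent[OF assms(3,2)]]) blast+
    then show ?thesis using True by (simp add: lie_bracket_apply algebra_simps)
  next
    case False
    then show ?thesis using tangent_nonsmooth[OF vf_tangent[OF assms(4,2)]] by (simp add: lie_bracket_def)
  qed
qed

lemma lie_bracket_add_left:
  assumes "open U" "x \<in> U" "X \<in> vfields A U" "Y \<in> vfields A U" "Z \<in> vfields A U"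
  shows "lie_bracket A (X + Y) Z x = lie_bracket A X Z x + lie_bracket A Y Z x"
  using lie_bracket_add_right[OF assms(1,2,5,3,4)] lie_bracket_skew[of _ Z]
  by (metis add.inverse_distrib_swap add.commute)

lemma lie_bracket_scale_left:
  assumes "open U" "x \<in> U" "X \<in> vfields A U" "Y \<in> vfields A U" "smooth_fun A U f"
  shows "lie_bracket A (\<lambda>y. f y *\<^sub>R X y) Y x = f x *\<^sub>R lie_bracket A X Y x - Y x f *\<^sub>R X x"
proof -
  have "lie_bracket A (\<lambda>y. f y *\<^sub>R X y) Y x = - lie_bracket A Y (\<lambda>y. f y *\<^sub>R X y) x"
    by (rule lie_bracket_skew)
  also have "\<dots> = - (f x *\<^sub>R lie_bracket A Y X x + Y x f *\<^sub>R X x)"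
    by (simp only: lie_bracket_scale_right[OF assms(1,2,4,3,5)])
  also have "lie_bracket A Y X x = - lie_bracket A X Y x" by (rule lie_bracket_skew)
  finally show ?thesis
    by (simp only: minus_add_distrib scaleR_minus_right minus_minus diff_conv_add_uminus)
qed

section \<open>Coordinate vector fields\<close>

lemma smooth_at_chart_differentiable:
  assumes "c \<in> A" "x \<in> fst c" "smooth_at A x f"
  shows "(f \<circ> chart_inv c) differentiable (at (snd c x))"
proof -
  obtain W where W: "open W" "x \<in> W" "smooth_fun A W f" using assms(3) unfolding smooth_at_def by blast
  show ?thesis
    using smooth_on_differentiable[OF smooth_fun_chart[OF W(3) assms(1)], of "snd c x"] W assms
    by (simp add: comp_def)
qed

lemma coord_field_apply:
  "smooth_at A y f \<Longrightarrow> coord_field A c b y f = frechet_derivative (f \<circ> chart_inv c) (at (snd c y)) b"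
  by (simp add: coord_field_def)

lemma coord_field_vfields:
  assumes c: "c \<in> A" shows "coord_field A c b \<in> vfields A (fst c)"
proof (rule vfieldsI)
  fix x assume x: "x \<in> fst c"
  show "coord_field A c b x \<in> tangent_space A x"
  proof (rule tangent_spaceI)
    fix f h \<alpha> \<beta> assume fh: "smooth_at A x f" "smooth_at A x h"
    let ?F = "f \<circ> chart_inv c" and ?H = "h \<circ> chart_inv c" and ?z = "snd c x"
    have D: "(?F has_derivative frechet_derivative ?F (at ?z)) (at ?z)"
      "(?H has_derivative frechet_derivative ?H (at ?z)) (at ?z)"
      using smooth_at_chart_differentiable[OF c x] fh by (simp_all add: frechet_derivative_works)
    have "((\<lambda>z. \<alpha> * ?F z + \<beta> * ?H z) has_derivative
        (\<lambda>v. \<alpha> * frechet_derivative ?F (at ?z) v + \<beta> * frechet_derivative ?H (at ?z) v)) (at ?z)"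
      by (intro has_derivative_add has_derivative_mult_right D)
    from fun_cong[OF frechet_derivative_at[OF this], of b]
    show "coord_field A c b x (\<lambda>y. \<alpha> * f y + \<beta> * h y)
        = \<alpha> * coord_field A c b x f + \<beta> * coord_field A c b x h"
      using fh smooth_at_add[OF smooth_at_mult[OF smooth_at_const] smooth_at_mult[OF smooth_at_const]]
      by (simp add: coord_field_apply comp_def)
    have "((\<lambda>z. ?F z * ?H z) has_derivative
        (\<lambda>v. ?F ?z * frechet_derivative ?H (at ?z) v + frechet_derivative ?F (at ?z) v * ?H ?z)) (at ?z)"
      by (intro has_derivative_mult D)
    from fun_cong[OF frechet_derivative_at[OF this], of b]
    show "coord_field A c b x (\<lambda>y. f y * h y)
        = f x * coord_field A c b x h + h x * coord_field A c b x f"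
      using fh smooth_at_mult c x by (simp add: coord_field_apply comp_def mult.commute)
  qed (simp add: coord_field_def)
next
  fix W f assume W: "open W" "W \<subseteq> fst c" "smooth_fun A W f"
  have eq: "W \<inter> fst c = W" using W by blast
  have "smooth_on (snd c ` W) (\<lambda>z. frechet_derivative (f \<circ> chart_inv c) (at z) b)"
    using smooth_on_frechet[OF smooth_fun_chart[OF W(3) c]] eq by (simp add: comp_def)
  from smooth_fun_from_chart[OF c W(1,2) this]
  show "smooth_fun A W (\<lambda>x. coord_field A c b x f)"
    by (rule smooth_fun_cong[OF W(1), rotated]) (use W smooth_atI in \<open>auto simp: coord_field_apply\<close>)
qed

lemma coord_field_coord:
  assumes c: "c \<in> A" "x \<in> fst c"
  shows "coord_field A c b x (\<lambda>y. snd c y \<bullet> b') = b \<bullet> b'"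
proof -
  have "((\<lambda>z. z \<bullet> b') has_derivative (\<lambda>v. v \<bullet> b')) (at (snd c x))"
    by (intro bounded_linear_imp_has_derivative bounded_linear_inner_left)
  then have "(((\<lambda>y. snd c y \<bullet> b') \<circ> chart_inv c) has_derivative (\<lambda>v. v \<bullet> b')) (at (snd c x))"
    by (rule has_derivative_transform_within_open[of _ _ _ _ "snd c ` (fst c \<inter> fst c)"])
      (use c chart_image_open[OF c(1) chart_dom_open[OF c(1)]] in auto)
  from fun_cong[OF frechet_derivative_at[OF this], of b] show ?thesis
    using c by (simp add: coord_field_apply smooth_at_coord)
qed

lemma coord_field_linear:
  assumes c: "c \<in> A" "x \<in> fst c" shows "linear (\<lambda>b. coord_field A c b x)"
proof (rule linearI)
  have lin: "linear (frechet_derivative (f \<circ> chart_inv c) (at (snd c x)))" if "smooth_at A x f" for f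
    using smooth_at_chart_differentiable[OF c that] linear_frechet_derivative by blast
  show "coord_field A c (b + b') x = coord_field A c b x + coord_field A c b' x" for b b'
    using linear_add[OF lin] by (auto simp: coord_field_def fun_eq_iff)
  show "coord_field A c (a *\<^sub>R b) x = a *\<^sub>R coord_field A c b x" for a b
    using linear_scale[OF lin] by (auto simp: coord_field_def fun_eq_iff)
qed

end

text \<open>The tangent spaces have the dimension of the model space. On a manifold with exponential
  charts at all points this is part of the data; it is the reason why the coordinate vectors span the
  space of derivations.\<close>

locale tangent_manifold = smooth_manifold A
  for A :: "('m::{t2_space, second_countable_topology}, 'e::euclidean_space) chart set" +
  assumes tangent_param: "\<exists>L::'e \<Rightarrow> 'm tangent. linear L \<and> bij_betw L UNIV (tangent_space A x)"
begin

text \<open>The coordinate vectors are linearly independent, as one sees by testing them on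
  the coordinate functions; a linear injection of the model space into itself is onto, so
  they span the tangent space.\<close>

lemma tangent_expand:
  assumes c: "c \<in> A" "x \<in> fst c" and v: "v \<in> tangent_space A x"
  shows "v = (\<Sum>b\<in>Basis. v (\<lambda>y. snd c y \<bullet> b) *\<^sub>R coord_field A c b x)"
proof -
  obtain L :: "'e \<Rightarrow> 'm tangent" where L: "linear L" "bij_betw L UNIV (tangent_space A x)"
    using tangent_param by blast
  define K where "K = (\<lambda>b. coord_field A c b x)"
  have linK: "linear K" unfolding K_def by (rule coord_field_linear[OF c])
  have KT: "K b \<in> tangent_space A x" for b
    unfolding K_def using vf_tangent[OF coord_field_vfields[OF c(1)] c(2)] .
  have injL: "inj L" using L(2) by (simp add: bij_betw_def)
  define Q where "Q = (\<lambda>b. inv L (K b))"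
  have LQ: "L (Q b) = K b" for b
    unfolding Q_def using KT L(2) by (simp add: bij_betw_def f_inv_into_f)
  have linQ: "linear Q"
  proof (rule linearI)
    show "Q (b + b') = Q b + Q b'" for b b'
      by (rule injD[OF injL]) (simp add: LQ linear_add[OF L(1)] linear_add[OF linK])
    show "Q (a *\<^sub>R b) = a *\<^sub>R Q b" for a b
      by (rule injD[OF injL]) (simp add: LQ linear_scale[OF L(1)] linear_scale[OF linK])
  qed
  have Kcoord: "K b (\<lambda>y. snd c y \<bullet> b') = b \<bullet> b'" for b b'
    unfolding K_def by (rule coord_field_coord[OF c])
  have injQ: "inj Q"
  proof (rule injI)
    fix b b' assume "Q b = Q b'"
    then have KK: "K b = K b'" using LQ[of b] LQ[of b'] by simp
    have "b \<bullet> i = b' \<bullet> i" for i using Kcoord[of b i] Kcoord[of b' i] KK by simp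
    then show "b = b'" by (rule euclidean_eqI)
  qed
  have "surj Q" by (rule linear_injective_imp_surjective[OF linQ injQ refl])
  obtain u where "v = L u" using v L(2) unfolding bij_betw_def by blast
  moreover obtain e where "u = Q e" using \<open>surj Q\<close> by blast
  ultimately have ve: "v = K e" using LQ[of e] by simp
  have "K e = K (\<Sum>b\<in>Basis. (e \<bullet> b) *\<^sub>R b)" by (simp add: euclidean_representation)
  also have "\<dots> = (\<Sum>b\<in>Basis. (e \<bullet> b) *\<^sub>R K b)" by (simp add: linear_sum[OF linK] linear_scale[OF linK])
  also have "\<dots> = (\<Sum>b\<in>Basis. v (\<lambda>y. snd c y \<bullet> b) *\<^sub>R K b)" using Kcoord ve by simp
  finally show ?thesis using ve by (simp add: K_def)
qed

text \<open>The coefficients in the coordinate frame are kept constant.\<close>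

lemma tangent_extend:
  assumes "w \<in> tangent_space A x"
  obtains W Z where "open W" "x \<in> W" "Z \<in> vfields A W" "Z x = w"
proof -
  obtain c where c: "c \<in> A" "x \<in> fst c" using chart_cover .
  define Z where "Z = (\<Sum>b\<in>Basis. (\<lambda>y. w (\<lambda>y. snd c y \<bullet> b) *\<^sub>R coord_field A c b y))"
  have "Z \<in> vfields A (fst c)" unfolding Z_def by (intro vf_sum vf_scaleR coord_field_vfields c)
  moreover have "Z x = w" using tangent_expand[OF c assms] by (simp add: Z_def sum_fun_apply)
  ultimately show thesis using that chart_dom_open c by blast
qed

lemma tensorial_add:
  "tensorial A U F \<Longrightarrow> open W \<Longrightarrow> W \<subseteq> U \<Longrightarrow> X \<in> vfields A W \<Longrightarrow> Y \<in> vfields A W \<Longrightarrow> x \<in> W \<Longrightarrow>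
    F (X + Y) x = F X x + F Y x"
  unfolding tensorial_def by blast

lemma tensorial_scale:
  assumes "tensorial A U F" "open W" "W \<subseteq> U" "X \<in> vfields A W" "smooth_fun A W f" "x \<in> W"
  shows "F (\<lambda>y. f y *\<^sub>R X y) x = f x *\<^sub>R F X x"
proof -
  have "\<forall>f X. smooth_fun A W f \<longrightarrow> X \<in> vfields A W \<longrightarrow> (\<forall>x\<in>W. F (\<lambda>y. f y *\<^sub>R X y) x = f x *\<^sub>R F X x)"
    using assms(1-3) unfolding tensorial_def by simp
  from this[rule_format, OF assms(5,4,6)] show ?thesis .
qed

text \<open>The expansion of \<open>X\<close> in the coordinate frame has smooth coefficients \<open>X\<close> applied to the coordinate
  functions, but it only holds near \<open>x\<close>. Multiplication by the indicator function of a neighbourhood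
  turns it into an identity of functions on the whole manifold, to which linearity applies.\<close>

lemma tensorial_expand:
  assumes F: "tensorial A U F" and c: "c \<in> A" and X: "X \<in> vfields A W"
    and W: "open W" "open U" and x: "x \<in> W" "x \<in> U" "x \<in> fst c"
  shows "F X x = (\<Sum>b\<in>Basis. X x (\<lambda>y. snd c y \<bullet> b) *\<^sub>R F (coord_field A c b) x)"
proof -
  define G where "G = W \<inter> U \<inter> fst c"
  have G: "open G" "G \<subseteq> U" "x \<in> G" "G \<subseteq> W" "G \<subseteq> fst c"
    using W x chart_dom_open[OF c] by (auto simp: G_def)
  note add = tensorial_add[OF F G(1,2) _ _ G(3)] and scale = tensorial_scale[OF F G(1,2) _ _ G(3)]
  define i :: "'m \<Rightarrow> real" where "i = indicator G"
  have i: "smooth_fun A G i" by (rule smooth_fun_cong[OF G(1) _ smooth_fun_const[of _ 1]]) (simp add: i_def)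
  have XG: "X \<in> vfields A G" using vfields_subset[OF X G(4)] .
  have EG: "coord_field A c b \<in> vfields A G" for b
    using vfields_subset[OF coord_field_vfields[OF c] G(5)] .
  define s where "s b = (\<lambda>y. i y * X y (\<lambda>y. snd c y \<bullet> b))" for b
  have s: "smooth_fun A G (s b)" for b
    unfolding s_def using vf_smooth[OF XG G(1) order_refl] smooth_fun_subset[OF smooth_fun_coord[OF c] G(5)]
    by (intro smooth_fun_mult G i) blast
  define T where "T b = (\<lambda>y. s b y *\<^sub>R coord_field A c b y)" for b
  have T: "T b \<in> vfields A G" for b unfolding T_def by (rule vf_scale[OF s EG])
  have F0: "F 0 x = 0"
    using scale[OF XG smooth_fun_const[of _ 0]] by (simp add: zero_fun_def)
  have Fsum: "F (\<Sum>b\<in>J. T b) x = (\<Sum>b\<in>J. F (T b) x)" if "finite J" for J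
    using that by induction
      (simp_all add: F0 add[OF T vf_sum] T del: zero_fun_apply plus_fun_apply)
  have "(\<lambda>y. i y *\<^sub>R X y) = (\<Sum>b\<in>Basis. T b)"
  proof
    fix y
    show "i y *\<^sub>R X y = (\<Sum>b\<in>Basis. T b) y"
    proof (cases "y \<in> G")
      case True
      then have "X y = (\<Sum>b\<in>Basis. X y (\<lambda>y. snd c y \<bullet> b) *\<^sub>R coord_field A c b y)"
        using tangent_expand[OF c _ vf_tangent[OF XG]] G by blast
      also have "\<dots> = (\<Sum>b\<in>Basis. T b) y" using True by (simp add: sum_fun_apply T_def s_def i_def)
      finally have "X y = (\<Sum>b\<in>Basis. T b) y" .
      moreover have "i y *\<^sub>R X y = X y" using True by (simp only: i_def indicator_simps scaleR_one)
      ultimately show ?thesis by (rule trans[rotated])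
    next
      case False
      then have i0: "i y = 0" by (simp add: i_def)
      then have "T b y = 0" for b by (simp add: T_def s_def)
      then show ?thesis by (simp only: sum_fun_apply i0 scaleR_zero_left sum.neutral_const)
    qed
  qed
  then have "F (\<lambda>y. i y *\<^sub>R X y) x = (\<Sum>b\<in>Basis. F (T b) x)" using Fsum by simp
  moreover have "F (\<lambda>y. i y *\<^sub>R X y) x = F X x" using scale[OF XG i] G(3) by (simp add: i_def)
  moreover have "F (T b) x = X x (\<lambda>y. snd c y \<bullet> b) *\<^sub>R F (coord_field A c b) x" for b
    unfolding T_def using scale[OF EG s] G(3) by (simp add: s_def i_def)
  ultimately show ?thesis by simp
qed

text \<open>This is what makes torsion, curvature and their derivatives tensors: they may be evaluated on
  any local fields with prescribed values at the point.\<close>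

lemma tensorial_pointwise:
  assumes "tensorial A U F" "open U" "x \<in> U"
    and "X \<in> vfields A W" "open W" "x \<in> W" and "Y \<in> vfields A W'" "open W'" "x \<in> W'"
    and "X x = Y x"
  shows "F X x = F Y x"
proof -
  obtain c where c: "c \<in> A" "x \<in> fst c" using chart_cover .
  show ?thesis
    by (simp only: tensorial_expand[OF assms(1) c(1) assms(4,5,2,6,3) c(2)]
      tensorial_expand[OF assms(1) c(1) assms(7,8,2,9,3) c(2)] assms(10))
qed

end

section \<open>Function-linear maps and connections\<close>

definition vf_map ::
  "('m::topological_space, 'e::euclidean_space) chart set \<Rightarrow> 'm set \<Rightarrow> ('m vfield \<Rightarrow> 'm vfield) \<Rightarrow> bool" where
  "vf_map A U F \<longleftrightarrow> (\<forall>W. open W \<longrightarrow> W \<subseteq> U \<longrightarrow> (\<forall>X\<in>vfields A W. F X \<in> vfields A W))"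

context tangent_manifold
begin

lemma vf_mapI: "(\<And>W X. open W \<Longrightarrow> W \<subseteq> U \<Longrightarrow> X \<in> vfields A W \<Longrightarrow> F X \<in> vfields A W) \<Longrightarrow> vf_map A U F"
  by (simp add: vf_map_def)

lemma vf_mapD: "vf_map A U F \<Longrightarrow> open W \<Longrightarrow> W \<subseteq> U \<Longrightarrow> X \<in> vfields A W \<Longrightarrow> F X \<in> vfields A W"
  by (simp add: vf_map_def)

lemma tensorialI:
  assumes "\<And>W X Y x. open W \<Longrightarrow> W \<subseteq> U \<Longrightarrow> X \<in> vfields A W \<Longrightarrow> Y \<in> vfields A W \<Longrightarrow> x \<in> W \<Longrightarrow>
      F (X + Y) x = F X x + F Y x"
    and "\<And>W X f x. open W \<Longrightarrow> W \<subseteq> U \<Longrightarrow> X \<in> vfields A W \<Longrightarrow> smooth_fun A W f \<Longrightarrow> x \<in> W \<Longrightarrow>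
      F (\<lambda>y. f y *\<^sub>R X y) x = f x *\<^sub>R F X x"
  shows "tensorial A U F"
  unfolding tensorial_def using assms by (intro allI impI conjI ballI) blast+

lemma tensorial_diff_fun:
  assumes F: "tensorial A U F" and H: "tensorial A U H"
  shows "tensorial A U (\<lambda>X. F X - H X)"
proof (rule tensorialI)
  fix W X Y x assume a: "open W" "W \<subseteq> U" "X \<in> vfields A W" "Y \<in> vfields A W" "x \<in> W"
  show "(F (X + Y) - H (X + Y)) x = (F X - H X) x + (F Y - H Y) x"
    unfolding minus_apply[of "F (X + Y)"] minus_apply[of "F X"] minus_apply[of "F Y"]
      tensorial_add[OF F a] tensorial_add[OF H a] by (simp only: add_diff_add)
next
  fix W X f x assume a: "open W" "W \<subseteq> U" "X \<in> vfields A W" "smooth_fun A W f" "x \<in> W"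
  show "(F (\<lambda>y. f y *\<^sub>R X y) - H (\<lambda>y. f y *\<^sub>R X y)) x = f x *\<^sub>R (F X - H X) x"
    unfolding minus_apply[of "F (\<lambda>y. f y *\<^sub>R X y)"] minus_apply[of "F X"]
      tensorial_scale[OF F a] tensorial_scale[OF H a] by (simp only: scaleR_diff_right)
qed

lemma tensorial_cong:
  assumes F: "tensorial A U F"
    and eq: "\<And>W X x. open W \<Longrightarrow> W \<subseteq> U \<Longrightarrow> X \<in> vfields A W \<Longrightarrow> x \<in> W \<Longrightarrow> H X x = F X x"
  shows "tensorial A U H"
proof (rule tensorialI)
  fix W X Y x assume a: "open W" "W \<subseteq> U" "X \<in> vfields A W" "Y \<in> vfields A W" "x \<in> W"
  show "H (X + Y) x = H X x + H Y x"
    unfolding eq[OF a(1,2) vf_plus[OF a(3,4)] a(5)] eq[OF a(1,2,3,5)] eq[OF a(1,2,4,5)]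
    by (rule tensorial_add[OF F a])
next
  fix W X f x assume a: "open W" "W \<subseteq> U" "X \<in> vfields A W" "smooth_fun A W f" "x \<in> W"
  show "H (\<lambda>y. f y *\<^sub>R X y) x = f x *\<^sub>R H X x"
    unfolding eq[OF a(1,2) vf_scale[OF a(4,3)] a(5)] eq[OF a(1,2,3,5)]
    by (rule tensorial_scale[OF F a])
qed

lemma tensorial_compose:
  assumes F: "tensorial A U F" "vf_map A U F" and H: "tensorial A U H" and U: "open U"
  shows "tensorial A U (\<lambda>X. H (F X))"
proof (rule tensorialI)
  fix W X Y x assume a: "open W" "W \<subseteq> U" "X \<in> vfields A W" "Y \<in> vfields A W" "x \<in> W"
  note m = vf_mapD[OF F(2) a(1,2)]
  have "H (F (X + Y)) x = H (F X + F Y) x"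
    using tensorial_add[OF F(1) a] a U
    by (intro tensorial_pointwise[OF H U _ m[OF vf_plus] a(1,5) vf_plus[OF m m] a(1,5)]) (auto simp del: plus_fun_apply simp: plus_fun_apply[of "F X"])
  also have "\<dots> = H (F X) x + H (F Y) x"
    by (rule tensorial_add[OF H a(1,2) m m]) (use a in auto)
  finally show "H (F (X + Y)) x = H (F X) x + H (F Y) x" .
next
  fix W X f x assume a: "open W" "W \<subseteq> U" "X \<in> vfields A W" "smooth_fun A W f" "x \<in> W"
  note m = vf_mapD[OF F(2) a(1,2)]
  have "H (F (\<lambda>y. f y *\<^sub>R X y)) x = H (\<lambda>y. f y *\<^sub>R F X y) x"
    using tensorial_scale[OF F(1) a] a U
    by (intro tensorial_pointwise[OF H U _ m[OF vf_scale] a(1,5) vf_scale[OF _ m] a(1,5)]) auto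
  also have "\<dots> = f x *\<^sub>R H (F X) x"
    by (rule tensorial_scale[OF H a(1,2) m]) (use a in auto)
  finally show "H (F (\<lambda>y. f y *\<^sub>R X y)) x = f x *\<^sub>R H (F X) x" .
qed

end

locale connection_manifold = tangent_manifold A
  for A :: "('m::{t2_space, second_countable_topology}, 'e::euclidean_space) chart set" +
  fixes D :: "'m connection"
  assumes conn: "is_connection A D"
begin

lemma D_vf: "open U \<Longrightarrow> X \<in> vfields A U \<Longrightarrow> Y \<in> vfields A U \<Longrightarrow> D X Y \<in> vfields A U"
  using conn unfolding is_connection_def by simp

lemma D_add_left:
  assumes "open U" "X \<in> vfields A U" "X' \<in> vfields A U" "Y \<in> vfields A U" "x \<in> U"
  shows "D (X + X') Y x = D X Y x + D X' Y x"
proof -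
  have "\<forall>X\<in>vfields A U. \<forall>X'\<in>vfields A U. \<forall>Y\<in>vfields A U. \<forall>x\<in>U. D (X + X') Y x = D X Y x + D X' Y x"
    using conn assms(1) unfolding is_connection_def by simp
  from this[rule_format, OF assms(2-5)] show ?thesis .
qed

lemma D_add_right:
  assumes "open U" "X \<in> vfields A U" "Y \<in> vfields A U" "Y' \<in> vfields A U" "x \<in> U"
  shows "D X (Y + Y') x = D X Y x + D X Y' x"
proof -
  have "\<forall>X\<in>vfields A U. \<forall>Y\<in>vfields A U. \<forall>Y'\<in>vfields A U. \<forall>x\<in>U. D X (Y + Y') x = D X Y x + D X Y' x"
    using conn assms(1) unfolding is_connection_def by simp
  from this[rule_format, OF assms(2-5)] show ?thesis .
qed

lemma D_scale:
  assumes "open U" "smooth_fun A U f" "X \<in> vfields A U" "Y \<in> vfields A U" "x \<in> U"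
  shows D_scale_left: "D (\<lambda>y. f y *\<^sub>R X y) Y x = f x *\<^sub>R D X Y x"
    and D_scale_right: "D X (\<lambda>y. f y *\<^sub>R Y y) x = f x *\<^sub>R D X Y x + X x f *\<^sub>R Y x"
proof -
  have "\<forall>f X Y. smooth_fun A U f \<longrightarrow> X \<in> vfields A U \<longrightarrow> Y \<in> vfields A U \<longrightarrow> (\<forall>x\<in>U.
        D (\<lambda>y. f y *\<^sub>R X y) Y x = f x *\<^sub>R D X Y x \<and>
        D X (\<lambda>y. f y *\<^sub>R Y y) x = f x *\<^sub>R D X Y x + X x f *\<^sub>R Y x)"
    using conn assms(1) unfolding is_connection_def by simp
  from this[rule_format, OF assms(2-5)]
  show "D (\<lambda>y. f y *\<^sub>R X y) Y x = f x *\<^sub>R D X Y x"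
    "D X (\<lambda>y. f y *\<^sub>R Y y) x = f x *\<^sub>R D X Y x + X x f *\<^sub>R Y x" by blast+
qed

lemma D_tensorial:
  assumes "Y \<in> vfields A U" shows "tensorial A U (\<lambda>X. D X Y)"
  by (rule tensorialI) (rule D_add_left D_scale_left; use assms vfields_subset in blast)+

lemma D_vf_map_left: "Y \<in> vfields A U \<Longrightarrow> vf_map A U (\<lambda>X. D X Y)"
  by (rule vf_mapI) (use D_vf vfields_subset in blast)

text \<open>The derivative of the indicator function of \<open>U\<close> vanishes on \<open>U\<close>, so multiplication by it
  changes neither covariant derivative.\<close>

lemma D_local_right:
  assumes "open U" "X \<in> vfields A U" "Y \<in> vfields A U" "Y' \<in> vfields A U" "x \<in> U"
    and eq: "\<And>y. y \<in> U \<Longrightarrow> Y y = Y' y"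
  shows "D X Y x = D X Y' x"
proof -
  define i :: "'m \<Rightarrow> real" where "i = indicator U"
  have i: "smooth_fun A U i"
    by (rule smooth_fun_cong[OF assms(1) _ smooth_fun_const[of _ 1]]) (simp add: i_def)
  have ix: "i x = 1" using assms(5) by (simp add: i_def)
  have "X x i = X x (\<lambda>y. 1)"
    by (rule tangent_germ[OF vf_tangent[OF assms(2,5)] assms(1,5)]) (simp add: i_def)
  then have Xi: "X x i = 0" using tangent_const[OF vf_tangent[OF assms(2,5)]] by simp
  have cut: "D X (\<lambda>y. i y *\<^sub>R Z y) x = D X Z x" if "Z \<in> vfields A U" for Z
    unfolding D_scale_right[OF assms(1) i assms(2) that assms(5)] Xi ix
    by (simp only: scaleR_one scaleR_zero_left add_0_right)
  have "(\<lambda>y. i y *\<^sub>R Y y) = (\<lambda>y. i y *\<^sub>R Y' y)"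
    using eq by (intro ext) (auto simp: i_def indicator_def)
  then show ?thesis using cut[OF assms(3)] cut[OF assms(4)] by simp
qed

text \<open>The covariant derivative of a function-linear map is function-linear again: the two Leibniz
  terms cancel.\<close>

lemma tensorial_derivative:
  assumes F: "tensorial A U F" "vf_map A U F" and Z: "Z \<in> vfields A U" and U: "open U"
  shows "tensorial A U (\<lambda>X. D Z (F X) - F (D Z X))"
proof (rule tensorialI)
  fix W X Y x assume a: "open W" "W \<subseteq> U" "X \<in> vfields A W" "Y \<in> vfields A W" "x \<in> W"
  note m = vf_mapD[OF F(2) a(1,2)]
  have ZW: "Z \<in> vfields A W" using Z a(2) vfields_subset by blast
  note d = D_vf[OF a(1) ZW]
  have xU: "x \<in> U" using a by blast
  have "D Z (F (X + Y)) x = D Z (F X + F Y) x"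
    by (rule D_local_right[OF a(1) ZW m[OF vf_plus[OF a(3,4)]] vf_plus[OF m[OF a(3)] m[OF a(4)]] a(5)])
      (simp only: tensorial_add[OF F(1) a(1-4)] plus_fun_apply[of "F X" "F Y"])
  moreover have "D Z (F X + F Y) x = D Z (F X) x + D Z (F Y) x"
    by (rule D_add_right[OF a(1) ZW m[OF a(3)] m[OF a(4)] a(5)])
  moreover have "F (D Z (X + Y)) x = F (D Z X + D Z Y) x"
    by (rule tensorial_pointwise[OF F(1) U xU d[OF vf_plus[OF a(3,4)]] a(1,5) vf_plus[OF d[OF a(3)] d[OF a(4)]] a(1,5)])
      (simp only: D_add_right[OF a(1) ZW a(3-5)] plus_fun_apply[of "D Z X"])
  moreover have "F (D Z X + D Z Y) x = F (D Z X) x + F (D Z Y) x"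
    by (rule tensorial_add[OF F(1) a(1,2) d[OF a(3)] d[OF a(4)] a(5)])
  ultimately show "(D Z (F (X + Y)) - F (D Z (X + Y))) x
      = (D Z (F X) - F (D Z X)) x + (D Z (F Y) - F (D Z Y)) x"
    unfolding minus_apply[of "D Z (F (X + Y))"] minus_apply[of "D Z (F X)"] minus_apply[of "D Z (F Y)"]
    by (simp only: add_diff_add)
next
  fix W X f x assume a: "open W" "W \<subseteq> U" "X \<in> vfields A W" "smooth_fun A W f" "x \<in> W"
  note m = vf_mapD[OF F(2) a(1,2)]
  have ZW: "Z \<in> vfields A W" using Z a(2) vfields_subset by blast
  note d = D_vf[OF a(1) ZW]
  have xU: "x \<in> U" using a by blast
  have Zf: "smooth_fun A W (\<lambda>y. Z y f)" by (rule vf_smooth[OF ZW a(1) order_refl a(4)])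
  have "D Z (F (\<lambda>y. f y *\<^sub>R X y)) x = D Z (\<lambda>y. f y *\<^sub>R F X y) x"
    by (rule D_local_right[OF a(1) ZW m[OF vf_scale[OF a(4,3)]] vf_scale[OF a(4) m[OF a(3)]] a(5)])
      (rule tensorial_scale[OF F(1) a(1-4)])
  moreover have "D Z (\<lambda>y. f y *\<^sub>R F X y) x = f x *\<^sub>R D Z (F X) x + Z x f *\<^sub>R F X x"
    by (rule D_scale_right[OF a(1,4) ZW m[OF a(3)] a(5)])
  moreover have "F (D Z (\<lambda>y. f y *\<^sub>R X y)) x = F ((\<lambda>y. f y *\<^sub>R D Z X y) + (\<lambda>y. Z y f *\<^sub>R X y)) x"
    by (rule tensorial_pointwise[OF F(1) U xU d[OF vf_scale[OF a(4,3)]] a(1,5)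
          vf_plus[OF vf_scale[OF a(4) d[OF a(3)]] vf_scale[OF Zf a(3)]] a(1,5)])
      (simp only: D_scale_right[OF a(1,4) ZW a(3,5)] plus_fun_apply[of "\<lambda>y. f y *\<^sub>R D Z X y"])
  moreover have "F ((\<lambda>y. f y *\<^sub>R D Z X y) + (\<lambda>y. Z y f *\<^sub>R X y)) x = f x *\<^sub>R F (D Z X) x + Z x f *\<^sub>R F X x"
    unfolding tensorial_add[OF F(1) a(1,2) vf_scale[OF a(4) d[OF a(3)]] vf_scale[OF Zf a(3)] a(5)]
      tensorial_scale[OF F(1) a(1,2) d[OF a(3)] a(4,5)] tensorial_scale[OF F(1) a(1,2,3) Zf a(5)] ..
  ultimately show "(D Z (F (\<lambda>y. f y *\<^sub>R X y)) - F (D Z (\<lambda>y. f y *\<^sub>R X y))) x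
      = f x *\<^sub>R (D Z (F X) - F (D Z X)) x"
    unfolding minus_apply[of "D Z (F (\<lambda>y. f y *\<^sub>R X y))"] minus_apply[of "D Z (F X)"]
    by (simp only: scaleR_diff_right add_diff_cancel_right)
qed

lemma torsion_apply: "torsion A D X Y x = D X Y x - D Y X x - lie_bracket A X Y x"
  by (simp add: torsion_def)

lemma curvature_apply:
  "curvature A D X Y Z x = D X (D Y Z) x - D Y (D X Z) x - D (lie_bracket A X Y) Z x"
  by (simp add: curvature_def)

lemma torsion_vf: "open U \<Longrightarrow> X \<in> vfields A U \<Longrightarrow> Y \<in> vfields A U \<Longrightarrow> torsion A D X Y \<in> vfields A U"
  unfolding torsion_def by (intro vf_minus D_vf vf_lie_bracket)

lemma curvature_vf:
  "open U \<Longrightarrow> X \<in> vfields A U \<Longrightarrow> Y \<in> vfields A U \<Longrightarrow> Z \<in> vfields A U \<Longrightarrow> curvature A D X Y Z \<in> vfields A U"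
  unfolding curvature_def by (intro vf_minus D_vf vf_lie_bracket)

lemma torsion_tensorial_left:
  assumes U: "open U" and Y: "Y \<in> vfields A U"
  shows "tensorial A U (\<lambda>X. torsion A D X Y)"
proof (rule tensorialI)
  fix W X X' x assume a: "open W" "W \<subseteq> U" "X \<in> vfields A W" "X' \<in> vfields A W" "x \<in> W"
  have Y: "Y \<in> vfields A W" using Y a(2) vfields_subset by blast
  show "torsion A D (X + X') Y x = torsion A D X Y x + torsion A D X' Y x"
    unfolding torsion_apply D_add_left[OF a(1,3,4) Y a(5)] D_add_right[OF a(1) Y a(3,4,5)]
      lie_bracket_add_left[OF a(1,5,3,4) Y]
    by (rule ext) (simp add: algebra_simps)
next
  fix W X f x assume a: "open W" "W \<subseteq> U" "X \<in> vfields A W" "smooth_fun A W f" "x \<in> W"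
  have Y: "Y \<in> vfields A W" using Y a(2) vfields_subset by blast
  show "torsion A D (\<lambda>y. f y *\<^sub>R X y) Y x = f x *\<^sub>R torsion A D X Y x"
    unfolding torsion_apply D_scale_left[OF a(1,4,3) Y a(5)] D_scale_right[OF a(1,4) Y a(3,5)]
      lie_bracket_scale_left[OF a(1,5,3) Y a(4)]
    by (rule ext) (simp add: algebra_simps)
qed

lemma torsion_skew: "torsion A D X Y x = - torsion A D Y X x"
  unfolding torsion_apply lie_bracket_skew[of Y X x] by (rule ext) simp

lemma tensorial_uminus_fun:
  assumes "tensorial A U F" shows "tensorial A U (\<lambda>X. - F X)"
proof (rule tensorialI)
  fix W X Y x assume a: "open W" "W \<subseteq> U" "X \<in> vfields A W" "Y \<in> vfields A W" "x \<in> W"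
  show "(- F (X + Y)) x = (- F X) x + (- F Y) x"
    using tensorial_add[OF assms a] by (simp only: uminus_apply[of "F _"] minus_add_distrib)
next
  fix W X f x assume a: "open W" "W \<subseteq> U" "X \<in> vfields A W" "smooth_fun A W f" "x \<in> W"
  show "(- F (\<lambda>y. f y *\<^sub>R X y)) x = f x *\<^sub>R (- F X) x"
    using tensorial_scale[OF assms a] by (simp only: uminus_apply[of "F _"] scaleR_minus_right)
qed

lemma torsion_tensorial_right:
  assumes "open U" "X \<in> vfields A U" shows "tensorial A U (torsion A D X)"
  by (rule tensorial_cong[OF tensorial_uminus_fun[OF torsion_tensorial_left[OF assms]]])
    (simp only: uminus_apply[of "torsion A D _ _"] torsion_skew[of X])

text \<open>The Leibniz term of \<open>D Y (f D X Z)\<close> cancels against the one of the bracket \<open>[f X, Y]\<close>.\<close>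

lemma curvature_tensorial_1:
  assumes U: "open U" and Y: "Y \<in> vfields A U" and Z: "Z \<in> vfields A U"
  shows "tensorial A U (\<lambda>X. curvature A D X Y Z)"
proof (rule tensorialI)
  fix W X X' x assume a: "open W" "W \<subseteq> U" "X \<in> vfields A W" "X' \<in> vfields A W" "x \<in> W"
  have Y: "Y \<in> vfields A W" and Z: "Z \<in> vfields A W" using Y Z a(2) vfields_subset by blast+
  note d = D_vf[OF a(1)] and b = vf_lie_bracket[OF a(1)]
  have "D Y (D (X + X') Z) x = D Y (D X Z + D X' Z) x"
    by (rule D_local_right[OF a(1) Y d[OF vf_plus[OF a(3,4)] Z] vf_plus[OF d[OF a(3) Z] d[OF a(4) Z]] a(5)])
      (simp only: D_add_left[OF a(1,3,4) Z] plus_fun_apply[of "D X Z"])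
  then have 1: "D Y (D (X + X') Z) x = D Y (D X Z) x + D Y (D X' Z) x"
    by (simp only: D_add_right[OF a(1) Y d[OF a(3) Z] d[OF a(4) Z] a(5)])
  have "D (lie_bracket A (X + X') Y) Z x = D (lie_bracket A X Y + lie_bracket A X' Y) Z x"
    by (rule tensorial_pointwise[OF D_tensorial[OF Z] a(1,5) b[OF vf_plus[OF a(3,4)] Y] a(1,5)
          vf_plus[OF b[OF a(3) Y] b[OF a(4) Y]] a(1,5)])
      (simp only: lie_bracket_add_left[OF a(1,5,3,4) Y] plus_fun_apply[of "lie_bracket A X Y"])
  then have 2: "D (lie_bracket A (X + X') Y) Z x = D (lie_bracket A X Y) Z x + D (lie_bracket A X' Y) Z x"
    by (simp only: D_add_left[OF a(1) b[OF a(3) Y] b[OF a(4) Y] Z a(5)])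
  show "curvature A D (X + X') Y Z x = curvature A D X Y Z x + curvature A D X' Y Z x"
    unfolding curvature_apply 1 2 D_add_left[OF a(1,3,4) d[OF Y Z] a(5)]
    by (rule ext) (simp add: algebra_simps)
next
  fix W X f x assume a: "open W" "W \<subseteq> U" "X \<in> vfields A W" "smooth_fun A W f" "x \<in> W"
  have Y: "Y \<in> vfields A W" and Z: "Z \<in> vfields A W" using Y Z a(2) vfields_subset by blast+
  note d = D_vf[OF a(1)] and b = vf_lie_bracket[OF a(1)]
  have Yf: "smooth_fun A W (\<lambda>y. Y y f)" by (rule vf_smooth[OF Y a(1) order_refl a(4)])
  have "D Y (D (\<lambda>y. f y *\<^sub>R X y) Z) x = D Y (\<lambda>y. f y *\<^sub>R D X Z y) x"
    by (rule D_local_right[OF a(1) Y d[OF vf_scale[OF a(4,3)] Z] vf_scale[OF a(4) d[OF a(3) Z]] a(5)])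
      (rule D_scale_left[OF a(1,4,3) Z])
  then have 1: "D Y (D (\<lambda>y. f y *\<^sub>R X y) Z) x = f x *\<^sub>R D Y (D X Z) x + Y x f *\<^sub>R D X Z x"
    by (simp only: D_scale_right[OF a(1,4) Y d[OF a(3) Z] a(5)])
  have "D (lie_bracket A (\<lambda>y. f y *\<^sub>R X y) Y) Z x
      = D ((\<lambda>y. f y *\<^sub>R lie_bracket A X Y y) - (\<lambda>y. Y y f *\<^sub>R X y)) Z x"
    by (rule tensorial_pointwise[OF D_tensorial[OF Z] a(1,5) b[OF vf_scale[OF a(4,3)] Y] a(1,5)
          vf_minus[OF vf_scale[OF a(4) b[OF a(3) Y]] vf_scale[OF Yf a(3)]] a(1,5)])
      (simp only: lie_bracket_scale_left[OF a(1,5,3) Y a(4)] minus_apply[of "\<lambda>y. f y *\<^sub>R lie_bracket A X Y y"])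
  also have "\<dots> = D (\<lambda>y. f y *\<^sub>R lie_bracket A X Y y) Z x - D (\<lambda>y. Y y f *\<^sub>R X y) Z x"
    using D_add_left[OF a(1) vf_minus[OF vf_scale[OF a(4) b[OF a(3) Y]] vf_scale[OF Yf a(3)]]
        vf_scale[OF Yf a(3)] Z a(5)] by (simp only: diff_add_cancel add_diff_cancel_right')
  finally have 2: "D (lie_bracket A (\<lambda>y. f y *\<^sub>R X y) Y) Z x
      = f x *\<^sub>R D (lie_bracket A X Y) Z x - Y x f *\<^sub>R D X Z x"
    by (simp only: D_scale_left[OF a(1,4) b[OF a(3) Y] Z a(5)] D_scale_left[OF a(1) Yf a(3) Z a(5)])
  show "curvature A D (\<lambda>y. f y *\<^sub>R X y) Y Z x = f x *\<^sub>R curvature A D X Y Z x"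
    unfolding curvature_apply 1 2 D_scale_left[OF a(1,4,3) d[OF Y Z] a(5)]
    by (rule ext) (simp add: algebra_simps)
qed

lemma curvature_skew:
  assumes U: "open U" "X \<in> vfields A U" "Y \<in> vfields A U" "Z \<in> vfields A U" "x \<in> U"
  shows "curvature A D X Y Z x = - curvature A D Y X Z x"
proof -
  note b = vf_lie_bracket[OF U(1)]
  have "D (lie_bracket A Y X) Z x = D (\<lambda>y. (-1) *\<^sub>R lie_bracket A X Y y) Z x"
    by (rule tensorial_pointwise[OF D_tensorial[OF U(4)] U(1,5) b[OF U(3,2)] U(1,5)
          vf_scaleR[OF b[OF U(2,3)]] U(1,5)])
      (simp only: lie_bracket_skew[of Y X] scaleR_minus_left scaleR_one)
  also have "\<dots> = (-1) *\<^sub>R D (lie_bracket A X Y) Z x"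
    by (rule D_scale_left[OF U(1) smooth_fun_const b[OF U(2,3)] U(4,5)])
  finally show ?thesis unfolding curvature_apply by (intro ext) simp
qed

lemma curvature_tensorial_2:
  assumes U: "open U" and X: "X \<in> vfields A U" and Z: "Z \<in> vfields A U"
  shows "tensorial A U (\<lambda>Y. curvature A D X Y Z)"
proof (rule tensorial_cong[OF tensorial_uminus_fun[OF curvature_tensorial_1[OF U X Z]]])
  fix W Y x assume a: "open W" "W \<subseteq> U" "Y \<in> vfields A W" "x \<in> W"
  have "X \<in> vfields A W" "Z \<in> vfields A W" using X Z a(2) vfields_subset by blast+
  from curvature_skew[OF a(1) this(1) a(3) this(2) a(4)]
  show "curvature A D X Y Z x = (- curvature A D Y X Z) x"
    by (simp only: uminus_apply[of "curvature A D _ _ _"])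
qed

text \<open>The first-order terms are symmetric in \<open>X\<close> and \<open>Y\<close>, and the second-order ones combine to
  \<open>X (Y f) - Y (X f)\<close>, the Leibniz term of \<open>D [X, Y]\<close>.\<close>

lemma curvature_tensorial_3:
  assumes U: "open U" and X: "X \<in> vfields A U" and Y: "Y \<in> vfields A U"
  shows "tensorial A U (curvature A D X Y)"
proof (rule tensorialI)
  fix W Z Z' x assume a: "open W" "W \<subseteq> U" "Z \<in> vfields A W" "Z' \<in> vfields A W" "x \<in> W"
  have X: "X \<in> vfields A W" and Y: "Y \<in> vfields A W" using X Y a(2) vfields_subset by blast+
  note d = D_vf[OF a(1)] and b = vf_lie_bracket[OF a(1)]
  have 1: "D P (D Q (Z + Z')) x = D P (D Q Z) x + D P (D Q Z') x"
    if P: "P \<in> vfields A W" and Q: "Q \<in> vfields A W" for P Q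
  proof -
    have "D P (D Q (Z + Z')) x = D P (D Q Z + D Q Z') x"
      by (rule D_local_right[OF a(1) P d[OF Q vf_plus[OF a(3,4)]] vf_plus[OF d[OF Q a(3)] d[OF Q a(4)]] a(5)])
        (simp only: D_add_right[OF a(1) Q a(3,4)] plus_fun_apply[of "D Q Z"])
    then show ?thesis by (simp only: D_add_right[OF a(1) P d[OF Q a(3)] d[OF Q a(4)] a(5)])
  qed
  show "curvature A D X Y (Z + Z') x = curvature A D X Y Z x + curvature A D X Y Z' x"
    unfolding curvature_apply 1[OF X Y] 1[OF Y X] D_add_right[OF a(1) b[OF X Y] a(3,4,5)]
    by (rule ext) (simp add: algebra_simps)
next
  fix W Z f x assume a: "open W" "W \<subseteq> U" "Z \<in> vfields A W" "smooth_fun A W f" "x \<in> W"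
  have X: "X \<in> vfields A W" and Y: "Y \<in> vfields A W" using X Y a(2) vfields_subset by blast+
  note d = D_vf[OF a(1)] and b = vf_lie_bracket[OF a(1)]
  have 1: "D P (D Q (\<lambda>y. f y *\<^sub>R Z y)) x = f x *\<^sub>R D P (D Q Z) x + P x f *\<^sub>R D Q Z x
      + (Q x f *\<^sub>R D P Z x + P x (\<lambda>y. Q y f) *\<^sub>R Z x)"
    if P: "P \<in> vfields A W" and Q: "Q \<in> vfields A W" for P Q
  proof -
    have Qf: "smooth_fun A W (\<lambda>y. Q y f)" by (rule vf_smooth[OF Q a(1) order_refl a(4)])
    have "D P (D Q (\<lambda>y. f y *\<^sub>R Z y)) x = D P ((\<lambda>y. f y *\<^sub>R D Q Z y) + (\<lambda>y. Q y f *\<^sub>R Z y)) x"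
      by (rule D_local_right[OF a(1) P d[OF Q vf_scale[OF a(4,3)]]
            vf_plus[OF vf_scale[OF a(4) d[OF Q a(3)]] vf_scale[OF Qf a(3)]] a(5)])
        (simp only: D_scale_right[OF a(1,4) Q a(3)] plus_fun_apply[of "\<lambda>y. f y *\<^sub>R D Q Z y"])
    then show ?thesis
      by (simp only: D_add_right[OF a(1) P vf_scale[OF a(4) d[OF Q a(3)]] vf_scale[OF Qf a(3)] a(5)]
          D_scale_right[OF a(1,4) P d[OF Q a(3)] a(5)] D_scale_right[OF a(1) Qf P a(3,5)])
  qed
  have "smooth_at A x f" using a smooth_atI by blast
  then have br: "lie_bracket A X Y x f = X x (\<lambda>y. Y y f) - Y x (\<lambda>y. X y f)" by (rule lie_bracket_apply)
  show "curvature A D X Y (\<lambda>y. f y *\<^sub>R Z y) x = f x *\<^sub>R curvature A D X Y Z x"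
    unfolding curvature_apply 1[OF X Y] 1[OF Y X] D_scale_right[OF a(1,4) b[OF X Y] a(3,5)] br
    by (rule ext) (simp add: algebra_simps)
qed

end

context connection_manifold
begin

lemma torsion_vf_map:
  "open U \<Longrightarrow> X \<in> vfields A U \<Longrightarrow> vf_map A U (torsion A D X)"
  "open U \<Longrightarrow> X \<in> vfields A U \<Longrightarrow> vf_map A U (\<lambda>Y. torsion A D Y X)"
  by (rule vf_mapI; use torsion_vf vfields_subset in blast)+

lemma curvature_vf_map:
  "open U \<Longrightarrow> X \<in> vfields A U \<Longrightarrow> Y \<in> vfields A U \<Longrightarrow> vf_map A U (curvature A D X Y)"
  "open U \<Longrightarrow> X \<in> vfields A U \<Longrightarrow> Y \<in> vfields A U \<Longrightarrow> vf_map A U (\<lambda>Z. curvature A D X Z Y)"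
  "open U \<Longrightarrow> X \<in> vfields A U \<Longrightarrow> Y \<in> vfields A U \<Longrightarrow> vf_map A U (\<lambda>Z. curvature A D Z X Y)"
  by (rule vf_mapI; use curvature_vf vfields_subset in blast)+

lemma cov_torsion_tensorial:
  assumes U: "open U" and X: "X \<in> vfields A U" and Y: "Y \<in> vfields A U"
  shows "tensorial A U (\<lambda>Z. cov_torsion A D Z X Y)"
    and "tensorial A U (\<lambda>Z. cov_torsion A D X Z Y)"
    and "tensorial A U (\<lambda>Z. cov_torsion A D X Y Z)"
proof -
  note d = D_vf[OF U] and t = torsion_vf[OF U]
    and tl = torsion_tensorial_left[OF U] and tr = torsion_tensorial_right[OF U]
  show "tensorial A U (\<lambda>Z. cov_torsion A D Z X Y)"
    unfolding cov_torsion_def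
    by (intro tensorial_diff_fun D_tensorial t X Y tensorial_compose[OF D_tensorial D_vf_map_left tl U]
        tensorial_compose[OF D_tensorial D_vf_map_left tr U])
  show "tensorial A U (\<lambda>Z. cov_torsion A D X Z Y)"
    unfolding cov_torsion_def
    by (intro tensorial_diff_fun tensorial_derivative[OF tl[OF Y] torsion_vf_map(2)[OF U Y] X U]
        tl[OF d[OF X Y]])
  have "tensorial A U (\<lambda>Z. (D X (torsion A D Y Z) - torsion A D Y (D X Z)) - torsion A D (D X Y) Z)"
    by (intro tensorial_diff_fun tensorial_derivative[OF tr[OF Y] torsion_vf_map(1)[OF U Y] X U]
        tr[OF d[OF X Y]])
  then show "tensorial A U (\<lambda>Z. cov_torsion A D X Y Z)"
    by (rule tensorial_cong) (rule ext, simp add: cov_torsion_def)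
qed

lemma cov_curvature_tensorial:
  assumes U: "open U" and X: "X \<in> vfields A U" and Y: "Y \<in> vfields A U" and Z: "Z \<in> vfields A U"
  shows "tensorial A U (\<lambda>W. cov_curvature A D W X Y Z)"
    and "tensorial A U (\<lambda>W. cov_curvature A D X W Y Z)"
    and "tensorial A U (\<lambda>W. cov_curvature A D X Y W Z)"
    and "tensorial A U (\<lambda>W. cov_curvature A D X Y Z W)"
proof -
  note d = D_vf[OF U] and t = curvature_vf[OF U]
    and t1 = curvature_tensorial_1[OF U] and t2 = curvature_tensorial_2[OF U]
    and t3 = curvature_tensorial_3[OF U]
  note comp = tensorial_compose[OF D_tensorial D_vf_map_left _ U]
  show "tensorial A U (\<lambda>W. cov_curvature A D W X Y Z)"
    unfolding cov_curvature_def
    by (intro tensorial_diff_fun D_tensorial t X Y Z comp[OF X X t1] comp[OF Y Y t2] comp[OF Z Z t3])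
  show "tensorial A U (\<lambda>W. cov_curvature A D X W Y Z)"
    unfolding cov_curvature_def
    by (intro tensorial_diff_fun tensorial_derivative[OF t1[OF Y Z] curvature_vf_map(3)[OF U Y Z] X U]
        t1 d X Y Z)
  have "tensorial A U (\<lambda>W. (D X (curvature A D Y W Z) - curvature A D Y (D X W) Z)
      - curvature A D (D X Y) W Z - curvature A D Y W (D X Z))"
    by (intro tensorial_diff_fun tensorial_derivative[OF t2[OF Y Z] curvature_vf_map(2)[OF U Y Z] X U]
        t2 d X Y Z)
  then show "tensorial A U (\<lambda>W. cov_curvature A D X Y W Z)"
    by (rule tensorial_cong) (rule ext, simp add: cov_curvature_def)
  have "tensorial A U (\<lambda>W. (D X (curvature A D Y Z W) - curvature A D Y Z (D X W))
      - curvature A D (D X Y) Z W - curvature A D Y (D X Z) W)"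
    by (intro tensorial_diff_fun tensorial_derivative[OF t3[OF Y Z] curvature_vf_map(1)[OF U Y Z] X U]
        t3 d X Y Z)
  then show "tensorial A U (\<lambda>W. cov_curvature A D X Y Z W)"
    by (rule tensorial_cong) (rule ext, simp add: cov_curvature_def)
qed

end

section \<open>Diffeomorphisms between open sets\<close>

text \<open>A diffeomorphism \<open>\<psi>\<close> with inverse \<open>\<phi>\<close>, described by its action on smooth functions; in this form it
  restricts to open subsets with the same maps \<open>\<psi>\<close> and \<open>\<phi>\<close>.\<close>

locale manifold_iso = tangent_manifold A
  for A :: "('m::{t2_space, second_countable_topology}, 'e::euclidean_space) chart set" +
  fixes W W' :: "'m set" and \<psi> \<phi> :: "'m \<Rightarrow> 'm"
  assumes open_W: "open W" and open_W': "open W'"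
    and maps: "x \<in> W \<Longrightarrow> \<psi> x \<in> W'" and maps': "y \<in> W' \<Longrightarrow> \<phi> y \<in> W"
    and inverse: "x \<in> W \<Longrightarrow> \<phi> (\<psi> x) = x" and inverse': "y \<in> W' \<Longrightarrow> \<psi> (\<phi> y) = y"
    and pull_open: "open G \<Longrightarrow> open (W \<inter> \<psi> -` G)" and pull_open': "open G \<Longrightarrow> open (W' \<inter> \<phi> -` G)"
    and pull_smooth: "open G \<Longrightarrow> smooth_fun A G f \<Longrightarrow> smooth_fun A (W \<inter> \<psi> -` G) (\<lambda>x. f (\<psi> x))"
    and pull_smooth': "open G \<Longrightarrow> smooth_fun A G f \<Longrightarrow> smooth_fun A (W' \<inter> \<phi> -` G) (\<lambda>x. f (\<phi> x))"

lemma (in tangent_manifold) manifold_iso_diffeo: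
  assumes "diffeo A A W W' \<psi>"
  shows "manifold_iso A W W' \<psi> (inv_into W \<psi>)"
proof
  have o: "open W" "open W'" and b: "bij_betw \<psi> W W'"
    and s: "smooth_map A A W \<psi>" "smooth_map A A W' (inv_into W \<psi>)"
    using assms by (auto simp: diffeo_def)
  show "open W" "open W'" by fact+
  show "\<psi> x \<in> W'" if "x \<in> W" for x using that b bij_betwE by blast
  show "inv_into W \<psi> y \<in> W" if "y \<in> W'" for y
    using that b by (metis bij_betw_imp_surj_on inv_into_into)
  show "inv_into W \<psi> (\<psi> x) = x" if "x \<in> W" for x using that b bij_betw_inv_into_left by metis
  show "\<psi> (inv_into W \<psi> y) = y" if "y \<in> W'" for y using that b bij_betw_inv_into_right by metis
  show "smooth_fun A (W \<inter> \<psi> -` G) (\<lambda>x. f (\<psi> x))" if "open G" "smooth_fun A G f" for G f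
    using smooth_fun_pullback(2)[OF o(1) s(1)] that by simp
  show "smooth_fun A (W' \<inter> inv_into W \<psi> -` G) (\<lambda>x. f (inv_into W \<psi> x))" if "open G" "smooth_fun A G f" for G f
    using smooth_fun_pullback(2)[OF o(2) s(2)] that by simp
  show "open (W \<inter> \<psi> -` G)" if "open G" for G
    using smooth_fun_pullback(1)[OF o(1) s(1) that smooth_fun_const] .
  show "open (W' \<inter> inv_into W \<psi> -` G)" if "open G" for G
    using smooth_fun_pullback(1)[OF o(2) s(2) that smooth_fun_const] .
qed

context manifold_iso
begin

lemma iso_inverse: "manifold_iso A W' W \<phi> \<psi>"
  by unfold_locales (simp_all add: open_W open_W' maps maps' inverse inverse' pull_open pull_open' pull_smooth pull_smooth')

lemma iso_restrict:
  assumes "open G" "G \<subseteq> W"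
  shows "manifold_iso A G (W' \<inter> \<phi> -` G) \<psi> \<phi>"
proof
  show "open (W' \<inter> \<phi> -` G)" using pull_open'[OF assms(1)] .
  have eq: "G \<inter> \<psi> -` H = G \<inter> (W \<inter> \<psi> -` H)" for H using assms by blast
  have eq': "W' \<inter> \<phi> -` G \<inter> \<phi> -` H = (W' \<inter> \<phi> -` G) \<inter> (W' \<inter> \<phi> -` H)" for H by blast
  show "open (G \<inter> \<psi> -` H)" if "open H" for H
    unfolding eq using assms pull_open[OF that] by blast
  show "open (W' \<inter> \<phi> -` G \<inter> \<phi> -` H)" if "open H" for H
    unfolding eq' using pull_open' assms that by blast
  show "smooth_fun A (G \<inter> \<psi> -` H) (\<lambda>x. f (\<psi> x))" if "open H" "smooth_fun A H f" for H f
    by (rule smooth_fun_subset[OF pull_smooth[OF that]]) (use assms in blast)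
  show "smooth_fun A (W' \<inter> \<phi> -` G \<inter> \<phi> -` H) (\<lambda>x. f (\<phi> x))" if "open H" "smooth_fun A H f" for H f
    by (rule smooth_fun_subset[OF pull_smooth'[OF that]]) blast
qed (use assms maps inverse inverse' in auto)

lemma smooth_at_pull:
  assumes "x \<in> W" "smooth_at A (\<psi> x) f" shows "smooth_at A x (\<lambda>y. f (\<psi> y))"
proof -
  obtain G where G: "open G" "\<psi> x \<in> G" "smooth_fun A G f" using assms(2) unfolding smooth_at_def by blast
  show ?thesis
    by (rule smooth_atI[OF pull_open[OF G(1)] _ pull_smooth[OF G(1,3)]]) (use assms G in auto)
qed

lemma differential_apply:
  "smooth_at A (\<psi> x) f \<Longrightarrow> differential A \<psi> x v f = v (\<lambda>y. f (\<psi> y))"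
  by (simp add: differential_def comp_def)

lemma differential_tangent:
  assumes x: "x \<in> W" and v: "v \<in> tangent_space A x"
  shows "differential A \<psi> x v \<in> tangent_space A (\<psi> x)"
proof (rule tangent_spaceI)
  fix f h a b assume fh: "smooth_at A (\<psi> x) f" "smooth_at A (\<psi> x) h"
  note p = smooth_at_pull[OF x]
  have "smooth_at A (\<psi> x) (\<lambda>y. a * f y + b * h y)"
    using fh by (intro smooth_at_add smooth_at_mult smooth_at_const)
  then show "differential A \<psi> x v (\<lambda>y. a * f y + b * h y) = a * differential A \<psi> x v f + b * differential A \<psi> x v h"
    using fh by (simp add: differential_apply tangent_lincomb[OF v p p])
  show "differential A \<psi> x v (\<lambda>y. f y * h y) = f (\<psi> x) * differential A \<psi> x v h + h (\<psi> x) * differential A \<psi> x v f"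
    using fh by (simp add: differential_apply smooth_at_mult tangent_mult[OF v p p])
qed (simp add: differential_def)

lemma differential_add: "differential A \<psi> x (v + w) = differential A \<psi> x v + differential A \<psi> x w"
  by (rule ext) (simp add: differential_def)

lemma differential_minus: "differential A \<psi> x (v - w) = differential A \<psi> x v - differential A \<psi> x w"
  by (rule ext) (simp add: differential_def)

lemma differential_uminus: "differential A \<psi> x (- v) = - differential A \<psi> x v"
  by (rule ext) (simp add: differential_def)

lemma differential_scale: "differential A \<psi> x (a *\<^sub>R v) = a *\<^sub>R differential A \<psi> x v"
  by (rule ext) (simp add: differential_def)

lemma differential_zero: "differential A \<psi> x 0 = 0"
  by (rule ext) (simp add: differential_def)

lemma differential_sum: "differential A \<psi> x (\<Sum>i\<in>J. v i) = (\<Sum>i\<in>J. differential A \<psi> x (v i))"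
  by (induction J rule: infinite_finite_induct)
    (simp_all only: sum.infinite sum.empty sum.insert differential_zero differential_add not_False_eq_True)

lemma differential_inverse:
  assumes x: "x \<in> W" and v: "v \<in> tangent_space A x"
  shows "differential A \<phi> (\<psi> x) (differential A \<psi> x v) = v"
proof -
  interpret inv: manifold_iso A W' W \<phi> \<psi> by (rule iso_inverse)
  note px = maps[OF x]
  have T: "differential A \<phi> (\<psi> x) (differential A \<psi> x v) \<in> tangent_space A x"
    using inv.differential_tangent[OF px differential_tangent[OF x v]] inverse[OF x] by simp
  show ?thesis
  proof (rule vf_eqI[OF T v])
    fix f assume f: "smooth_at A x f"
    then have f': "smooth_at A (\<phi> (\<psi> x)) f" using inverse[OF x] by simp
    have "differential A \<phi> (\<psi> x) (differential A \<psi> x v) f = v (\<lambda>y. f (\<phi> (\<psi> y)))"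
      using inv.differential_apply[OF f'] differential_apply[OF inv.smooth_at_pull[OF px f']] by simp
    also have "\<dots> = v f" by (rule tangent_germ[OF v open_W x]) (simp add: inverse)
    finally show "differential A \<phi> (\<psi> x) (differential A \<psi> x v) f = v f" .
  qed
qed

definition push :: "'m vfield \<Rightarrow> 'm vfield" where
  "push X y = differential A \<psi> (\<phi> y) (X (\<phi> y))"

text \<open>Relatedness is preserved by brackets, and for Witt isometries also by the canonical connection;
  everything built from these operations is then invariant by formal composition.\<close>

definition related :: "'m vfield \<Rightarrow> 'm vfield \<Rightarrow> bool" where
  "related X X' \<longleftrightarrow> (\<forall>x\<in>W. X' (\<psi> x) = differential A \<psi> x (X x))"

lemma related_push: "related X (push X)"
  by (simp add: related_def push_def inverse)

lemma push_vfields: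
  assumes G: "open G" "G \<subseteq> W" and X: "X \<in> vfields A G"
  shows "push X \<in> vfields A (W' \<inter> \<phi> -` G)"
proof (rule vfieldsI)
  interpret inv: manifold_iso A W' W \<phi> \<psi> by (rule iso_inverse)
  {
    fix y assume y: "y \<in> W' \<inter> \<phi> -` G"
    then show "push X y \<in> tangent_space A y"
      using differential_tangent[OF maps' vf_tangent[OF X], of y] by (simp add: push_def inverse')
  }
  fix H f assume H: "open H" "H \<subseteq> W' \<inter> \<phi> -` G" "smooth_fun A H f"
  let ?K = "G \<inter> (W \<inter> \<psi> -` H)"
  have K: "open ?K" using G pull_open[OF H(1)] by blast
  have "smooth_fun A ?K (\<lambda>x. X x (\<lambda>z. f (\<psi> z)))"
    by (rule vf_smooth[OF X K]) (auto intro: smooth_fun_subset[OF pull_smooth[OF H(1,3)]])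
  from pull_smooth'[OF K this]
  have "smooth_fun A H (\<lambda>y. X (\<phi> y) (\<lambda>z. f (\<psi> z)))"
    by (rule smooth_fun_subset) (use H maps' inverse' in auto)
  then show "smooth_fun A H (\<lambda>y. push X y f)"
  proof (rule smooth_fun_cong[OF H(1), rotated])
    fix y assume y: "y \<in> H"
    then have "smooth_at A (\<psi> (\<phi> y)) f" using smooth_atI[OF H(1) _ H(3)] inverse' H by auto
    then show "X (\<phi> y) (\<lambda>z. f (\<psi> z)) = push X y f" by (simp add: push_def differential_apply)
  qed
qed

lemma push_vf: "X \<in> vfields A W \<Longrightarrow> push X \<in> vfields A W'"
  using push_vfields[OF open_W order_refl, of X] maps' by (simp add: Int_absorb2 subset_eq)

lemma push_add: "push (X + Y) = push X + push Y"
  by (rule ext) (simp add: push_def differential_add del: plus_fun_apply add: plus_fun_apply[of X] plus_fun_apply[of "push X"])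

lemma push_scale: "push (\<lambda>x. f x *\<^sub>R X x) = (\<lambda>y. f (\<phi> y) *\<^sub>R push X y)"
  by (rule ext) (simp only: push_def differential_scale)

lemma related_apply:
  "related X X' \<Longrightarrow> x \<in> W \<Longrightarrow> smooth_at A (\<psi> x) f \<Longrightarrow> X' (\<psi> x) f = X x (\<lambda>y. f (\<psi> y))"
  by (simp add: related_def differential_apply)

lemma related_diff: "related X X' \<Longrightarrow> related Y Y' \<Longrightarrow> related (X - Y) (X' - Y')"
  unfolding related_def by (simp add: differential_minus minus_apply[of X] minus_apply[of X'] del: minus_apply)

lemma related_lie_bracket:
  assumes X: "X \<in> vfields A W" "X' \<in> vfields A W'" "related X X'"
    and Y: "Y \<in> vfields A W" "Y' \<in> vfields A W'" "related Y Y'"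
  shows "related (lie_bracket A X Y) (lie_bracket A X' Y')"
  unfolding related_def
proof
  fix x assume x: "x \<in> W"
  have half: "P' (\<psi> x) (\<lambda>y. Q' y f) = P x (\<lambda>y. Q y (\<lambda>z. f (\<psi> z)))"
    if P: "P \<in> vfields A W" "P' \<in> vfields A W'" "related P P'"
      and Q: "Q \<in> vfields A W" "Q' \<in> vfields A W'" "related Q Q'" and f: "smooth_at A (\<psi> x) f"
    for P P' Q Q' f
  proof -
    obtain G where G: "open G" "\<psi> x \<in> G" "G \<subseteq> W'" "\<And>y. y \<in> G \<Longrightarrow> smooth_at A y f"
      using smooth_atE[OF f open_W' maps[OF x]] by metis
    have "P' (\<psi> x) (\<lambda>y. Q' y f) = P x (\<lambda>y. Q' (\<psi> y) f)"
      by (rule related_apply[OF P(3) x vf_smooth_at[OF Q(2) open_W' maps[OF x] f]])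
    also have "\<dots> = P x (\<lambda>y. Q y (\<lambda>z. f (\<psi> z)))"
      by (rule tangent_germ[OF vf_tangent[OF P(1) x] pull_open[OF G(1)]])
        (use x G related_apply[OF Q(3)] in auto)
    finally show ?thesis .
  qed
  show "lie_bracket A X' Y' (\<psi> x) = differential A \<psi> x (lie_bracket A X Y x)"
  proof
    fix f
    show "lie_bracket A X' Y' (\<psi> x) f = differential A \<psi> x (lie_bracket A X Y x) f"
    proof (cases "smooth_at A (\<psi> x) f")
      case True
      then show ?thesis
        by (simp only: lie_bracket_apply differential_apply smooth_at_pull[OF x] half[OF X Y] half[OF Y X])
    qed (simp add: lie_bracket_def differential_def)
  qed
qed

end

context tangent_manifold
begin

lemma tensorial_sum:
  assumes F: "tensorial A U F" "open W" "W \<subseteq> U" and x: "x \<in> W"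
    and X: "finite J" "\<And>j. j \<in> J \<Longrightarrow> X j \<in> vfields A W"
  shows "F (\<Sum>j\<in>J. X j) x = (\<Sum>j\<in>J. F (X j) x)"
  using X
proof (induction J)
  case empty
  have "F (\<lambda>y. 0 *\<^sub>R (0 :: 'm vfield) y) x = 0 *\<^sub>R F 0 x"
    by (rule tensorial_scale[OF F vf_zero smooth_fun_const x])
  then show ?case by (simp add: zero_fun_def)
next
  case (insert j J)
  have "F (X j + (\<Sum>j\<in>J. X j)) x = F (X j) x + F (\<Sum>j\<in>J. X j) x"
    by (rule tensorial_add[OF F _ vf_sum x]) (use insert.prems in auto)
  moreover have "F (\<Sum>j\<in>J. X j) x = (\<Sum>j\<in>J. F (X j) x)"
    using insert.IH insert.prems by blast
  ultimately show ?case by (simp only: sum.insert[OF insert.hyps])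
qed

end

section \<open>The algebra of a Witt structure\<close>

text \<open>The properties of a Witt structure on which the argument rests, with the involution \<open>star\<close> on
  the index set in place of the three families of indices.\<close>

locale witt_manifold = connection_manifold A D
  for A :: "('m::{t2_space, second_countable_topology}, 'e::euclidean_space) chart set"
    and D :: "'m connection" +
  fixes g :: "'m metric_field" and I :: "int set" and star :: "int \<Rightarrow> int"
    and V :: "int \<Rightarrow> 'm \<Rightarrow> 'm tangent set"
  assumes metric: "pseudo_riemannian_metric A g"
    and finite_index: "finite I"
    and subbundle: "i \<in> I \<Longrightarrow> smooth_subbundle A (V i)"
    and decomposition: "direct_sum_decomposition I (\<lambda>i. V i x) (tangent_space A x)"
    and star_index: "i \<in> I \<Longrightarrow> star i \<in> I"
    and orthogonal: "i \<in> I \<Longrightarrow> j \<in> I \<Longrightarrow> j \<noteq> i \<Longrightarrow> j \<noteq> star i \<Longrightarrow> u \<in> V i x \<Longrightarrow> w \<in> V j x \<Longrightarrow> g x u w = 0"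
    and pairing: "i \<in> I \<Longrightarrow> star i \<noteq> i \<Longrightarrow> u \<in> V i x \<Longrightarrow> (\<And>w. w \<in> V (star i) x \<Longrightarrow> g x u w = 0) \<Longrightarrow> u = 0"
    and anisotropic: "i \<in> I \<Longrightarrow> star i = i \<Longrightarrow> u \<in> V i x \<Longrightarrow> g x u u = 0 \<Longrightarrow> u = 0"
    and canonical: "canonical_witt_connection A g I star V D"
begin

lemmas g_axioms = metric[unfolded pseudo_riemannian_metric_def]
lemmas g_linear_left = g_axioms[THEN conjunct1, rule_format]
  and g_sym = g_axioms[THEN conjunct2, THEN conjunct1, rule_format]
  and g_nondegenerate_ball = g_axioms[THEN conjunct2, THEN conjunct2, THEN conjunct1, rule_format]
  and g_smooth = g_axioms[THEN conjunct2, THEN conjunct2, THEN conjunct2, rule_format]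

lemma g_nondegenerate:
  "u \<in> tangent_space A x \<Longrightarrow> (\<And>v. v \<in> tangent_space A x \<Longrightarrow> g x u v = 0) \<Longrightarrow> u = 0"
  by (rule g_nondegenerate_ball) auto

lemma g_linear_right:
  assumes "u \<in> tangent_space A x" "v \<in> tangent_space A x" "w \<in> tangent_space A x"
  shows "g x w (a *\<^sub>R u + b *\<^sub>R v) = a * g x w u + b * g x w v"
  using g_linear_left[OF assms] g_sym[OF assms(3)] assms
  by (simp only: tangent_plus tangent_scale)

lemma g_add_left: "u \<in> tangent_space A x \<Longrightarrow> v \<in> tangent_space A x \<Longrightarrow> w \<in> tangent_space A x \<Longrightarrow>
    g x (u + v) w = g x u w + g x v w"
  using g_linear_left[of u x v w 1 1] by (simp only: scaleR_one mult_1)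

lemma g_diff_left: "u \<in> tangent_space A x \<Longrightarrow> v \<in> tangent_space A x \<Longrightarrow> w \<in> tangent_space A x \<Longrightarrow>
    g x (u - v) w = g x u w - g x v w"
  using g_linear_left[of u x v w 1 "-1"]
  by (simp only: scaleR_one mult_1 scaleR_minus_left mult_minus_left diff_conv_add_uminus)

lemma g_scale_left: "u \<in> tangent_space A x \<Longrightarrow> w \<in> tangent_space A x \<Longrightarrow> g x (a *\<^sub>R u) w = a * g x u w"
  using g_linear_left[of u x u w a 0] by (simp only: scaleR_zero_left mult_zero_left add_0_right)

lemma g_add_right: "u \<in> tangent_space A x \<Longrightarrow> v \<in> tangent_space A x \<Longrightarrow> w \<in> tangent_space A x \<Longrightarrow>
    g x w (u + v) = g x w u + g x w v"
  using g_linear_right[of u x v w 1 1] by (simp only: scaleR_one mult_1)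

lemma g_diff_right: "u \<in> tangent_space A x \<Longrightarrow> v \<in> tangent_space A x \<Longrightarrow> w \<in> tangent_space A x \<Longrightarrow>
    g x w (u - v) = g x w u - g x w v"
  using g_linear_right[of u x v w 1 "-1"]
  by (simp only: scaleR_one mult_1 scaleR_minus_left mult_minus_left diff_conv_add_uminus)

lemma g_scale_right: "u \<in> tangent_space A x \<Longrightarrow> w \<in> tangent_space A x \<Longrightarrow> g x w (a *\<^sub>R u) = a * g x w u"
  using g_linear_right[of u x u w a 0] by (simp only: scaleR_zero_left mult_zero_left add_0_right)

lemma g_zero_left: "w \<in> tangent_space A x \<Longrightarrow> g x 0 w = 0"
  using g_scale_left[OF tangent_zero, of w x 0] by (simp only: scaleR_zero_left mult_zero_left)

lemma V_tangent: "i \<in> I \<Longrightarrow> u \<in> V i x \<Longrightarrow> u \<in> tangent_space A x"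
  using decomposition[of x] unfolding direct_sum_decomposition_def by blast

lemma local_frame:
  assumes i: "i \<in> I"
  obtains k :: nat and H X where "open H" "x \<in> H" "\<And>j. j < k \<Longrightarrow> X j \<in> vfields A H"
    "inj_on (\<lambda>j. X j x) {..<k}" "\<And>y. y \<in> H \<Longrightarrow> span ((\<lambda>j. X j y) ` {..<k}) = V i y"
proof -
  obtain k :: nat where k: "\<forall>x. \<exists>U X. open U \<and> x \<in> U \<and>
     (\<forall>j<k. X j \<in> vfields A U) \<and>
     (\<forall>y\<in>U. inj_on (\<lambda>j. X j y) {..<k} \<and> independent ((\<lambda>j. X j y) ` {..<k}) \<and>
        span ((\<lambda>j. X j y) ` {..<k}) = V i y)"
    using subbundle[OF i] unfolding smooth_subbundle_def by (elim exE)
  from spec[OF k, of x] obtain H X where HX: "open H \<and> x \<in> H \<and>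
     (\<forall>j<k. X j \<in> vfields A H) \<and>
     (\<forall>y\<in>H. inj_on (\<lambda>j. X j y) {..<k} \<and> independent ((\<lambda>j. X j y) ` {..<k}) \<and>
        span ((\<lambda>j. X j y) ` {..<k}) = V i y)" by (elim exE)
  show thesis by (rule that[of H k X]) (use HX in simp_all)
qed

lemma V_subspace: assumes "i \<in> I" shows "subspace (V i x)"
proof (rule local_frame[OF assms, of x])
  fix k :: nat and H and X :: "nat \<Rightarrow> 'm vfield"
  assume "x \<in> H" "\<And>y. y \<in> H \<Longrightarrow> span ((\<lambda>j. X j y) ` {..<k}) = V i y"
  then show ?thesis using subspace_span by metis
qed

text \<open>The coefficients with respect to a local frame are kept constant.\<close>

lemma V_section:
  assumes i: "i \<in> I" and u: "u \<in> V i x" and U: "open U" "x \<in> U"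
  obtains G Z where "open G" "x \<in> G" "G \<subseteq> U" "Z \<in> sections A G (V i)" "Z x = u"
proof -
  obtain k :: nat and H X where H: "open H" "x \<in> H" and X: "\<And>j. j < k \<Longrightarrow> X j \<in> vfields A H"
    and inj: "inj_on (\<lambda>j. X j x) {..<k}"
    and span: "\<And>y. y \<in> H \<Longrightarrow> span ((\<lambda>j. X j y) ` {..<k}) = V i y"
    by (rule local_frame[OF i, of x]) (rule that; assumption)
  have "u \<in> span ((\<lambda>j. X j x) ` {..<k})" using span[OF H(2)] u by simp
  then obtain a where a: "u = (\<Sum>v\<in>(\<lambda>j. X j x) ` {..<k}. a v *\<^sub>R v)"
    by (auto simp: span_finite)
  define Z where "Z = (\<Sum>j<k. (\<lambda>y. a (X j x) *\<^sub>R X j y))"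
  have Zy: "Z y = (\<Sum>j<k. a (X j x) *\<^sub>R X j y)" for y
    unfolding Z_def by (rule sum_fun_apply)
  have "Z x = u" unfolding Zy a by (rule sum.reindex[OF inj, unfolded comp_def, symmetric])
  moreover have "Z \<in> vfields A H" unfolding Z_def by (intro vf_sum vf_scaleR X) simp
  then have "Z \<in> vfields A (H \<inter> U)" by (rule vfields_subset) simp
  moreover have "Z y \<in> V i y" if "y \<in> H" for y
    unfolding Zy span[OF that, symmetric] by (intro span_sum span_scale span_base) simp
  ultimately show thesis using that[of "H \<inter> U" Z] H U by (simp add: sections_def open_Int)
qed

abbreviation P :: "int \<Rightarrow> 'm \<Rightarrow> 'm tangent \<Rightarrow> 'm tangent" where
  "P \<equiv> witt_proj I V"

lemma proj_unique:
  assumes u: "\<And>i. i \<in> I \<Longrightarrow> u i \<in> V i x" and i: "i \<in> I"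
  shows "P i x (\<Sum>i\<in>I. u i) = u i"
proof -
  let ?v = "\<Sum>i\<in>I. u i"
  have "?v \<in> tangent_space A x" by (rule tangent_sum) (use u V_tangent in blast)
  then have ex: "\<exists>!w. w \<in> (\<Pi>\<^sub>E i\<in>I. V i x) \<and> ?v = (\<Sum>i\<in>I. w i)"
    using decomposition[of x] unfolding direct_sum_decomposition_def by blast
  have "restrict u I \<in> (\<Pi>\<^sub>E i\<in>I. V i x) \<and> ?v = (\<Sum>i\<in>I. restrict u I i)"
    using u by (auto simp: restrict_PiE_iff intro: sum.cong)
  then have "(THE w. w \<in> (\<Pi>\<^sub>E i\<in>I. V i x) \<and> ?v = (\<Sum>i\<in>I. w i)) = restrict u I"
    by (intro the1_equality[OF ex])
  then show ?thesis using i by (simp add: witt_proj_def)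
qed

lemma proj_sum:
  assumes "v \<in> tangent_space A x"
  shows "(\<Sum>i\<in>I. P i x v) = v" "i \<in> I \<Longrightarrow> P i x v \<in> V i x"
proof -
  have ex: "\<exists>!w. w \<in> (\<Pi>\<^sub>E i\<in>I. V i x) \<and> v = (\<Sum>i\<in>I. w i)"
    using decomposition[of x] assms unfolding direct_sum_decomposition_def by blast
  from theI'[OF ex] show "(\<Sum>i\<in>I. P i x v) = v" "i \<in> I \<Longrightarrow> P i x v \<in> V i x"
    unfolding witt_proj_def by (auto dest: PiE_mem)
qed

lemma proj_V:
  assumes "i \<in> I" "v \<in> V i x" "k \<in> I"
  shows "P k x v = (if k = i then v else 0)"
proof -
  have "(\<Sum>k\<in>I. if k = i then v else 0) = v" using assms(1) finite_index by simp
  moreover have "P k x (\<Sum>k\<in>I. if k = i then v else 0) = (if k = i then v else 0)"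
    by (rule proj_unique) (use assms subspace_0[OF V_subspace] in auto)
  ultimately show ?thesis by simp
qed

lemma V_independent: "i \<in> I \<Longrightarrow> j \<in> I \<Longrightarrow> i \<noteq> j \<Longrightarrow> v \<in> V i x \<Longrightarrow> v \<in> V j x \<Longrightarrow> v = 0"
  using proj_V[of i v x i] proj_V[of j v x i] by simp

text \<open>The subbundles span the tangent spaces, so a function-linear map vanishes as soon as it
  vanishes on their local sections.\<close>

lemma tensorial_sections_zero:
  assumes F: "tensorial A U F" and U: "open U" "x \<in> U"
    and zero: "\<And>i G Z. i \<in> I \<Longrightarrow> open G \<Longrightarrow> G \<subseteq> U \<Longrightarrow> x \<in> G \<Longrightarrow> Z \<in> sections A G (V i) \<Longrightarrow> F Z x = 0"
    and X: "X \<in> vfields A W" "open W" "x \<in> W"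
  shows "F X x = 0"
proof -
  have "\<exists>G Z. open G \<and> x \<in> G \<and> G \<subseteq> U \<and> Z \<in> sections A G (V i) \<and> Z x = P i x (X x)" if "i \<in> I" for i
    using V_section[OF that proj_sum(2)[OF vf_tangent[OF X(1,3)] that] U] by metis
  then obtain G Z where G: "\<And>i. i \<in> I \<Longrightarrow> open (G i) \<and> x \<in> G i \<and> G i \<subseteq> U"
    and Z: "\<And>i. i \<in> I \<Longrightarrow> Z i \<in> sections A (G i) (V i) \<and> Z i x = P i x (X x)" by metis
  define H where "H = U \<inter> (\<Inter>i\<in>I. G i)"
  have H: "open H" "H \<subseteq> U" "x \<in> H"
    unfolding H_def using G U finite_index by (auto intro!: open_Int open_INT)
  have ZH: "Z i \<in> vfields A H" if "i \<in> I" for i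
    by (rule vfields_subset[of _ "G i"]) (use Z[OF that] that in \<open>auto simp: sections_def H_def\<close>)
  have Zx: "(\<Sum>i\<in>I. Z i) x = X x"
    using Z proj_sum(1)[OF vf_tangent[OF X(1,3)]] by (simp only: sum_fun_apply cong: sum.cong)
  have "F X x = F (\<Sum>i\<in>I. Z i) x"
    using Zx by (intro tensorial_pointwise[OF F U X vf_sum[OF ZH] H(1,3)]) simp_all
  also have "\<dots> = (\<Sum>i\<in>I. F (Z i) x)" by (rule tensorial_sum[OF F H finite_index ZH])
  also have "\<dots> = 0" using zero G Z by (intro sum.neutral) blast
  finally show ?thesis .
qed

lemma D_metric:
  assumes "open U" "X \<in> vfields A U" "Y \<in> vfields A U" "Z \<in> vfields A U" "x \<in> U"
  shows "X x (\<lambda>y. g y (Y y) (Z y)) = g x (D X Y x) (Z x) + g x (Y x) (D X Z x)"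
  using canonical assms unfolding canonical_witt_connection_def metric_connection_def by simp

lemma D_preserves:
  assumes "i \<in> I" "open U" "X \<in> vfields A U" "Y \<in> sections A U (V i)" "x \<in> U"
  shows "D X Y x \<in> V i x"
  using canonical assms unfolding canonical_witt_connection_def preserves_subbundle_def sections_def by simp

lemma torsion_formula:
  assumes "open U" "i \<in> I" "j \<in> I" "X \<in> sections A U (V i)" "Y \<in> sections A U (V j)" "x \<in> U"
  shows "torsion A D X Y x =
          - (\<Sum>k\<in>I - {i, j}. P k x (lie_bracket A X Y x))
          + witt_T A g I star V j i X j Y x - witt_T A g I star V i j Y i X x"
  using canonical assms unfolding canonical_witt_connection_def by simp

section \<open>Musical isomorphisms and Lie derivatives of forms\<close>

definition linear_form :: "'m \<Rightarrow> ('m tangent \<Rightarrow> real) \<Rightarrow> bool" where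
  "linear_form x \<alpha> \<longleftrightarrow> (\<forall>u\<in>tangent_space A x. \<forall>v\<in>tangent_space A x. \<forall>a b.
     \<alpha> (a *\<^sub>R u + b *\<^sub>R v) = a * \<alpha> u + b * \<alpha> v)"

lemma sharp_unique:
  assumes "v \<in> tangent_space A x" "\<And>w. w \<in> tangent_space A x \<Longrightarrow> g x v w = \<alpha> x w"
  shows "sharp A g \<alpha> x = v"
  unfolding sharp_def
proof (rule the_equality)
  fix v' assume v': "v' \<in> tangent_space A x \<and> (\<forall>w\<in>tangent_space A x. g x v' w = \<alpha> x w)"
  have "v' - v = 0"
    by (rule g_nondegenerate[of _ x]) (use assms v' in \<open>simp_all only: tangent_minus g_diff_left diff_self\<close>)
  then show "v' = v" by (simp only: right_minus_eq)
qed (use assms in blast)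

text \<open>Nondegeneracy makes the map from vectors to linear forms injective, hence onto in finite
  dimension. The parametrisation \<open>L\<close> turns it into an endomorphism of the model space.\<close>

lemma sharp_exists:
  assumes lin: "linear_form x (\<alpha> x)"
  shows "\<exists>v\<in>tangent_space A x. \<forall>w\<in>tangent_space A x. g x v w = \<alpha> x w"
proof -
  obtain L :: "'e \<Rightarrow> 'm tangent" where L: "linear L" "bij_betw L UNIV (tangent_space A x)"
    using tangent_param by blast
  have T: "L e \<in> tangent_space A x" for e using L(2) bij_betwE by blast
  have surjL: "\<exists>e. w = L e" if "w \<in> tangent_space A x" for w
    using L(2) that unfolding bij_betw_def by blast
  have lin1: "linear (\<lambda>c. g x (L e) (L c))" for e
    by (rule linearI) (simp_all only: linear_add[OF L(1)] linear_scale[OF L(1)] g_add_right g_scale_right T real_scaleR_def)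
  have lin2: "linear (\<lambda>c. g x (L c) (L e))" for e
    by (rule linearI) (simp_all only: linear_add[OF L(1)] linear_scale[OF L(1)] g_add_left g_scale_left T real_scaleR_def)
  have lin3: "linear (\<lambda>c. \<alpha> x (L c))"
  proof (rule linearI)
    have *: "\<alpha> x (a *\<^sub>R L u + b *\<^sub>R L v) = a * \<alpha> x (L u) + b * \<alpha> x (L v)" for a b u v
      using lin T unfolding linear_form_def by blast
    show "\<alpha> x (L (u + v)) = \<alpha> x (L u) + \<alpha> x (L v)" for u v
      using *[of 1 u 1 v] by (simp only: linear_add[OF L(1)] scaleR_one mult_1)
    show "\<alpha> x (L (a *\<^sub>R u)) = a *\<^sub>R \<alpha> x (L u)" for a u
      using *[of a u 0 u] by (simp only: linear_scale[OF L(1)] scaleR_zero_left mult_zero_left add_0_right real_scaleR_def)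
  qed
  define M where "M = (\<lambda>e. \<Sum>b\<in>Basis. g x (L e) (L b) *\<^sub>R b)"
  have Mb: "M e \<bullet> b = g x (L e) (L b)" if "b \<in> Basis" for e b
    using that by (simp add: M_def inner_sum_left inner_Basis if_distrib cong: if_cong)
  have linM: "linear M"
    unfolding M_def by (intro linear_compose_sum ballI linear_compose[OF lin2 linear_scaleR_left, unfolded comp_def])
  have injM: "inj M"
    unfolding linear_injective_0[OF linM]
  proof (intro allI impI)
    fix e assume "M e = 0"
    then have "g x (L e) (L b) = 0" if "b \<in> Basis" for b using Mb[OF that, of e] by simp
    then have "(\<lambda>c. g x (L e) (L c)) = (\<lambda>c. 0)"
      by (intro linear_eq_stdbasis[OF lin1 linear_zero])
    then have "L e = 0"
      using surjL by (intro g_nondegenerate[OF T]) metis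
    then have "L e = L 0" using linear_0[OF L(1)] by simp
    then show "e = 0" using L(2) unfolding bij_betw_def inj_on_def by blast
  qed
  obtain e where e: "M e = (\<Sum>b\<in>Basis. \<alpha> x (L b) *\<^sub>R b)"
    using linear_injective_imp_surjective[OF linM injM refl] by (metis surjD)
  have "g x (L e) (L b) = \<alpha> x (L b)" if "b \<in> Basis" for b
    using Mb[OF that, of e] that unfolding e
    by (simp add: inner_sum_left inner_Basis if_distrib cong: if_cong)
  then have "(\<lambda>c. g x (L e) (L c)) = (\<lambda>c. \<alpha> x (L c))"
    by (intro linear_eq_stdbasis[OF lin1 lin3])
  then have "\<forall>w\<in>tangent_space A x. g x (L e) w = \<alpha> x w" using surjL by metis
  then show ?thesis using T by blast
qed

lemma sharp_char:
  assumes "linear_form x (\<alpha> x)"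
  shows "sharp A g \<alpha> x \<in> tangent_space A x"
    and "w \<in> tangent_space A x \<Longrightarrow> g x (sharp A g \<alpha> x) w = \<alpha> x w"
proof -
  obtain v where v: "v \<in> tangent_space A x" "\<And>w. w \<in> tangent_space A x \<Longrightarrow> g x v w = \<alpha> x w"
    using sharp_exists[of x \<alpha>, OF assms] by blast
  show "sharp A g \<alpha> x \<in> tangent_space A x"
    and "w \<in> tangent_space A x \<Longrightarrow> g x (sharp A g \<alpha> x) w = \<alpha> x w"
    using sharp_unique[of v x \<alpha>, OF v] v by simp_all
qed

text \<open>The expression \<open>(\<L>\<^sub>X Y\<^sup>\<flat>)(Z)\<close> for vector fields. It is function-linear in \<open>Z\<close>, so its value at a
  point depends on the value of \<open>Z\<close> only; hence the definite description that defines the Lie derivative of a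
  form denotes this value.\<close>

definition lie_flat :: "'m vfield \<Rightarrow> 'm vfield \<Rightarrow> 'm vfield \<Rightarrow> 'm \<Rightarrow> real" where
  "lie_flat X Y Z x = X x (\<lambda>y. g y (Y y) (Z y)) - g x (Y x) (lie_bracket A X Z x)"

lemma lie_flat_tensorial:
  assumes U: "open U" and X: "X \<in> vfields A U" and Y: "Y \<in> vfields A U"
  shows "tensorial A U (lie_flat X Y)"
proof (rule tensorialI)
  fix W Z Z' x assume a: "open W" "W \<subseteq> U" "Z \<in> vfields A W" "Z' \<in> vfields A W" "x \<in> W"
  have X: "X \<in> vfields A W" and Y: "Y \<in> vfields A W" using X Y a(2) vfields_subset by blast+
  note T = vf_tangent[OF _ a(5)] and b = vf_lie_bracket[OF a(1)]
  have s: "smooth_at A x (\<lambda>y. g y (Y y) (Z y))" if "Z \<in> vfields A W" for Z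
    using smooth_atI[OF a(1,5) g_smooth[OF a(1) Y that]] .
  have "X x (\<lambda>y. g y (Y y) ((Z + Z') y)) = X x (\<lambda>y. g y (Y y) (Z y) + g y (Y y) (Z' y))"
    by (rule tangent_germ[OF T[OF X] a(1,5)])
      (simp only: plus_fun_apply[of Z] g_add_right vf_tangent[OF a(3)] vf_tangent[OF a(4)] vf_tangent[OF Y])
  also have "\<dots> = X x (\<lambda>y. g y (Y y) (Z y)) + X x (\<lambda>y. g y (Y y) (Z' y))"
    by (rule tangent_add[OF T[OF X] s[OF a(3)] s[OF a(4)]])
  finally show "lie_flat X Y (Z + Z') x = lie_flat X Y Z x + lie_flat X Y Z' x"
    unfolding lie_flat_def lie_bracket_add_right[OF a(1,5) X a(3,4)]
      g_add_right[OF T[OF b[OF X a(3)]] T[OF b[OF X a(4)]] T[OF Y]] by simp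
next
  fix W Z f x assume a: "open W" "W \<subseteq> U" "Z \<in> vfields A W" "smooth_fun A W f" "x \<in> W"
  have X: "X \<in> vfields A W" and Y: "Y \<in> vfields A W" using X Y a(2) vfields_subset by blast+
  note T = vf_tangent[OF _ a(5)] and b = vf_lie_bracket[OF a(1)]
  have s: "smooth_at A x (\<lambda>y. g y (Y y) (Z y))"
    using smooth_atI[OF a(1,5) g_smooth[OF a(1) Y a(3)]] .
  have "X x (\<lambda>y. g y (Y y) (f y *\<^sub>R Z y)) = X x (\<lambda>y. f y * g y (Y y) (Z y))"
    by (rule tangent_germ[OF T[OF X] a(1,5)])
      (simp only: g_scale_right vf_tangent[OF a(3)] vf_tangent[OF Y])
  also have "\<dots> = f x * X x (\<lambda>y. g y (Y y) (Z y)) + g x (Y x) (Z x) * X x f"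
    by (rule tangent_mult[OF T[OF X] smooth_atI[OF a(1,5,4)] s])
  finally show "lie_flat X Y (\<lambda>y. f y *\<^sub>R Z y) x = f x *\<^sub>R lie_flat X Y Z x"
    unfolding lie_flat_def lie_bracket_scale_right[OF a(1,5) X a(3,4)]
      g_linear_right[OF T[OF b[OF X a(3)]] T[OF a(3)] T[OF Y]] by (simp add: algebra_simps)
qed

lemma lie_form_eq:
  assumes U: "open U" "x \<in> U" and X: "X \<in> vfields A U" and Y: "Y \<in> vfields A U"
    and Z: "Z \<in> vfields A G" "open G" "x \<in> G"
  shows "lie_form A X (flat g Y) x (Z x) = lie_flat X Y Z x"
  unfolding lie_form_def
proof (rule the_equality)
  show "\<exists>U Z'. open U \<and> x \<in> U \<and> Z' \<in> vfields A U \<and> Z' x = Z x \<and>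
     lie_flat X Y Z x = X x (\<lambda>y. flat g Y y (Z' y)) - flat g Y x (lie_bracket A X Z' x)"
    using Z by (intro exI[of _ G] exI[of _ Z]) (simp add: lie_flat_def flat_def)
next
  fix a assume "\<exists>U Z'. open U \<and> x \<in> U \<and> Z' \<in> vfields A U \<and> Z' x = Z x \<and>
     a = X x (\<lambda>y. flat g Y y (Z' y)) - flat g Y x (lie_bracket A X Z' x)"
  then obtain H Z' where H: "open H" "x \<in> H" "Z' \<in> vfields A H" "Z' x = Z x" "a = lie_flat X Y Z' x"
    unfolding lie_flat_def flat_def by blast
  show "a = lie_flat X Y Z x"
    unfolding H(5) by (rule tensorial_pointwise[OF lie_flat_tensorial[OF U(1) X Y] U H(3,1,2) Z H(4)])
qed

lemma lie_form_linear:
  assumes U: "open U" "x \<in> U" and X: "X \<in> vfields A U" and Y: "Y \<in> vfields A U"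
  shows "linear_form x (lie_form A X (flat g Y) x)"
  unfolding linear_form_def
proof (intro ballI allI)
  fix u v a b assume u: "u \<in> tangent_space A x" and v: "v \<in> tangent_space A x"
  obtain G Z where G: "open G" "x \<in> G" "Z \<in> vfields A G" "Z x = u" using tangent_extend[OF u] .
  obtain H Z' where H: "open H" "x \<in> H" "Z' \<in> vfields A H" "Z' x = v" using tangent_extend[OF v] .
  define K where "K = U \<inter> (G \<inter> H)"
  have K: "open K" "x \<in> K" "K \<subseteq> U" using U G H by (auto simp: K_def)
  have Z: "Z \<in> vfields A K" "Z' \<in> vfields A K"
    using G H by (auto simp: K_def intro: vfields_subset)
  note t = lie_flat_tensorial[OF U(1) X Y] and e = lie_form_eq[OF U X Y _ K(1,2)]
  have "lie_form A X (flat g Y) x (a *\<^sub>R u + b *\<^sub>R v) = lie_flat X Y ((\<lambda>y. a *\<^sub>R Z y) + (\<lambda>y. b *\<^sub>R Z' y)) x"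
    using e[OF vf_plus[OF vf_scaleR[OF Z(1)] vf_scaleR[OF Z(2)]], of a b] G(4) H(4)
    by (simp only: plus_fun_apply[of "\<lambda>y. a *\<^sub>R Z y"])
  also have "\<dots> = a * lie_flat X Y Z x + b * lie_flat X Y Z' x"
    unfolding tensorial_add[OF t K(1,3) vf_scaleR[OF Z(1)] vf_scaleR[OF Z(2)] K(2)]
      tensorial_scale[OF t K(1,3) Z(1) smooth_fun_const K(2)] tensorial_scale[OF t K(1,3) Z(2) smooth_fun_const K(2)]
    by simp
  finally show "lie_form A X (flat g Y) x (a *\<^sub>R u + b *\<^sub>R v)
      = a * lie_form A X (flat g Y) x u + b * lie_form A X (flat g Y) x v"
    using e[OF Z(1)] e[OF Z(2)] G(4) H(4) by simp
qed

end

section \<open>Witt isometries preserve the canonical connection\<close>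

lemma diff_swap: "p - q - c = a - b - c \<Longrightarrow> p - a = q - b" for p :: "'a::ab_group_add"
  by (simp add: algebra_simps)

locale witt_iso = witt_manifold A D g I star V + manifold_iso A W W' \<psi> \<phi>
  for A :: "('m::{t2_space, second_countable_topology}, 'e::euclidean_space) chart set"
    and D :: "'m connection" and g :: "'m metric_field" and I :: "int set" and star :: "int \<Rightarrow> int"
    and V :: "int \<Rightarrow> 'm \<Rightarrow> 'm tangent set"
    and W W' :: "'m set" and \<psi> \<phi> :: "'m \<Rightarrow> 'm" +
  assumes isometry: "x \<in> W \<Longrightarrow> v \<in> tangent_space A x \<Longrightarrow> w \<in> tangent_space A x \<Longrightarrow>
      g (\<psi> x) (differential A \<psi> x v) (differential A \<psi> x w) = g x v w"
    and preserves: "i \<in> I \<Longrightarrow> x \<in> W \<Longrightarrow> v \<in> V i x \<Longrightarrow> differential A \<psi> x v \<in> V i (\<psi> x)"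
begin

lemma witt_iso_restrict:
  assumes "open G" "G \<subseteq> W"
  shows "witt_iso A D g I star V G (W' \<inter> \<phi> -` G) \<psi> \<phi>"
proof -
  interpret r: manifold_iso A G "W' \<inter> \<phi> -` G" \<psi> \<phi> by (rule iso_restrict[OF assms])
  show ?thesis by unfold_locales (use assms isometry preserves in auto)
qed

lemma differential_inverse':
  assumes "x \<in> W" "w \<in> tangent_space A (\<psi> x)"
  shows "differential A \<phi> (\<psi> x) w \<in> tangent_space A x"
    and "differential A \<psi> x (differential A \<phi> (\<psi> x) w) = w"
proof -
  interpret inv: manifold_iso A W' W \<phi> \<psi> by (rule iso_inverse)
  show "differential A \<phi> (\<psi> x) w \<in> tangent_space A x"
    using inv.differential_tangent[OF maps[OF assms(1)] assms(2)] inverse[OF assms(1)] by simp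
  show "differential A \<psi> x (differential A \<phi> (\<psi> x) w) = w"
    using inv.differential_inverse[OF maps[OF assms(1)] assms(2)] inverse[OF assms(1)] by simp
qed

lemma proj_natural:
  assumes x: "x \<in> W" and v: "v \<in> tangent_space A x" and k: "k \<in> I"
  shows "P k (\<psi> x) (differential A \<psi> x v) = differential A \<psi> x (P k x v)"
proof -
  have "differential A \<psi> x v = differential A \<psi> x (\<Sum>i\<in>I. P i x v)"
    by (simp only: proj_sum(1)[OF v])
  also have "\<dots> = (\<Sum>i\<in>I. differential A \<psi> x (P i x v))" by (rule differential_sum)
  finally show ?thesis
    using proj_unique[of "\<lambda>i. differential A \<psi> x (P i x v)" "\<psi> x", OF preserves[OF _ x proj_sum(2)[OF v]] k]
    by simp
qed

text \<open>The projections commute with the differential, which is injective; so a vector whose image has a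
  single component has a single component itself.\<close>

lemma preserves':
  assumes i: "i \<in> I" and x: "x \<in> W" and w: "w \<in> V i (\<psi> x)"
  shows "differential A \<phi> (\<psi> x) w \<in> V i x"
proof -
  interpret inv: manifold_iso A W' W \<phi> \<psi> by (rule iso_inverse)
  let ?v = "differential A \<phi> (\<psi> x) w"
  note T = differential_inverse'[OF x V_tangent[OF i w]]
  have "P k x ?v = (if k = i then P i x ?v else 0)" if k: "k \<in> I" for k
  proof (cases "k = i")
    case False
    have "differential A \<psi> x (P k x ?v) = 0"
      using proj_natural[OF x T(1) k] proj_V[OF i w k] T(2) False by simp
    then have "P k x ?v = differential A \<phi> (\<psi> x) 0"
      using differential_inverse[OF x V_tangent[OF k proj_sum(2)[OF T(1) k]]] by simp
    then show ?thesis using inv.differential_zero[of "\<psi> x"] False by simp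
  qed simp
  then have "(\<Sum>k\<in>I. P k x ?v) = (\<Sum>k\<in>I. if k = i then P i x ?v else 0)" by (rule sum.cong[OF refl])
  also have "\<dots> = P i x ?v" using i finite_index by simp
  finally have "?v = P i x ?v" using proj_sum(1)[OF T(1)] by simp
  then show ?thesis using proj_sum(2)[OF T(1) i] by simp
qed

lemma related_g:
  assumes Y: "Y \<in> vfields A W" "related Y Y'" and Z: "Z \<in> vfields A W" "related Z Z'"
    and x: "x \<in> W"
  shows "g (\<psi> x) (Y' (\<psi> x)) (Z' (\<psi> x)) = g x (Y x) (Z x)"
  using assms isometry vf_tangent by (simp add: related_def)

lemma related_g_derivative:
  assumes Y: "Y \<in> vfields A W" "Y' \<in> vfields A W'" "related Y Y'"
    and Z: "Z \<in> vfields A W" "Z' \<in> vfields A W'" "related Z Z'"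
    and x: "x \<in> W" and v: "v \<in> tangent_space A x"
  shows "differential A \<psi> x v (\<lambda>y. g y (Y' y) (Z' y)) = v (\<lambda>y. g y (Y y) (Z y))"
proof -
  have "smooth_at A (\<psi> x) (\<lambda>y. g y (Y' y) (Z' y))"
    by (rule smooth_atI[OF open_W' maps[OF x] g_smooth[OF open_W' Y(2) Z(2)]])
  then have "differential A \<psi> x v (\<lambda>y. g y (Y' y) (Z' y)) = v (\<lambda>y. g (\<psi> y) (Y' (\<psi> y)) (Z' (\<psi> y)))"
    by (rule differential_apply)
  also have "\<dots> = v (\<lambda>y. g y (Y y) (Z y))"
    by (rule tangent_germ[OF v open_W x]) (rule related_g[OF Y(1,3) Z(1,3)])
  finally show ?thesis .
qed

lemma sharp_natural:
  assumes x: "x \<in> W" and lin: "linear_form x (\<alpha> x)"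
    and eq: "\<And>w. w \<in> tangent_space A x \<Longrightarrow> \<alpha>' (\<psi> x) (differential A \<psi> x w) = \<alpha> x w"
  shows "sharp A g \<alpha>' (\<psi> x) = differential A \<psi> x (sharp A g \<alpha> x)"
proof (rule sharp_unique)
  note s = sharp_char[of x \<alpha>, OF lin]
  show "differential A \<psi> x (sharp A g \<alpha> x) \<in> tangent_space A (\<psi> x)"
    by (rule differential_tangent[OF x s(1)])
  fix w' assume w': "w' \<in> tangent_space A (\<psi> x)"
  note w = differential_inverse'[OF x w']
  show "g (\<psi> x) (differential A \<psi> x (sharp A g \<alpha> x)) w' = \<alpha>' (\<psi> x) w'"
    using isometry[OF x s(1) w(1)] s(2)[OF w(1)] eq[OF w(1)] unfolding w(2) by simp
qed

lemma lie_form_natural: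
  assumes X: "X \<in> vfields A W" "X' \<in> vfields A W'" "related X X'"
    and Y: "Y \<in> vfields A W" "Y' \<in> vfields A W'" "related Y Y'"
    and x: "x \<in> W" and w: "w \<in> tangent_space A x"
  shows "lie_form A X' (flat g Y') (\<psi> x) (differential A \<psi> x w) = lie_form A X (flat g Y) x w"
proof -
  obtain G0 Z where G0: "open G0" "x \<in> G0" "Z \<in> vfields A G0" "Z x = w" using tangent_extend[OF w] .
  define G where "G = W \<inter> G0"
  have G: "open G" "G \<subseteq> W" "x \<in> G" using G0 open_W x by (auto simp: G_def)
  have Z: "Z \<in> vfields A G" by (rule vfields_subset[OF G0(3)]) (simp add: G_def)
  interpret r: witt_iso A D g I star V G "W' \<inter> \<phi> -` G" \<psi> \<phi> by (rule witt_iso_restrict[OF G(1,2)])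
  let ?Z = "push Z"
  note rZ = r.related_push[of Z] and pZ = r.push_vf[OF Z]
  have XG: "X \<in> vfields A G" "X' \<in> vfields A (W' \<inter> \<phi> -` G)" "r.related X X'"
    using vfields_subset[OF X(1) G(2)] vfields_subset[OF X(2), of "W' \<inter> \<phi> -` G"] X(3) G(2)
    by (auto simp: related_def r.related_def)
  have YG: "Y \<in> vfields A G" "Y' \<in> vfields A (W' \<inter> \<phi> -` G)" "r.related Y Y'"
    using vfields_subset[OF Y(1) G(2)] vfields_subset[OF Y(2), of "W' \<inter> \<phi> -` G"] Y(3) G(2)
    by (auto simp: related_def r.related_def)
  have Zx: "?Z (\<psi> x) = differential A \<psi> x w"
    using rZ G(3) G0(4) by (simp add: r.related_def)
  have "lie_form A X' (flat g Y') (\<psi> x) (?Z (\<psi> x)) = lie_flat X' Y' ?Z (\<psi> x)"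
    by (rule lie_form_eq[OF open_W' maps[OF x] X(2) Y(2) pZ r.open_W' r.maps[OF G(3)]])
  also have "\<dots> = lie_flat X Y Z x"
  proof -
    have "X' (\<psi> x) (\<lambda>y. g y (Y' y) (?Z y)) = X x (\<lambda>y. g y (Y y) (Z y))"
      using r.related_g_derivative[OF YG Z pZ rZ G(3) vf_tangent[OF X(1) x]] X(3) x
      by (simp add: related_def)
    moreover have "g (\<psi> x) (Y' (\<psi> x)) (lie_bracket A X' ?Z (\<psi> x)) = g x (Y x) (lie_bracket A X Z x)"
      by (rule r.related_g[OF YG(1,3) vf_lie_bracket[OF G(1) XG(1) Z] r.related_lie_bracket[OF XG Z pZ rZ] G(3)])
    ultimately show ?thesis by (simp add: lie_flat_def)
  qed
  also have "\<dots> = lie_form A X (flat g Y) x (Z x)"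
    by (rule lie_form_eq[OF open_W x X(1) Y(1) Z G(1,3), symmetric])
  finally show ?thesis using Zx G0(4) by simp
qed

lemma linear_form_add: "linear_form x \<alpha> \<Longrightarrow> linear_form x \<beta> \<Longrightarrow> linear_form x (\<lambda>w. \<alpha> w + \<beta> w)"
  unfolding linear_form_def by (simp add: algebra_simps del: plus_fun_apply scaleR_fun_apply)

text \<open>Brackets, musical isomorphisms, Lie derivatives, differentials of functions and the projections
  all commute with isometries that preserve the subbundles.\<close>

lemma witt_T_natural:
  assumes i: "i \<in> I" "j \<in> I" "k \<in> I"
    and X: "X \<in> vfields A W" "X' \<in> vfields A W'" "related X X'"
    and Y: "Y \<in> vfields A W" "Y' \<in> vfields A W'" "related Y Y'"
    and x: "x \<in> W"
  shows "witt_T A g I star V k i X' j Y' (\<psi> x) = differential A \<psi> x (witt_T A g I star V k i X j Y x)"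
proof -
  note lX = lie_form_linear[OF open_W x X(1) Y(1)] and lY = lie_form_linear[OF open_W x Y(1) X(1)]
  note nX = lie_form_natural[OF X Y x] and nY = lie_form_natural[OF Y X x]
  have b: "lie_bracket A X' Y' (\<psi> x) = differential A \<psi> x (lie_bracket A X Y x)"
    using related_lie_bracket[OF X Y] x by (simp add: related_def)
  have bT: "lie_bracket A X Y x \<in> tangent_space A x"
    by (rule vf_tangent[OF vf_lie_bracket[OF open_W X(1) Y(1)] x])
  have l1: "linear_form x ((lie_form A X (flat g Y) + lie_form A Y (flat g X)) x)"
    using linear_form_add[OF lX lY] by (simp add: plus_fun_def)
  have s1: "sharp A g (lie_form A X' (flat g Y') + lie_form A Y' (flat g X')) (\<psi> x)
      = differential A \<psi> x (sharp A g (lie_form A X (flat g Y) + lie_form A Y (flat g X)) x)"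
    by (rule sharp_natural[of x "lie_form A X (flat g Y) + lie_form A Y (flat g X)", OF x l1]) (simp add: nX nY)
  have s2: "sharp A g (lie_form A X' (flat g Y')) (\<psi> x) = differential A \<psi> x (sharp A g (lie_form A X (flat g Y)) x)"
    by (rule sharp_natural[of x "lie_form A X (flat g Y)", OF x lX]) (rule nX)
  have l3: "linear_form x (fun_differential (\<lambda>y. g y (X y) (Y y)) x)"
    by (simp add: linear_form_def fun_differential_def)
  have s3: "sharp A g (fun_differential (\<lambda>y. g y (X' y) (Y' y))) (\<psi> x)
      = differential A \<psi> x (sharp A g (fun_differential (\<lambda>y. g y (X y) (Y y))) x)"
    by (rule sharp_natural[of x "fun_differential (\<lambda>y. g y (X y) (Y y))", OF x l3]) (simp only: fun_differential_def related_g_derivative[OF X Y x])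
  note T1 = sharp_char(1)[of x "lie_form A X (flat g Y) + lie_form A Y (flat g X)", OF l1]
    and T2 = sharp_char(1)[of x "lie_form A X (flat g Y)", OF lX]
    and T3 = sharp_char(1)[of x "fun_differential (\<lambda>y. g y (X y) (Y y))", OF l3]
  show ?thesis
    unfolding witt_T_def s1 s2 s3 b proj_natural[OF x T1 i(3)] proj_natural[OF x T2 i(3)]
      proj_natural[OF x T3 i(3)] proj_natural[OF x bT i(3)]
    by (simp only: if_distrib[of "differential A \<psi> x"] differential_zero differential_scale differential_minus)
qed

lemma push_sections:
  assumes i: "i \<in> I" and X: "X \<in> sections A W (V i)" shows "push X \<in> sections A W' (V i)"
proof -
  have "push X y \<in> V i y" if "y \<in> W'" for y
    using preserves[OF i maps'[OF that], of "X (\<phi> y)"] X maps'[OF that] inverse'[OF that]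
    by (simp add: push_def sections_def)
  then show ?thesis using push_vf X by (simp add: sections_def)
qed

lemma torsion_sections_natural:
  assumes i: "i \<in> I" "j \<in> I" and X: "X \<in> sections A W (V i)" and Y: "Y \<in> sections A W (V j)" and x: "x \<in> W"
  shows "torsion A D (push X) (push Y) (\<psi> x) = differential A \<psi> x (torsion A D X Y x)"
proof -
  have vX: "X \<in> vfields A W" and vY: "Y \<in> vfields A W" using X Y by (auto simp: sections_def)
  note X' = vX push_vf[OF vX] related_push and Y' = vY push_vf[OF vY] related_push
  have b: "lie_bracket A (push X) (push Y) (\<psi> x) = differential A \<psi> x (lie_bracket A X Y x)"
    using related_lie_bracket[OF X' Y'] x by (simp add: related_def)
  have bT: "lie_bracket A X Y x \<in> tangent_space A x"
    by (rule vf_tangent[OF vf_lie_bracket[OF open_W vX vY] x])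
  have s: "(\<Sum>k\<in>I - {i, j}. P k (\<psi> x) (differential A \<psi> x (lie_bracket A X Y x)))
      = differential A \<psi> x (\<Sum>k\<in>I - {i, j}. P k x (lie_bracket A X Y x))"
    unfolding differential_sum by (rule sum.cong[OF refl]) (simp add: proj_natural[OF x bT])
  show ?thesis
    unfolding torsion_formula[OF open_W i X Y x] torsion_formula[OF open_W' i push_sections[OF i(1) X] push_sections[OF i(2) Y] maps[OF x]]
      b s witt_T_natural[OF i i(2) X' Y' x] witt_T_natural[OF i(2,1,1) Y' X' x]
    by (simp only: differential_add differential_minus differential_uminus witt_T_natural[OF i(2,1,1) Y' X' x]
      witt_T_natural[OF i i(1) X' Y' x])
qed

text \<open>The difference between the connection transported back by the isometry and the
  connection itself.\<close>

definition defect :: "'m vfield \<Rightarrow> 'm vfield \<Rightarrow> 'm vfield" where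
  "defect X Y x = differential A \<phi> (\<psi> x) (D (push X) (push Y) (\<psi> x)) - D X Y x"

lemma differential_defect:
  assumes "x \<in> W" "X \<in> vfields A W" "Y \<in> vfields A W"
  shows "differential A \<psi> x (defect X Y x) = D (push X) (push Y) (\<psi> x) - differential A \<psi> x (D X Y x)"
    and "defect X Y x \<in> tangent_space A x"
proof -
  note T = vf_tangent[OF D_vf[OF open_W' push_vf[OF assms(2)] push_vf[OF assms(3)]] maps[OF assms(1)]]
  show "differential A \<psi> x (defect X Y x) = D (push X) (push Y) (\<psi> x) - differential A \<psi> x (D X Y x)"
    unfolding defect_def differential_minus differential_inverse'(2)[OF assms(1) T] ..
  show "defect X Y x \<in> tangent_space A x"
    unfolding defect_def
    by (intro tangent_minus differential_inverse'(1)[OF assms(1) T] vf_tangent[OF D_vf[OF open_W assms(2,3)] assms(1)])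
qed

lemma differential_injective:
  assumes "x \<in> W" "u \<in> tangent_space A x" "v \<in> tangent_space A x" "differential A \<psi> x u = differential A \<psi> x v"
  shows "u = v"
  using differential_inverse[OF assms(1,2)] differential_inverse[OF assms(1,3)] assms(4) by metis

lemma defect_tensorial_left:
  assumes Y: "Y \<in> vfields A W" shows "tensorial A W (\<lambda>X. defect X Y)"
proof (rule tensorialI)
  fix G X X' x assume a: "open G" "G \<subseteq> W" "X \<in> vfields A G" "X' \<in> vfields A G" "x \<in> G"
  interpret r: witt_iso A D g I star V G "W' \<inter> \<phi> -` G" \<psi> \<phi> by (rule witt_iso_restrict[OF a(1,2)])
  interpret inv: manifold_iso A "W' \<inter> \<phi> -` G" G \<phi> \<psi> by (rule r.iso_inverse)
  have Y: "Y \<in> vfields A G" using Y a(2) vfields_subset by blast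
  note p = r.push_vf
  show "defect (X + X') Y x = defect X Y x + defect X' Y x"
    unfolding defect_def push_add D_add_left[OF r.open_W' p[OF a(3)] p[OF a(4)] p[OF Y] r.maps[OF a(5)]]
      D_add_left[OF a(1,3,4) Y a(5)] inv.differential_add by (rule add_diff_add)
next
  fix G X f x assume a: "open G" "G \<subseteq> W" "X \<in> vfields A G" "smooth_fun A G f" "x \<in> G"
  interpret r: witt_iso A D g I star V G "W' \<inter> \<phi> -` G" \<psi> \<phi> by (rule witt_iso_restrict[OF a(1,2)])
  interpret inv: manifold_iso A "W' \<inter> \<phi> -` G" G \<phi> \<psi> by (rule r.iso_inverse)
  have Y: "Y \<in> vfields A G" using Y a(2) vfields_subset by blast
  note p = r.push_vf
  have f': "smooth_fun A (W' \<inter> \<phi> -` G) (\<lambda>y. f (\<phi> y))" by (rule pull_smooth'[OF a(1,4)])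
  have "f (\<phi> (\<psi> x)) = f x" using r.inverse[OF a(5)] by simp
  then show "defect (\<lambda>y. f y *\<^sub>R X y) Y x = f x *\<^sub>R defect X Y x"
    unfolding defect_def push_scale D_scale_left[OF r.open_W' f' p[OF a(3)] p[OF Y] r.maps[OF a(5)]]
      D_scale_left[OF a(1,4,3) Y a(5)] inv.differential_scale by (simp only: scaleR_diff_right)
qed

lemma defect_tensorial_right:
  assumes X: "X \<in> vfields A W" shows "tensorial A W (defect X)"
proof (rule tensorialI)
  fix G Y Y' x assume a: "open G" "G \<subseteq> W" "Y \<in> vfields A G" "Y' \<in> vfields A G" "x \<in> G"
  interpret r: witt_iso A D g I star V G "W' \<inter> \<phi> -` G" \<psi> \<phi> by (rule witt_iso_restrict[OF a(1,2)])
  interpret inv: manifold_iso A "W' \<inter> \<phi> -` G" G \<phi> \<psi> by (rule r.iso_inverse)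
  have X: "X \<in> vfields A G" using X a(2) vfields_subset by blast
  note p = r.push_vf
  show "defect X (Y + Y') x = defect X Y x + defect X Y' x"
    unfolding defect_def push_add D_add_right[OF r.open_W' p[OF X] p[OF a(3)] p[OF a(4)] r.maps[OF a(5)]]
      D_add_right[OF a(1) X a(3,4,5)] inv.differential_add by (rule add_diff_add)
next
  fix G Y f x assume a: "open G" "G \<subseteq> W" "Y \<in> vfields A G" "smooth_fun A G f" "x \<in> G"
  interpret r: witt_iso A D g I star V G "W' \<inter> \<phi> -` G" \<psi> \<phi> by (rule witt_iso_restrict[OF a(1,2)])
  interpret inv: manifold_iso A "W' \<inter> \<phi> -` G" G \<phi> \<psi> by (rule r.iso_inverse)
  have X: "X \<in> vfields A G" using X a(2) vfields_subset by blast
  note p = r.push_vf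
  have f': "smooth_fun A (W' \<inter> \<phi> -` G) (\<lambda>y. f (\<phi> y))" by (rule pull_smooth'[OF a(1,4)])
  have fx: "f (\<phi> (\<psi> x)) = f x" using r.inverse[OF a(5)] by simp
  have "push X (\<psi> x) (\<lambda>y. f (\<phi> y)) = X x (\<lambda>y. f (\<phi> (\<psi> y)))"
    by (rule r.related_apply[OF r.related_push a(5) smooth_atI[OF r.open_W' r.maps[OF a(5)] f']])
  also have "\<dots> = X x f"
    by (rule tangent_germ[OF vf_tangent[OF X a(5)] a(1,5)]) (simp add: r.inverse)
  finally have Xf: "push X (\<psi> x) (\<lambda>y. f (\<phi> y)) = X x f" .
  have Yx: "differential A \<phi> (\<psi> x) (push Y (\<psi> x)) = Y x"
    unfolding push_def r.inverse[OF a(5)] by (rule r.differential_inverse[OF a(5) vf_tangent[OF a(3,5)]])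
  show "defect X (\<lambda>y. f y *\<^sub>R Y y) x = f x *\<^sub>R defect X Y x"
    unfolding defect_def push_scale D_scale_right[OF r.open_W' f' p[OF X] p[OF a(3)] r.maps[OF a(5)]]
      D_scale_right[OF a(1,4) X a(3,5)] inv.differential_add inv.differential_scale Yx Xf fx
    by (simp only: scaleR_diff_right add_diff_cancel_right)
qed

lemma defect_V:
  assumes "j \<in> I" "X \<in> vfields A W" "Y \<in> sections A W (V j)" "x \<in> W"
  shows "defect X Y x \<in> V j x"
  unfolding defect_def
  by (intro subspace_diff[OF V_subspace[OF assms(1)]] preserves'[OF assms(1,4)]
      D_preserves[OF assms(1) open_W' push_vf[OF assms(2)] push_sections[OF assms(1,3)] maps[OF assms(4)]]
      D_preserves[OF assms(1) open_W assms(2-4)])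

lemma defect_symmetric:
  assumes i: "i \<in> I" "j \<in> I" and X: "X \<in> sections A W (V i)" and Y: "Y \<in> sections A W (V j)" and x: "x \<in> W"
  shows "defect X Y x = defect Y X x"
proof -
  have vX: "X \<in> vfields A W" and vY: "Y \<in> vfields A W" using X Y by (auto simp: sections_def)
  have b: "lie_bracket A (push X) (push Y) (\<psi> x) = differential A \<psi> x (lie_bracket A X Y x)"
    using related_lie_bracket[OF vX push_vf[OF vX] related_push vY push_vf[OF vY] related_push] x
    by (simp add: related_def)
  have "D (push X) (push Y) (\<psi> x) - D (push Y) (push X) (\<psi> x) - lie_bracket A (push X) (push Y) (\<psi> x)
      = differential A \<psi> x (D X Y x) - differential A \<psi> x (D Y X x) - differential A \<psi> x (lie_bracket A X Y x)"
    using torsion_sections_natural[OF assms] by (simp only: torsion_apply differential_minus)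
  then have "differential A \<psi> x (defect X Y x) = differential A \<psi> x (defect Y X x)"
    unfolding differential_defect(1)[OF x vX vY] differential_defect(1)[OF x vY vX] b
    by (rule diff_swap)
  then show ?thesis
    by (rule differential_injective[OF x differential_defect(2)[OF x vX vY] differential_defect(2)[OF x vY vX]])
qed

lemma defect_skew:
  assumes X: "X \<in> vfields A W" and Y: "Y \<in> vfields A W" and Z: "Z \<in> vfields A W" and x: "x \<in> W"
  shows "g x (defect X Y x) (Z x) = - g x (Y x) (defect X Z x)"
proof -
  note T = vf_tangent[OF _ x] and T' = vf_tangent[OF _ maps[OF x]]
  have rel: "push Q (\<psi> x) = differential A \<psi> x (Q x)" for Q
    using related_push x by (simp add: related_def)
  let ?E = "\<lambda>Q. differential A \<phi> (\<psi> x) (D (push X) (push Q) (\<psi> x))"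
  have E: "?E Q \<in> tangent_space A x" "differential A \<psi> x (?E Q) = D (push X) (push Q) (\<psi> x)"
    if "Q \<in> vfields A W" for Q
    using differential_inverse'[OF x T'[OF D_vf[OF open_W' push_vf[OF X] push_vf[OF that]]]] by auto
  have dT: "D X Q x \<in> tangent_space A x" if "Q \<in> vfields A W" for Q
    by (rule T[OF D_vf[OF open_W X that]])
  have "g x (?E Y) (Z x) + g x (Y x) (?E Z) = push X (\<psi> x) (\<lambda>y. g y (push Y y) (push Z y))"
    using isometry[OF x E(1)[OF Y] T[OF Z]] isometry[OF x T[OF Y] E(1)[OF Z]]
      D_metric[OF open_W' push_vf[OF X] push_vf[OF Y] push_vf[OF Z] maps[OF x]]
    by (simp only: E(2)[OF Y] E(2)[OF Z] rel)
  also have "\<dots> = X x (\<lambda>y. g y (Y y) (Z y))"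
    unfolding rel[of X] by (rule related_g_derivative[OF Y push_vf[OF Y] related_push Z push_vf[OF Z] related_push x T[OF X]])
  also have "\<dots> = g x (D X Y x) (Z x) + g x (Y x) (D X Z x)"
    by (rule D_metric[OF open_W X Y Z x])
  finally show ?thesis
    unfolding defect_def g_diff_left[OF E(1)[OF Y] dT[OF Y] T[OF Z]] g_diff_right[OF E(1)[OF Z] dT[OF Z] T[OF Y]]
    by simp
qed

text \<open>The defect is symmetric on sections of the subbundles, skew with respect to the metric, and
  preserves each subbundle. For sections of two different subbundles it lies in both, so it vanishes.
  Within an isotropic subbundle it is orthogonal to the dual one by the previous case; within an
  anisotropic subbundle a trilinear form that is symmetric in one pair of arguments and skew in
  another one vanishes.\<close>

lemma defect_sections:
  assumes i: "i \<in> I" "j \<in> I" and X: "X \<in> sections A W (V i)" and Y: "Y \<in> sections A W (V j)" and x: "x \<in> W"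
  shows "defect X Y x = 0"
proof -
  have vX: "X \<in> vfields A W" and vY: "Y \<in> vfields A W" using X Y by (auto simp: sections_def)
  show ?thesis
  proof (cases "i = j")
    case False
    have "defect X Y x \<in> V j x" by (rule defect_V[OF i(2) vX Y x])
    moreover have "defect X Y x \<in> V i x"
      unfolding defect_symmetric[OF i X Y x] by (rule defect_V[OF i(1) vY X x])
    ultimately show ?thesis using V_independent[OF i(1,2) False] by blast
  next
    case True
    note Y = Y[folded True]
    have dV: "defect X Y x \<in> V i x" by (rule defect_V[OF i(1) vX Y x])
    show ?thesis
    proof (cases "star i = i")
      case False
      show ?thesis
      proof (rule pairing[OF i(1) False dV])
        fix w assume "w \<in> V (star i) x"
        from V_section[OF star_index[OF i(1)] this open_W x]
        obtain G Z where G: "open G" "x \<in> G" "G \<subseteq> W" "Z \<in> sections A G (V (star i))" "Z x = w" .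
        interpret r: witt_iso A D g I star V G "W' \<inter> \<phi> -` G" \<psi> \<phi> by (rule witt_iso_restrict[OF G(1,3)])
        have XG: "X \<in> sections A G (V i)" "X \<in> vfields A G" and YG: "Y \<in> vfields A G"
          and Z: "Z \<in> vfields A G"
          using X vX vY G vfields_subset[OF _ G(3)] by (auto simp: sections_def)
        have zV: "defect X Z x \<in> V (star i) x" by (rule r.defect_V[OF star_index[OF i(1)] XG(2) G(4,2)])
        have "defect X Z x \<in> V i x"
          unfolding r.defect_symmetric[OF i(1) star_index[OF i(1)] XG(1) G(4,2)]
          by (rule r.defect_V[OF i(1) Z XG(1) G(2)])
        with zV have "defect X Z x = 0" by (intro V_independent[OF star_index[OF i(1)] i(1) False])
        then have "g x (defect X Y x) (Z x) = - g x (Y x) 0"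
          using r.defect_skew[OF XG(2) YG Z G(2)] by simp
        also have "g x (Y x) 0 = 0"
          using g_scale_right[OF vf_tangent[OF vY x] vf_tangent[OF vY x], of 0] by (simp only: scaleR_zero_left mult_zero_left)
        finally show "g x (defect X Y x) w = 0" using G(5) by simp
      qed
    next
      case True
      from V_section[OF i(1) dV open_W x]
      obtain G Z where G: "open G" "x \<in> G" "G \<subseteq> W" "Z \<in> sections A G (V i)" "Z x = defect X Y x" .
      interpret r: witt_iso A D g I star V G "W' \<inter> \<phi> -` G" \<psi> \<phi> by (rule witt_iso_restrict[OF G(1,3)])
      have XG: "X \<in> sections A G (V i)" "X \<in> vfields A G" and YG: "Y \<in> sections A G (V i)" "Y \<in> vfields A G"
        and Z: "Z \<in> vfields A G"
        using X Y vX vY G vfields_subset[OF _ G(3)] by (auto simp: sections_def)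
      note sym = r.defect_symmetric[OF i(1) i(1) _ _ G(2)] and skew = r.defect_skew[OF _ _ _ G(2)]
      have T: "defect P Q x \<in> tangent_space A x" "Q x \<in> tangent_space A x" if "P \<in> vfields A G" "Q \<in> vfields A G" for P Q
        using r.differential_defect(2)[OF G(2) that] vf_tangent[OF that(2) G(2)] by auto
      have "g x (defect X Y x) (Z x) = - g x (Y x) (defect X Z x)" by (rule skew[OF XG(2) YG(2) Z])
      also have "\<dots> = - g x (defect Z X x) (Y x)"
        unfolding sym[OF XG(1) G(4)] using g_sym[OF T(2)[OF Z YG(2)] T(1)[OF Z XG(2)]] by simp
      also have "\<dots> = g x (X x) (defect Z Y x)" using skew[OF Z XG(2) YG(2)] by simp
      also have "\<dots> = g x (defect Y Z x) (X x)"
        unfolding sym[OF G(4) YG(1)] by (rule g_sym[OF T(2)[OF Z XG(2)] T(1)[OF YG(2) Z]])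
      also have "\<dots> = - g x (Z x) (defect Y X x)" by (rule skew[OF YG(2) Z XG(2)])
      also have "\<dots> = - g x (defect X Y x) (Z x)"
        unfolding sym[OF YG(1) XG(1)] using g_sym[OF T(2)[OF YG(2) Z] T(1)[OF XG(2) YG(2)]] by simp
      finally have "g x (defect X Y x) (defect X Y x) = 0" using G(5) by simp
      then show ?thesis by (rule anisotropic[OF i(1) True dV])
    qed
  qed
qed

text \<open>The defect is function-linear in both arguments, so it only depends on the values of the fields at
  the point, and these decompose into components that extend to local sections.\<close>

lemma defect_zero:
  assumes X: "X \<in> vfields A W" and Y: "Y \<in> vfields A W" and x: "x \<in> W"
  shows "defect X Y x = 0"
proof (rule tensorial_sections_zero[OF defect_tensorial_left[OF Y] open_W x _ X open_W x])
  fix i G Z assume i: "i \<in> I" and G: "open G" "G \<subseteq> W" "x \<in> G" and Z: "Z \<in> sections A G (V i)"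
  interpret r: witt_iso A D g I star V G "W' \<inter> \<phi> -` G" \<psi> \<phi> by (rule witt_iso_restrict[OF G(1,2)])
  have ZG: "Z \<in> vfields A G" and YG: "Y \<in> vfields A G"
    using Z vfields_subset[OF Y G(2)] by (auto simp: sections_def)
  show "defect Z Y x = 0"
  proof (rule tensorial_sections_zero[OF r.defect_tensorial_right[OF ZG] G(1,3) _ YG G(1,3)])
    fix j H Q assume j: "j \<in> I" and H: "open H" "H \<subseteq> G" "x \<in> H" and Q: "Q \<in> sections A H (V j)"
    interpret s: witt_iso A D g I star V H "W' \<inter> \<phi> -` H" \<psi> \<phi>
      by (rule witt_iso_restrict) (use H G in auto)
    have "Z \<in> sections A H (V i)" using Z vfields_subset[OF ZG H(2)] H(2) by (auto simp: sections_def)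
    then show "defect Z Q x = 0" by (rule s.defect_sections[OF i j _ Q H(3)])
  qed
qed

lemma related_D:
  assumes X: "X \<in> vfields A W" "X' \<in> vfields A W'" "related X X'"
    and Y: "Y \<in> vfields A W" "Y' \<in> vfields A W'" "related Y Y'"
  shows "related (D X Y) (D X' Y')"
  unfolding related_def
proof
  fix x assume x: "x \<in> W"
  have eq: "Q' y = push Q y" if "related Q Q'" "y \<in> W'" for Q Q' y
    using that maps'[OF that(2)] inverse'[OF that(2)] unfolding related_def push_def by metis
  note pX = push_vf[OF X(1)] and pY = push_vf[OF Y(1)]
  have "D X' Y' (\<psi> x) = D X' (push Y) (\<psi> x)"
    by (rule D_local_right[OF open_W' X(2) Y(2) pY maps[OF x] eq[OF Y(3)]])
  also have "\<dots> = D (push X) (push Y) (\<psi> x)"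
    by (rule tensorial_pointwise[OF D_tensorial[OF pY] open_W' maps[OF x] X(2) open_W' maps[OF x] pX
          open_W' maps[OF x] eq[OF X(3) maps[OF x]]])
  also have "\<dots> = differential A \<psi> x (D X Y x)"
    using differential_defect(1)[OF x X(1) Y(1), symmetric] defect_zero[OF X(1) Y(1) x]
    by (simp only: differential_zero right_minus_eq)
  finally show "D X' Y' (\<psi> x) = differential A \<psi> x (D X Y x)" .
qed

lemma related_torsion:
  assumes X: "X \<in> vfields A W" "X' \<in> vfields A W'" "related X X'"
    and Y: "Y \<in> vfields A W" "Y' \<in> vfields A W'" "related Y Y'"
  shows "related (torsion A D X Y) (torsion A D X' Y')"
  unfolding torsion_def
  by (intro related_diff related_D[OF X Y] related_D[OF Y X] related_lie_bracket[OF X Y])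

lemma related_curvature:
  assumes X: "X \<in> vfields A W" "X' \<in> vfields A W'" "related X X'"
    and Y: "Y \<in> vfields A W" "Y' \<in> vfields A W'" "related Y Y'"
    and Z: "Z \<in> vfields A W" "Z' \<in> vfields A W'" "related Z Z'"
  shows "related (curvature A D X Y Z) (curvature A D X' Y' Z')"
  unfolding curvature_def
  by (intro related_diff related_D X Y Z related_lie_bracket D_vf open_W open_W' vf_lie_bracket)

lemma related_cov_torsion:
  assumes X: "X \<in> vfields A W" "X' \<in> vfields A W'" "related X X'"
    and Y: "Y \<in> vfields A W" "Y' \<in> vfields A W'" "related Y Y'"
    and Z: "Z \<in> vfields A W" "Z' \<in> vfields A W'" "related Z Z'"
  shows "related (cov_torsion A D X Y Z) (cov_torsion A D X' Y' Z')"
  unfolding cov_torsion_def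
  by (intro related_diff related_D X Y Z related_torsion D_vf open_W open_W' torsion_vf)

lemma related_cov_curvature:
  assumes X: "X \<in> vfields A W" "X' \<in> vfields A W'" "related X X'"
    and Y: "Y \<in> vfields A W" "Y' \<in> vfields A W'" "related Y Y'"
    and Z: "Z \<in> vfields A W" "Z' \<in> vfields A W'" "related Z Z'"
    and Q: "Q \<in> vfields A W" "Q' \<in> vfields A W'" "related Q Q'"
  shows "related (cov_curvature A D X Y Z Q) (cov_curvature A D X' Y' Z' Q')"
  unfolding cov_curvature_def
  by (intro related_diff related_D X Y Z Q related_curvature D_vf open_W open_W' curvature_vf)

end

section \<open>Uniqueness for ordinary differential equations\<close>

lemma smooth_on_locally_Lipschitz:
  fixes G :: "'a::euclidean_space \<Rightarrow> 'b::euclidean_space"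
  assumes S: "open S" "p \<in> S" and G: "smooth_on S G"
  obtains r B where "r > 0" "cball p r \<subseteq> S" "B \<ge> 0"
    "\<And>x y. x \<in> cball p r \<Longrightarrow> y \<in> cball p r \<Longrightarrow> norm (G x - G y) \<le> B * norm (x - y)"
proof -
  obtain r where r: "r > 0" "cball p r \<subseteq> S" using S open_contains_cball by blast
  let ?G' = "\<lambda>x. frechet_derivative G (at x)"
  have "\<exists>K. \<forall>x\<in>cball p r. norm (?G' x b) \<le> K" for b
  proof -
    have "continuous_on (cball p r) (\<lambda>x. ?G' x b)"
      using smooth_on_continuous[OF smooth_on_frechet[OF G]] r(2) continuous_on_subset by blast
    then have "bounded ((\<lambda>x. ?G' x b) ` cball p r)"
      using compact_continuous_image compact_imp_bounded compact_cball by blast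
    then show ?thesis by (auto simp: bounded_iff)
  qed
  then obtain K where K: "\<And>b x. x \<in> cball p r \<Longrightarrow> norm (?G' x b) \<le> K b" by metis
  define B where "B = (\<Sum>b\<in>Basis. K b)"
  have Kpos: "K b \<ge> 0" for b by (rule order_trans[OF norm_ge_zero K[of p b]]) (use r(1) in simp)
  have D: "(G has_derivative ?G' x) (at x)" if "x \<in> cball p r" for x
    using smooth_on_differentiable[OF G] that r(2) by (auto simp: frechet_derivative_works)
  have "onorm (?G' x) \<le> B" if x: "x \<in> cball p r" for x
  proof (rule onorm_bound)
    show "0 \<le> B" unfolding B_def by (intro sum_nonneg Kpos)
    fix v
    have lin: "linear (?G' x)" using D[OF x] has_derivative_linear by blast
    have "?G' x v = ?G' x (\<Sum>b\<in>Basis. (v \<bullet> b) *\<^sub>R b)" by (simp only: euclidean_representation)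
    also have "\<dots> = (\<Sum>b\<in>Basis. (v \<bullet> b) *\<^sub>R ?G' x b)"
      by (simp only: linear_sum[OF lin] linear_scale[OF lin])
    finally have "norm (?G' x v) \<le> (\<Sum>b\<in>Basis. norm ((v \<bullet> b) *\<^sub>R ?G' x b))" by (simp only: norm_sum)
    also have "\<dots> \<le> (\<Sum>b\<in>Basis. K b * norm v)"
    proof (rule sum_mono)
      fix b :: 'a assume "b \<in> Basis"
      then have "\<bar>v \<bullet> b\<bar> * norm (?G' x b) \<le> norm v * K b"
        by (intro mult_mono Basis_le_norm K[OF x]) auto
      then show "norm ((v \<bullet> b) *\<^sub>R ?G' x b) \<le> K b * norm v" by (simp add: mult.commute)
    qed
    also have "\<dots> = B * norm v" by (simp add: B_def sum_distrib_right)
    finally show "norm (?G' x v) \<le> B * norm v" .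
  qed
  then have "norm (G x - G y) \<le> B * norm (x - y)" if "x \<in> cball p r" "y \<in> cball p r" for x y
    using differentiable_bound[OF convex_cball, of p r G ?G' B] D that by (blast intro: has_derivative_at_withinI)
  moreover have "B \<ge> 0" unfolding B_def by (intro sum_nonneg Kpos)
  ultimately show thesis using that r by blast
qed

text \<open>On a short time interval the mean value inequality bounds the maximal distance of two solutions
  by half of itself.\<close>

lemma ode_unique_locally:
  fixes G :: "'a::euclidean_space \<Rightarrow> 'a" and y z :: "real \<Rightarrow> 'a"
  assumes S: "open S" "smooth_on S G" and T: "open T" "t0 \<in> T"
    and y: "\<And>t. t \<in> T \<Longrightarrow> y t \<in> S \<and> (y has_vector_derivative G (y t)) (at t)"
    and z: "\<And>t. t \<in> T \<Longrightarrow> z t \<in> S \<and> (z has_vector_derivative G (z t)) (at t)"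
    and eq: "y t0 = z t0"
  obtains d where "d > 0" "\<And>t. \<bar>t - t0\<bar> \<le> d \<Longrightarrow> y t = z t"
proof -
  obtain r B where r: "r > 0" and B: "B \<ge> 0"
    and lip: "\<And>p q. p \<in> cball (y t0) r \<Longrightarrow> q \<in> cball (y t0) r \<Longrightarrow> norm (G p - G q) \<le> B * norm (p - q)"
    using smooth_on_locally_Lipschitz[OF S(1) _ S(2), of "y t0"] y[OF T(2)] by metis
  have cont: "isCont y t" "isCont z t" if "t \<in> T" for t
    using y[OF that] z[OF that] has_vector_derivative_continuous by blast+
  obtain d1 where d1: "d1 > 0" "\<And>t. dist t t0 < d1 \<Longrightarrow> dist (y t) (y t0) < r"
    using cont(1)[OF T(2)] r unfolding continuous_at_eps_delta by blast
  obtain d2 where d2: "d2 > 0" "\<And>t. dist t t0 < d2 \<Longrightarrow> dist (z t) (z t0) < r"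
    using cont(2)[OF T(2)] r unfolding continuous_at_eps_delta by blast
  obtain d3 where d3: "d3 > 0" "cball t0 d3 \<subseteq> T" using T open_contains_cball by blast
  (* the last bound on d gives d * B <= 1 / 2, the contraction factor *)
  define d where "d = min (min (d1 / 2) (d2 / 2)) (min d3 (1 / (2 * (B + 1))))"
  have d: "d > 0" "d < d1" "d < d2" "d \<le> d3" "d \<le> 1 / (2 * (B + 1))"
    using d1(1) d2(1) d3(1) B by (auto simp: d_def min_def)
  have dB: "d * B \<le> 1 / 2"
  proof -
    have "d * B \<le> 1 / (2 * (B + 1)) * B" using d(5) B by (rule mult_right_mono)
    also have "\<dots> \<le> 1 / 2" using B by (simp add: field_simps)
    finally show ?thesis .
  qed
  let ?C = "cball t0 d"
  have in_T: "t \<in> T" if "t \<in> ?C" for t using that d(4) d3(2) by auto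
  have near: "y t \<in> cball (y t0) r" "z t \<in> cball (y t0) r" if "t \<in> ?C" for t
    using that d d1(2)[of t] d2(2)[of t] eq by (auto simp: dist_commute)
  define w where "w = (\<lambda>t. y t - z t)"
  have wcont: "continuous_on ?C (\<lambda>t. norm (w t))"
    unfolding w_def by (intro continuous_intros continuous_at_imp_continuous_on ballI cont in_T)
  obtain s where s: "s \<in> ?C" "\<And>t. t \<in> ?C \<Longrightarrow> norm (w t) \<le> norm (w s)"
    using continuous_attains_sup[OF compact_cball _ wcont] d(1) by auto
  define M where "M = norm (w s)"
  have D: "(w has_derivative (\<lambda>h. h *\<^sub>R (G (y t) - G (z t)))) (at t within ?C)" if "t \<in> ?C" for t
    using has_vector_derivative_diff[of y "G (y t)" "at t within ?C" z "G (z t)"] y[OF in_T[OF that]] z[OF in_T[OF that]]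
      has_vector_derivative_at_within unfolding w_def has_vector_derivative_def[of "\<lambda>t. y t - z t"] by blast
  have "onorm (\<lambda>h. h *\<^sub>R (G (y t) - G (z t))) \<le> B * M" if "t \<in> ?C" for t
  proof (rule onorm_bound)
    show "0 \<le> B * M" using B by (simp add: M_def)
    fix h :: real
    have "norm (G (y t) - G (z t)) \<le> B * norm (w t)" unfolding w_def by (rule lip[OF near[OF that]])
    also have "\<dots> \<le> B * M" unfolding M_def by (rule mult_left_mono[OF s(2)[OF that] B])
    finally show "norm (h *\<^sub>R (G (y t) - G (z t))) \<le> B * M * norm h"
      using mult_left_mono[of "norm (G (y t) - G (z t))" "B * M" "\<bar>h\<bar>"] by (simp add: mult.commute)
  qed
  from differentiable_bound[OF convex_cball D this s(1), of t0]
  have "norm (w s - w t0) \<le> B * M * norm (s - t0)" using d(1) by simp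
  moreover have "w t0 = 0" using eq by (simp add: w_def)
  moreover have "norm (s - t0) \<le> d" using s(1) by (simp add: dist_norm norm_minus_commute)
  then have "B * M * norm (s - t0) \<le> B * M * d" using B by (intro mult_left_mono) (auto simp: M_def)
  ultimately have "M \<le> (d * B) * M" by (simp add: M_def ac_simps)
  also have "\<dots> \<le> (1 / 2) * M" by (rule mult_right_mono[OF dB]) (simp add: M_def)
  finally have "M = 0" using norm_ge_zero[of "w s"] unfolding M_def by linarith
  then have "y t = z t" if "\<bar>t - t0\<bar> \<le> d" for t
    using s(2)[of t] that by (simp add: M_def w_def dist_real_def abs_minus_commute)
  then show thesis using that d(1) by blast
qed

section \<open>Curves in a chart\<close>

lemma smooth_on_vector_derivative:
  fixes u :: "real \<Rightarrow> 'a::euclidean_space"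
  assumes "smooth_on J u" "t \<in> J"
  shows "(u has_vector_derivative frechet_derivative u (at t) 1) (at t)"
proof -
  have D: "(u has_derivative frechet_derivative u (at t)) (at t)"
    using smooth_on_differentiable[OF assms] by (simp add: frechet_derivative_works)
  have "frechet_derivative u (at t) h = h *\<^sub>R frechet_derivative u (at t) 1" for h
    using linear_scale[OF has_derivative_linear[OF D], of h 1] by simp
  then have "frechet_derivative u (at t) = (\<lambda>h. h *\<^sub>R frechet_derivative u (at t) 1)" ..
  then show ?thesis using D unfolding has_vector_derivative_def by simp
qed

context smooth_manifold
begin

definition chart_velocity :: "('m, 'e) chart \<Rightarrow> (real \<Rightarrow> 'm) \<Rightarrow> real \<Rightarrow> 'e" where
  "chart_velocity c \<gamma> t = frechet_derivative (\<lambda>s. snd c (\<gamma> s)) (at t) 1"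

definition chart_acceleration :: "('m, 'e) chart \<Rightarrow> (real \<Rightarrow> 'm) \<Rightarrow> real \<Rightarrow> 'e" where
  "chart_acceleration c \<gamma> t = frechet_derivative (chart_velocity c \<gamma>) (at t) 1"

lemma curve_chart:
  assumes J: "open J" and \<gamma>: "smooth_map std_atlas A J \<gamma>" and c: "c \<in> A"
  shows "open (J \<inter> \<gamma> -` fst c)" "smooth_on (J \<inter> \<gamma> -` fst c) (\<lambda>t. snd c (\<gamma> t))"
    "smooth_on (J \<inter> \<gamma> -` fst c) (chart_velocity c \<gamma>)"
    "t \<in> J \<inter> \<gamma> -` fst c \<Longrightarrow> ((\<lambda>t. snd c (\<gamma> t)) has_vector_derivative chart_velocity c \<gamma> t) (at t)"
    "t \<in> J \<inter> \<gamma> -` fst c \<Longrightarrow> (chart_velocity c \<gamma> has_vector_derivative chart_acceleration c \<gamma> t) (at t)"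
proof -
  show "open (J \<inter> \<gamma> -` fst c)"
    by (rule smooth_on_pullback(1)[OF J \<gamma> chart_dom_open[OF c] smooth_fun_const])
  show s: "smooth_on (J \<inter> \<gamma> -` fst c) (\<lambda>t. snd c (\<gamma> t))"
    using \<gamma> c by (simp add: smooth_map_def std_atlas_def comp_def)
  show s': "smooth_on (J \<inter> \<gamma> -` fst c) (chart_velocity c \<gamma>)"
    using smooth_on_frechet[OF s] unfolding chart_velocity_def .
  show "t \<in> J \<inter> \<gamma> -` fst c \<Longrightarrow> ((\<lambda>t. snd c (\<gamma> t)) has_vector_derivative chart_velocity c \<gamma> t) (at t)"
    unfolding chart_velocity_def by (rule smooth_on_vector_derivative[OF s])
  show "t \<in> J \<inter> \<gamma> -` fst c \<Longrightarrow> (chart_velocity c \<gamma> has_vector_derivative chart_acceleration c \<gamma> t) (at t)"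
    unfolding chart_acceleration_def by (rule smooth_on_vector_derivative[OF s'])
qed

lemma curve_fun_derivative:
  assumes J: "open J" and \<gamma>: "smooth_map std_atlas A J \<gamma>" and c: "c \<in> A" and t: "t \<in> J" "\<gamma> t \<in> fst c"
    and f: "smooth_at A (\<gamma> t) f"
  shows "((\<lambda>s. f (\<gamma> s)) has_real_derivative coord_field A c (chart_velocity c \<gamma> t) (\<gamma> t) f) (at t)"
proof -
  have tJ: "t \<in> J \<inter> \<gamma> -` fst c" using t by simp
  let ?F = "f \<circ> chart_inv c" and ?u = "\<lambda>s. snd c (\<gamma> s)"
  have "(?F has_derivative frechet_derivative ?F (at (?u t))) (at (?u t))"
    using smooth_at_chart_differentiable[OF c t(2) f] by (simp add: frechet_derivative_works)
  then have "((\<lambda>s. ?F (?u s)) has_derivative (\<lambda>h. frechet_derivative ?F (at (?u t)) (h *\<^sub>R chart_velocity c \<gamma> t))) (at t)"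
    using curve_chart(4)[OF J \<gamma> c tJ] unfolding has_vector_derivative_def by (intro has_derivative_compose[of ?u _ t UNIV ?F])
  moreover have "linear (frechet_derivative ?F (at (?u t)))"
    using smooth_at_chart_differentiable[OF c t(2) f] by (rule linear_frechet_derivative)
  ultimately have "((\<lambda>s. ?F (?u s)) has_derivative (\<lambda>h. h * frechet_derivative ?F (at (?u t)) (chart_velocity c \<gamma> t))) (at t)"
    by (simp add: linear_scale)
  then have "((\<lambda>s. ?F (?u s)) has_real_derivative coord_field A c (chart_velocity c \<gamma> t) (\<gamma> t) f) (at t)"
    by (rule has_derivative_imp_has_field_derivative) (simp add: coord_field_apply[OF f])
  then show ?thesis
    by (rule has_field_derivative_transform_within_open[OF _ curve_chart(1)[OF J \<gamma> c] tJ]) (use c in simp)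
qed

lemma velocity_chart:
  assumes J: "open J" and \<gamma>: "smooth_map std_atlas A J \<gamma>" and c: "c \<in> A" and t: "t \<in> J" "\<gamma> t \<in> fst c"
  shows "velocity A \<gamma> t = coord_field A c (chart_velocity c \<gamma> t) (\<gamma> t)"
proof
  fix f
  show "velocity A \<gamma> t f = coord_field A c (chart_velocity c \<gamma> t) (\<gamma> t) f"
    using DERIV_imp_deriv[OF curve_fun_derivative[OF assms]]
    by (cases "smooth_at A (\<gamma> t) f") (simp_all add: velocity_def coord_field_def comp_def)
qed

lemma coord_comp_velocity:
  assumes J: "open J" and \<gamma>: "smooth_map std_atlas A J \<gamma>" and c: "c \<in> A" and t: "t \<in> J" "\<gamma> t \<in> fst c"
  shows "coord_comp c b (velocity A \<gamma> t) = chart_velocity c \<gamma> t \<bullet> b"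
  unfolding coord_comp_def velocity_chart[OF assms] by (rule coord_field_coord[OF c t(2)])

end

section \<open>Geodesics and the exponential map\<close>

context connection_manifold
begin

lemma cov_deriv_chart:
  assumes J: "open J" and \<gamma>: "smooth_map std_atlas A J \<gamma>" and c: "c \<in> A" and t: "t \<in> J" "\<gamma> t \<in> fst c"
  shows "cov_deriv_along A D c \<gamma> (velocity A \<gamma>) t = (\<Sum>b\<in>Basis. (chart_acceleration c \<gamma> t \<bullet> b) *\<^sub>R coord_field A c b (\<gamma> t) +
        (chart_velocity c \<gamma> t \<bullet> b) *\<^sub>R (\<Sum>a\<in>Basis. (chart_velocity c \<gamma> t \<bullet> a) *\<^sub>R D (coord_field A c a) (coord_field A c b) (\<gamma> t)))"
proof -
  have tJ: "t \<in> J \<inter> \<gamma> -` fst c" using t by simp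
  note K = curve_chart(1)[OF J \<gamma> c]
  have "deriv (\<lambda>s. coord_comp c b (velocity A \<gamma> s)) t = chart_acceleration c \<gamma> t \<bullet> b" for b
  proof -
    have "((\<lambda>s. chart_velocity c \<gamma> s \<bullet> b) has_vector_derivative chart_acceleration c \<gamma> t \<bullet> b) (at t)"
      using bounded_linear.has_vector_derivative[OF bounded_linear_inner_left curve_chart(5)[OF J \<gamma> c tJ]] .
    then have "((\<lambda>s. chart_velocity c \<gamma> s \<bullet> b) has_real_derivative chart_acceleration c \<gamma> t \<bullet> b) (at t)"
      by (simp add: has_real_derivative_iff_has_vector_derivative)
    then have "((\<lambda>s. coord_comp c b (velocity A \<gamma> s)) has_real_derivative chart_acceleration c \<gamma> t \<bullet> b) (at t)"
      by (rule has_field_derivative_transform_within_open[OF _ K tJ])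
        (simp add: coord_comp_velocity[OF J \<gamma> c])
    then show ?thesis by (rule DERIV_imp_deriv)
  qed
  then show ?thesis
    unfolding cov_deriv_along_def by (simp only: coord_comp_velocity[OF J \<gamma> c t])
qed

definition christoffel :: "('m, 'e) chart \<Rightarrow> 'e \<Rightarrow> 'e \<Rightarrow> 'e \<Rightarrow> 'e \<Rightarrow> real" where
  "christoffel c a b k z = D (coord_field A c a) (coord_field A c b) (chart_inv c z) (\<lambda>y. snd c y \<bullet> k)"

lemma christoffel_smooth:
  assumes c: "c \<in> A" shows "smooth_on (snd c ` fst c) (christoffel c a b k)"
proof -
  note o = chart_dom_open[OF c] and v = coord_field_vfields[OF c]
  have "smooth_fun A (fst c) (\<lambda>y. D (coord_field A c a) (coord_field A c b) y (\<lambda>y. snd c y \<bullet> k))"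
    by (rule vf_smooth[OF D_vf[OF o v v] o order_refl smooth_fun_coord[OF c]])
  from smooth_fun_chart[OF this c] show ?thesis unfolding christoffel_def by simp
qed

text \<open>The geodesic equation in a chart as a first-order system for position and velocity.\<close>

definition geodesic_field :: "('m, 'e) chart \<Rightarrow> 'e \<times> 'e \<Rightarrow> 'e \<times> 'e" where
  "geodesic_field c p = (snd p, - (\<Sum>k\<in>Basis. (\<Sum>b\<in>Basis. \<Sum>a\<in>Basis.
      (snd p \<bullet> b) * ((snd p \<bullet> a) * christoffel c a b k (fst p))) *\<^sub>R k))"

lemma geodesic_field_smooth:
  assumes c: "c \<in> A" shows "smooth_on ((snd c ` fst c) \<times> UNIV) (geodesic_field c)"
proof -
  let ?S = "(snd c ` fst c) \<times> (UNIV :: 'e set)"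
  have oc: "open (snd c ` fst c)" using chart_image_open[OF c chart_dom_open[OF c]] by simp
  have S: "open ?S" by (intro open_Times oc open_UNIV)
  have f: "smooth_on ?S fst" and s: "smooth_on ?S snd"
    by (intro smooth_on_linear bounded_linear_fst bounded_linear_snd)+
  have ch: "smooth_on ?S (\<lambda>p. christoffel c a b k (fst p))" for a b k
    by (rule smooth_on_compose[OF S oc _ f christoffel_smooth[OF c]]) auto
  have q: "smooth_on ?S (\<lambda>p. \<Sum>k\<in>Basis. (\<Sum>b\<in>Basis. \<Sum>a\<in>Basis.
      (snd p \<bullet> b) * ((snd p \<bullet> a) * christoffel c a b k (fst p))) *\<^sub>R k)"
    by (intro smooth_on_sum smooth_on_scaleR smooth_on_mult smooth_on_inner s smooth_on_const ch S)
  have l: "bounded_linear (\<lambda>w::'e. (w, 0::'e))" "bounded_linear (\<lambda>w::'e. (0::'e, - w))"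
    by (intro bounded_linear_Pair bounded_linear_ident bounded_linear_zero bounded_linear_minus)+
  have "smooth_on ?S (\<lambda>p. (snd p, 0) + (0, - (\<Sum>k\<in>Basis. (\<Sum>b\<in>Basis. \<Sum>a\<in>Basis.
      (snd p \<bullet> b) * ((snd p \<bullet> a) * christoffel c a b k (fst p))) *\<^sub>R k)))"
    by (intro smooth_on_add[OF S] smooth_on_compose[OF S open_UNIV _ s smooth_on_linear[OF l(1)]]
        smooth_on_compose[OF S open_UNIV _ q smooth_on_linear[OF l(2)]]) auto
  then show ?thesis unfolding geodesic_field_def by simp
qed

lemma geodesic_ode:
  assumes \<gamma>: "geodesic A D J \<gamma>" and c: "c \<in> A" and t: "t \<in> J \<inter> \<gamma> -` fst c"
  shows "((\<lambda>s. (snd c (\<gamma> s), chart_velocity c \<gamma> s)) has_vector_derivative geodesic_field c (snd c (\<gamma> t), chart_velocity c \<gamma> t)) (at t)"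
proof -
  have J: "open J" and s: "smooth_map std_atlas A J \<gamma>" using \<gamma> by (auto simp: geodesic_def)
  have t': "t \<in> J" "\<gamma> t \<in> fst c" using t by auto
  let ?w = "chart_velocity c \<gamma> t"
  have "cov_deriv_along A D c \<gamma> (velocity A \<gamma>) t = 0" using \<gamma> c t' unfolding geodesic_def by blast
  note eq = this[unfolded cov_deriv_chart[OF J s c t']]
  have comp: "chart_acceleration c \<gamma> t \<bullet> k = - (\<Sum>b\<in>Basis. \<Sum>a\<in>Basis. (?w \<bullet> b) * ((?w \<bullet> a) * christoffel c a b k (snd c (\<gamma> t))))"
    if k: "k \<in> Basis" for k
  proof -
    have "(\<Sum>b\<in>Basis. (chart_acceleration c \<gamma> t \<bullet> b) * (b \<bullet> k)) = chart_acceleration c \<gamma> t \<bullet> k"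
      using k by (simp add: inner_Basis if_distrib cong: if_cong)
    moreover have "0 = (\<Sum>b\<in>Basis. (chart_acceleration c \<gamma> t \<bullet> b) * (b \<bullet> k) +
        (?w \<bullet> b) * (\<Sum>a\<in>Basis. (?w \<bullet> a) * christoffel c a b k (snd c (\<gamma> t))))"
      using fun_cong[OF eq, of "\<lambda>y. snd c y \<bullet> k"] c t'
      by (simp add: sum_fun_apply coord_field_coord[OF c t'(2)] christoffel_def)
    ultimately show ?thesis by (simp add: sum.distrib sum_distrib_left)
  qed
  have "chart_acceleration c \<gamma> t = - (\<Sum>k\<in>Basis. (\<Sum>b\<in>Basis. \<Sum>a\<in>Basis.
      (?w \<bullet> b) * ((?w \<bullet> a) * christoffel c a b k (snd c (\<gamma> t)))) *\<^sub>R k)"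
    by (rule euclidean_eqI) (simp add: comp inner_sum_left inner_Basis if_distrib cong: if_cong)
  then have "geodesic_field c (snd c (\<gamma> t), ?w) = (?w, chart_acceleration c \<gamma> t)" by (simp add: geodesic_field_def)
  then show ?thesis
    using has_vector_derivative_Pair[OF curve_chart(4)[OF J s c t] curve_chart(5)[OF J s c t]] by simp
qed

lemma geodesic_eq_locally:
  assumes \<gamma>: "geodesic A D J \<gamma>" and \<sigma>: "geodesic A D K \<sigma>" and t: "t \<in> J" "t \<in> K"
    and eq: "\<gamma> t = \<sigma> t" "velocity A \<gamma> t = velocity A \<sigma> t"
  shows "\<forall>\<^sub>F s in nhds t. \<gamma> s = \<sigma> s \<and> velocity A \<gamma> s = velocity A \<sigma> s"
proof -
  have J: "open J" "smooth_map std_atlas A J \<gamma>" and K: "open K" "smooth_map std_atlas A K \<sigma>"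
    using \<gamma> \<sigma> by (auto simp: geodesic_def)
  obtain c where c: "c \<in> A" "\<gamma> t \<in> fst c" using chart_cover .
  define T where "T = (J \<inter> \<gamma> -` fst c) \<inter> (K \<inter> \<sigma> -` fst c)"
  have T: "open T" "t \<in> T"
    using curve_chart(1)[OF J c(1)] curve_chart(1)[OF K c(1)] t c eq(1) by (auto simp: T_def)
  have oc: "open ((snd c ` fst c) \<times> (UNIV :: 'e set))"
    using chart_image_open[OF c(1) chart_dom_open[OF c(1)]] by (intro open_Times) auto
  have v: "chart_velocity c \<gamma> s \<bullet> b = coord_comp c b (velocity A \<gamma> s)" "chart_velocity c \<sigma> s \<bullet> b = coord_comp c b (velocity A \<sigma> s)"
    if "s \<in> T" for s b
    using coord_comp_velocity[OF J c(1)] coord_comp_velocity[OF K c(1)] that by (auto simp: T_def)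
  have "chart_velocity c \<gamma> t = chart_velocity c \<sigma> t" by (rule euclidean_eqI) (simp add: v[OF T(2)] eq(2))
  then have eq0: "(snd c (\<gamma> t), chart_velocity c \<gamma> t) = (snd c (\<sigma> t), chart_velocity c \<sigma> t)" using eq(1) by simp
  let ?y = "\<lambda>s. (snd c (\<gamma> s), chart_velocity c \<gamma> s)" and ?z = "\<lambda>s. (snd c (\<sigma> s), chart_velocity c \<sigma> s)"
  have y: "?y s \<in> (snd c ` fst c) \<times> UNIV \<and> (?y has_vector_derivative geodesic_field c (?y s)) (at s)" if "s \<in> T" for s
    using geodesic_ode[OF \<gamma> c(1)] that by (simp add: T_def)
  have z: "?z s \<in> (snd c ` fst c) \<times> UNIV \<and> (?z has_vector_derivative geodesic_field c (?z s)) (at s)" if "s \<in> T" for s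
    using geodesic_ode[OF \<sigma> c(1)] that by (simp add: T_def)
  obtain d where d: "d > 0" "\<And>s. \<bar>s - t\<bar> \<le> d \<Longrightarrow> ?y s = ?z s"
    by (rule ode_unique_locally[where y = ?y and z = ?z, OF oc geodesic_field_smooth[OF c(1)] T y z eq0]; blast)
  have "open (T \<inter> ball t d)" "t \<in> T \<inter> ball t d" using T d(1) by auto
  moreover have "\<gamma> s = \<sigma> s \<and> velocity A \<gamma> s = velocity A \<sigma> s" if s: "s \<in> T \<inter> ball t d" for s
  proof -
    have sT: "s \<in> J" "\<gamma> s \<in> fst c" "s \<in> K" "\<sigma> s \<in> fst c" using s by (auto simp: T_def)
    have e: "snd c (\<gamma> s) = snd c (\<sigma> s)" "chart_velocity c \<gamma> s = chart_velocity c \<sigma> s"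
      using d(2)[of s] s by (auto simp: dist_real_def abs_minus_commute)
    have "\<gamma> s = \<sigma> s" using chart_inv_chart[OF c(1) sT(2)] chart_inv_chart[OF c(1) sT(4)] e(1) by metis
    then show ?thesis
      using velocity_chart[OF J c(1) sT(1,2)] velocity_chart[OF K c(1) sT(3,4)] e(2) by simp
  qed
  ultimately show ?thesis unfolding eventually_nhds by blast
qed

lemma geodesic_neq_locally:
  assumes \<gamma>: "geodesic A D J \<gamma>" and \<sigma>: "geodesic A D K \<sigma>" and t: "t \<in> J" "t \<in> K"
    and neq: "\<not> (\<gamma> t = \<sigma> t \<and> velocity A \<gamma> t = velocity A \<sigma> t)"
  shows "\<forall>\<^sub>F s in nhds t. \<not> (\<gamma> s = \<sigma> s \<and> velocity A \<gamma> s = velocity A \<sigma> s)"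
proof -
  have J: "open J" "smooth_map std_atlas A J \<gamma>" and K: "open K" "smooth_map std_atlas A K \<sigma>"
    using \<gamma> \<sigma> by (auto simp: geodesic_def)
  have pre: "open (J \<inter> \<gamma> -` G)" "open (K \<inter> \<sigma> -` G)" if "open G" for G
    using smooth_on_pullback(1)[OF J that smooth_fun_const] smooth_on_pullback(1)[OF K that smooth_fun_const] .
  show ?thesis
  proof (cases "\<gamma> t = \<sigma> t")
    case False
    obtain G H where GH: "open G" "open H" "\<gamma> t \<in> G" "\<sigma> t \<in> H" "G \<inter> H = {}" using hausdorff[OF False] by metis
    have "open ((J \<inter> \<gamma> -` G) \<inter> (K \<inter> \<sigma> -` H))" "t \<in> (J \<inter> \<gamma> -` G) \<inter> (K \<inter> \<sigma> -` H)"
      using pre GH t by auto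
    moreover have "\<gamma> s \<noteq> \<sigma> s" if "s \<in> (J \<inter> \<gamma> -` G) \<inter> (K \<inter> \<sigma> -` H)" for s
      using that GH(5) by auto
    ultimately show ?thesis unfolding eventually_nhds by blast
  next
    case True
    obtain c where c: "c \<in> A" "\<gamma> t \<in> fst c" using chart_cover .
    define T where "T = (J \<inter> \<gamma> -` fst c) \<inter> (K \<inter> \<sigma> -` fst c)"
    have T: "open T" "t \<in> T"
      using curve_chart(1)[OF J c(1)] curve_chart(1)[OF K c(1)] t c True by (auto simp: T_def)
    have v: "velocity A \<gamma> s = coord_field A c (chart_velocity c \<gamma> s) (\<gamma> s)" "velocity A \<sigma> s = coord_field A c (chart_velocity c \<sigma> s) (\<sigma> s)"
      "chart_velocity c \<gamma> s \<bullet> b = coord_comp c b (velocity A \<gamma> s)" "chart_velocity c \<sigma> s \<bullet> b = coord_comp c b (velocity A \<sigma> s)"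
      if "s \<in> T" for s b
      using velocity_chart[OF J c(1)] velocity_chart[OF K c(1)]
        coord_comp_velocity[OF J c(1)] coord_comp_velocity[OF K c(1)] that by (auto simp: T_def)
    have "chart_velocity c \<gamma> t \<noteq> chart_velocity c \<sigma> t" using neq True v(1,2)[OF T(2)] by auto
    then have ne: "chart_velocity c \<gamma> t - chart_velocity c \<sigma> t \<noteq> 0" by simp
    have "continuous_on T (\<lambda>s. chart_velocity c \<gamma> s - chart_velocity c \<sigma> s)"
      using smooth_on_continuous[OF curve_chart(3)[OF J c(1)]] smooth_on_continuous[OF curve_chart(3)[OF K c(1)]]
      by (intro continuous_on_diff) (auto simp: T_def intro: continuous_on_subset)
    then have "open (T \<inter> (\<lambda>s. chart_velocity c \<gamma> s - chart_velocity c \<sigma> s) -` (- {0}))"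
      using continuous_on_open_vimage[OF T(1)] by (metis Int_commute open_Compl closed_singleton)
    moreover have "t \<in> T \<inter> (\<lambda>s. chart_velocity c \<gamma> s - chart_velocity c \<sigma> s) -` (- {0})" using T(2) ne by simp
    moreover have "velocity A \<gamma> s \<noteq> velocity A \<sigma> s" if s: "s \<in> T \<inter> (\<lambda>s. chart_velocity c \<gamma> s - chart_velocity c \<sigma> s) -` (- {0})" for s
    proof
      assume "velocity A \<gamma> s = velocity A \<sigma> s"
      then have "chart_velocity c \<gamma> s \<bullet> b = chart_velocity c \<sigma> s \<bullet> b" for b using v(3,4)[of s b] s by simp
      then have "chart_velocity c \<gamma> s = chart_velocity c \<sigma> s" by (rule euclidean_eqI)
      then show False using s by simp
    qed
    ultimately show ?thesis unfolding eventually_nhds by blast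
  qed
qed

text \<open>The times in \<open>[0, 1]\<close> at which positions and velocities agree form an open and closed set.
  It is closed because the manifold is Hausdorff.\<close>

lemma geodesic_endpoint_unique:
  assumes "geodesic_endpoint A D x v y" "geodesic_endpoint A D x v z"
  shows "y = z"
proof -
  obtain J \<gamma> where \<gamma>: "geodesic A D J \<gamma>" "{0..1} \<subseteq> J" "\<gamma> 0 = x" "velocity A \<gamma> 0 = v" "\<gamma> 1 = y"
    using assms(1) unfolding geodesic_endpoint_def by blast
  obtain K \<sigma> where \<sigma>: "geodesic A D K \<sigma>" "{0..1} \<subseteq> K" "\<sigma> 0 = x" "velocity A \<sigma> 0 = v" "\<sigma> 1 = z"
    using assms(2) unfolding geodesic_endpoint_def by blast
  let ?P = "\<lambda>t. \<gamma> t = \<sigma> t \<and> velocity A \<gamma> t = velocity A \<sigma> t"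
  have "?P (0::real) = ?P (1::real)"
  proof (rule connected_local_const[of "{0..1::real}"])
    show "\<forall>t\<in>{0..1}. \<forall>\<^sub>F s in at t within {0..1}. ?P t = ?P s"
    proof
      fix t :: real assume "t \<in> {0..1}"
      then have t: "t \<in> J" "t \<in> K" using \<gamma>(2) \<sigma>(2) by auto
      have "\<forall>\<^sub>F s in nhds t. ?P t = ?P s"
      proof (cases "?P t")
        case True
        then show ?thesis using geodesic_eq_locally[OF \<gamma>(1) \<sigma>(1) t] by (auto elim: eventually_mono)
      next
        case False
        then show ?thesis using geodesic_neq_locally[OF \<gamma>(1) \<sigma>(1) t] by (auto elim: eventually_mono)
      qed
      then show "\<forall>\<^sub>F s in at t within {0..1}. ?P t = ?P s"
        unfolding eventually_at_filter by (rule eventually_mono) simp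
    qed
  qed auto
  then show ?thesis using \<gamma>(3-5) \<sigma>(3-5) by simp
qed

lemma exp_map_eq: "geodesic_endpoint A D x v y \<Longrightarrow> exp_map A D x v = y"
  unfolding exp_map_def using geodesic_endpoint_unique by blast

text \<open>The factor \<open>r\<close> may be \<open>0\<close>; then the curve is constant.\<close>

lemma geodesic_rescale:
  assumes \<gamma>: "geodesic A D J \<gamma>" and r0: "0 \<in> J"
  shows "geodesic A D {s. r * s \<in> J} (\<lambda>s. \<gamma> (r * s))"
    and "velocity A (\<lambda>s. \<gamma> (r * s)) 0 = r *\<^sub>R velocity A \<gamma> 0"
proof -
  have J: "open J" and Ji: "is_interval J" and s: "smooth_map std_atlas A J \<gamma>"
    using \<gamma> by (auto simp: geodesic_def)
  let ?J = "{s. r * s \<in> J}" and ?\<gamma> = "\<lambda>s. \<gamma> (r * s)"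
  have oJ: "open ?J"
    using open_vimage[OF J, of "\<lambda>s. r * s"] by (simp add: vimage_def continuous_on_mult_left)
  have iJ: "is_interval ?J"
  proof -
    have "convex ((\<lambda>s. r * s) -` J)"
      using Ji by (intro convex_linear_vimage) (auto simp: is_interval_convex_1 linear_iff algebra_simps)
    then show ?thesis by (simp add: is_interval_convex_1 vimage_def)
  qed
  have lin: "smooth_on T (\<lambda>s. r * s)" for T by (intro smooth_on_linear bounded_linear_mult_right)
  have sm: "smooth_map std_atlas A ?J ?\<gamma>"
    unfolding smooth_map_def
  proof (intro conjI ballI)
    show "continuous_on ?J ?\<gamma>"
    proof (rule continuous_on_compose2[of J \<gamma>])
      show "continuous_on J \<gamma>" using s by (simp add: smooth_map_def)
      show "continuous_on ?J (\<lambda>s. r * s)" by (intro continuous_on_mult_left continuous_on_id)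
    qed auto
    fix d :: "('m, 'e) chart" and c0 :: "(real, real) chart"
    assume c0: "c0 \<in> std_atlas" and d: "d \<in> A"
    have o: "open {s. r * s \<in> J \<inter> \<gamma> -` fst d}"
      using open_vimage[OF curve_chart(1)[OF J s d], of "\<lambda>s. r * s"] by (simp add: vimage_def continuous_on_mult_left)
    have "smooth_on {s. r * s \<in> J \<inter> \<gamma> -` fst d} (\<lambda>s. snd d (\<gamma> (r * s)))"
      by (rule smooth_on_compose[OF o curve_chart(1)[OF J s d] _ lin curve_chart(2)[OF J s d]]) auto
    then show "smooth_on (snd c0 ` (?J \<inter> fst c0 \<inter> ?\<gamma> -` fst d)) (snd d \<circ> ?\<gamma> \<circ> chart_inv c0)"
      using c0 by (simp add: std_atlas_def comp_def Int_def vimage_def)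
  qed
  have cv: "chart_velocity c ?\<gamma> t = r *\<^sub>R chart_velocity c \<gamma> (r * t)" and ca: "chart_acceleration c ?\<gamma> t = (r * r) *\<^sub>R chart_acceleration c \<gamma> (r * t)"
    if c: "c \<in> A" and t: "t \<in> ?J \<inter> ?\<gamma> -` fst c" for c t
  proof -
    have rt: "r * t \<in> J \<inter> \<gamma> -` fst c" if "t \<in> ?J \<inter> ?\<gamma> -` fst c" for t using that by simp
    have mult: "((\<lambda>s. r * s) has_vector_derivative r) (at t)" for t
      by (auto intro!: derivative_eq_intros simp: has_real_derivative_iff_has_vector_derivative[symmetric])
    have "((\<lambda>s. snd c (\<gamma> (r * s))) has_vector_derivative r *\<^sub>R chart_velocity c \<gamma> (r * t)) (at t)" if "t \<in> ?J \<inter> ?\<gamma> -` fst c" for t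
      using vector_diff_chain_at[OF mult curve_chart(4)[OF J s c rt[OF that]]] by (simp add: comp_def)
    then have cv: "chart_velocity c ?\<gamma> t = r *\<^sub>R chart_velocity c \<gamma> (r * t)" if "t \<in> ?J \<inter> ?\<gamma> -` fst c" for t
      using vector_derivative_unique_at[OF curve_chart(4)[OF oJ sm c that]] that by blast
    show "chart_velocity c ?\<gamma> t = r *\<^sub>R chart_velocity c \<gamma> (r * t)" by (rule cv[OF t])
    have "((\<lambda>s. chart_velocity c \<gamma> (r * s)) has_vector_derivative r *\<^sub>R chart_acceleration c \<gamma> (r * t)) (at t)"
      using vector_diff_chain_at[OF mult curve_chart(5)[OF J s c rt[OF t]]] by (simp add: comp_def)
    then have "((\<lambda>s. r *\<^sub>R chart_velocity c \<gamma> (r * s)) has_vector_derivative r *\<^sub>R (r *\<^sub>R chart_acceleration c \<gamma> (r * t))) (at t)"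
      by (rule bounded_linear.has_vector_derivative[OF bounded_linear_scaleR_right])
    then have "(chart_velocity c ?\<gamma> has_vector_derivative r *\<^sub>R (r *\<^sub>R chart_acceleration c \<gamma> (r * t))) (at t)"
      by (rule has_vector_derivative_transform_within_open[OF _ curve_chart(1)[OF oJ sm c] t]) (simp add: cv)
    from vector_derivative_unique_at[OF curve_chart(5)[OF oJ sm c t] this]
    show "chart_acceleration c ?\<gamma> t = (r * r) *\<^sub>R chart_acceleration c \<gamma> (r * t)" by simp
  qed
  have "cov_deriv_along A D c ?\<gamma> (velocity A ?\<gamma>) t = 0" if c: "c \<in> A" and t: "t \<in> ?J" "?\<gamma> t \<in> fst c" for c t
  proof -
    have t': "t \<in> ?J \<inter> ?\<gamma> -` fst c" and rt: "r * t \<in> J" using t by auto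
    have "cov_deriv_along A D c ?\<gamma> (velocity A ?\<gamma>) t
        = (r * r) *\<^sub>R cov_deriv_along A D c \<gamma> (velocity A \<gamma>) (r * t)"
      unfolding cov_deriv_chart[OF oJ sm c t] cov_deriv_chart[OF J s c rt t(2)] cv[OF c t'] ca[OF c t']
      by (simp only: scaleR_sum_right scaleR_add_right scaleR_scaleR inner_scaleR_left ac_simps)
    then show ?thesis using \<gamma> c rt t(2) unfolding geodesic_def by simp
  qed
  then show "geodesic A D ?J ?\<gamma>" using oJ iJ sm by (simp add: geodesic_def)
  obtain c where c: "c \<in> A" "\<gamma> 0 \<in> fst c" using chart_cover .
  have 0: "0 \<in> ?J" "?\<gamma> 0 \<in> fst c" "0 \<in> ?J \<inter> ?\<gamma> -` fst c" using r0 c by auto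
  show "velocity A ?\<gamma> 0 = r *\<^sub>R velocity A \<gamma> 0"
    unfolding velocity_chart[OF oJ sm c(1) 0(1,2)] velocity_chart[OF J s c(1) r0 c(2)] cv[OF c(1) 0(3)]
    using linear_scale[OF coord_field_linear[OF c]] by simp
qed

text \<open>The geodesics through \<open>x\<close> are the images of the rays under the exponential map.\<close>

lemma exp_map_ray:
  assumes "v \<in> exp_domain A D x"
  obtains J \<gamma> where "geodesic A D J \<gamma>" "{0..1} \<subseteq> J" "\<gamma> 0 = x" "velocity A \<gamma> 0 = v"
    "\<And>t. t \<in> {0..1} \<Longrightarrow> exp_map A D x (t *\<^sub>R v) = \<gamma> t"
proof -
  obtain J \<gamma> where \<gamma>: "geodesic A D J \<gamma>" "{0..1} \<subseteq> J" "\<gamma> 0 = x" "velocity A \<gamma> 0 = v"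
    using assms unfolding exp_domain_def geodesic_endpoint_def by blast
  have 0: "0 \<in> J" using \<gamma>(2) by auto
  have "exp_map A D x (t *\<^sub>R v) = \<gamma> t" if t: "t \<in> {0..1}" for t
  proof (rule exp_map_eq)
    have "t * s \<in> {0..1}" if "s \<in> {0..1}" for s using t that by (auto intro: mult_le_one)
    then show "geodesic_endpoint A D x (t *\<^sub>R v) (\<gamma> t)"
      unfolding geodesic_endpoint_def
      using geodesic_rescale[OF \<gamma>(1) 0, of t] \<gamma>(2-4)
      by (intro exI[of _ "{s. t * s \<in> J}"] exI[of _ "\<lambda>s. \<gamma> (t * s)"]) auto
  qed
  then show thesis using that \<gamma> by blast
qed

end

context connection_manifold
begin

text \<open>The differential of the exponential map at the origin is the identity: a ray is mapped to the
  geodesic with the corresponding initial velocity. Only vectors in \<open>B\<close> are known to have a geodesic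
  that is defined up to time \<open>1\<close>; all others are multiples of these.\<close>

lemma exp_map_derivative:
  fixes L :: "'e \<Rightarrow> 'm tangent"
  assumes zero: "0 \<in> L ` B" and sub: "L ` B \<subseteq> exp_domain A D x" and L: "linear L"
    "bij_betw L UNIV (tangent_space A x)"
    and diff: "diffeo std_atlas A B U (exp_map A D x \<circ> L)" and f: "smooth_at A x f"
  shows "((\<lambda>e. f (exp_map A D x (L e))) has_derivative (\<lambda>e. L e f)) (at 0)"
    and "exp_map A D x 0 = x" and "0 \<in> B"
proof -
  have B: "open B" and s: "smooth_map std_atlas A B (exp_map A D x \<circ> L)"
    using diff by (auto simp: diffeo_def)
  obtain e0 where e0: "e0 \<in> B" "L e0 = 0" using zero by force
  then have "L e0 = L 0" using linear_0[OF L(1)] by simp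
  then have "e0 = 0" using L(2) by (simp add: bij_betw_def inj_eq)
  then show B0: "0 \<in> B" using e0 by simp
  have "0 \<in> exp_domain A D x" using zero sub by blast
  then obtain J \<gamma> where "\<gamma> 0 = x" "\<And>t. t \<in> {0..1} \<Longrightarrow> exp_map A D x (t *\<^sub>R 0) = \<gamma> t"
    by (rule exp_map_ray) blast
  from this(1) this(2)[of 0] show exp0: "exp_map A D x 0 = x" by simp
  obtain G where G: "open G" "x \<in> G" "smooth_fun A G f" using f unfolding smooth_at_def by blast
  let ?H = "\<lambda>e. f (exp_map A D x (L e))"
  have "smooth_on (B \<inter> (exp_map A D x \<circ> L) -` G) ?H"
    using smooth_on_pullback(2)[OF B s G(1,3)] by (simp add: comp_def)
  moreover have "0 \<in> B \<inter> (exp_map A D x \<circ> L) -` G" using B0 exp0 G(2) linear_0[OF L(1)] by simp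
  ultimately have D: "(?H has_derivative frechet_derivative ?H (at 0)) (at 0)"
    using smooth_on_differentiable frechet_derivative_works by blast
  note lin = has_derivative_linear[OF D]
  have small: "frechet_derivative ?H (at 0) e = L e f" if e: "e \<in> B" for e
  proof -
    have "L e \<in> exp_domain A D x" using e sub by blast
    then obtain J \<gamma> where \<gamma>: "geodesic A D J \<gamma>" "{0..1} \<subseteq> J" "\<gamma> 0 = x" "velocity A \<gamma> 0 = L e"
      and ray: "\<And>t. t \<in> {0..1} \<Longrightarrow> exp_map A D x (t *\<^sub>R L e) = \<gamma> t"
      by (rule exp_map_ray) blast
    have J: "open J" "smooth_map std_atlas A J \<gamma>" "0 \<in> J" using \<gamma>(1,2) by (auto simp: geodesic_def)
    (* the ray agrees with the geodesic for times in [0, 1] only, so derivatives are compared there *)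
    have "((\<lambda>t::real. t *\<^sub>R e) has_derivative (\<lambda>t. t *\<^sub>R e)) (at 0)"
      by (intro bounded_linear_imp_has_derivative bounded_linear_scaleR_left)
    moreover have "(?H has_derivative frechet_derivative ?H (at 0)) (at ((0::real) *\<^sub>R e))" using D by simp
    ultimately have "((\<lambda>t. ?H (t *\<^sub>R e)) has_derivative (\<lambda>t. frechet_derivative ?H (at 0) (t *\<^sub>R e))) (at 0)"
      by (rule has_derivative_compose[of "\<lambda>t. t *\<^sub>R e" _ 0 UNIV ?H])
    then have 1: "((\<lambda>t. ?H (t *\<^sub>R e)) has_vector_derivative frechet_derivative ?H (at 0) e) (at 0 within cbox 0 1)"
      unfolding has_vector_derivative_def linear_scale[OF lin] by (rule has_derivative_at_withinI)
    obtain c where c: "c \<in> A" "\<gamma> 0 \<in> fst c" using chart_cover .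
    have vel: "coord_field A c (chart_velocity c \<gamma> 0) (\<gamma> 0) = L e"
      using velocity_chart[OF J(1,2) c(1) J(3) c(2)] \<gamma>(4) by simp
    have "smooth_at A (\<gamma> 0) f" using f \<gamma>(3) by simp
    from curve_fun_derivative[OF J(1,2) c(1) J(3) c(2) this]
    have "((\<lambda>t. f (\<gamma> t)) has_real_derivative L e f) (at 0)" unfolding vel .
    then have "((\<lambda>t. f (\<gamma> t)) has_vector_derivative L e f) (at 0 within cbox 0 1)"
      using has_vector_derivative_at_within has_real_derivative_iff_has_vector_derivative by blast
    then have 2: "((\<lambda>t. ?H (t *\<^sub>R e)) has_vector_derivative L e f) (at 0 within cbox 0 1)"
      by (rule has_vector_derivative_transform[rotated 2]) (use ray in \<open>auto simp: linear_scale[OF L(1)]\<close>)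
    show ?thesis by (rule vector_derivative_unique_within_closed_interval[OF _ _ 1 2]) auto
  qed
  have "frechet_derivative ?H (at 0) e = L e f" for e
  proof -
    obtain r where r: "r > 0" "ball 0 r \<subseteq> B" using B B0 open_contains_ball by blast
    (* the factor k moves e into the ball contained in B *)
    define k where "k = r / (norm e + 1) / 2"
    have k: "k > 0" using r(1) by (simp add: k_def add_nonneg_pos)
    have "norm (k *\<^sub>R e) < r"
    proof -
      define c where "c = r * (norm e / (norm e + 1))"
      have "norm e / (norm e + 1) < 1" by (simp add: add_nonneg_pos)
      then have "c < r * 1" unfolding c_def using r(1) by (intro mult_strict_left_mono)
      moreover have "norm (k *\<^sub>R e) = c / 2" using r(1) by (simp add: k_def c_def)
      moreover have "0 \<le> c" using r(1) by (simp add: c_def)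
      ultimately show ?thesis by linarith
    qed
    then have "frechet_derivative ?H (at 0) (k *\<^sub>R e) = L (k *\<^sub>R e) f" using r(2) by (intro small) auto
    then show ?thesis using k by (simp add: linear_scale[OF lin] linear_scale[OF L(1)])
  qed
  then have "frechet_derivative ?H (at 0) = (\<lambda>e. L e f)" ..
  then show "(?H has_derivative (\<lambda>e. L e f)) (at 0)" using D by simp
qed

end

section \<open>The symmetries and their eigenbundles\<close>

context witt_manifold
begin

abbreviation \<delta> :: "'m \<Rightarrow> 'm tangent \<Rightarrow> 'm tangent" where
  "\<delta> \<equiv> witt_delta I V"

abbreviation sign :: "int \<Rightarrow> real" where
  "sign i \<equiv> (-1) powi i"

lemma sign_cases: "sign i = 1 \<or> sign i = -1"
  by (cases "even i") simp_all

lemma proj_linear: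
  assumes "u \<in> tangent_space A x" "v \<in> tangent_space A x" "i \<in> I"
  shows "P i x (a *\<^sub>R u + b *\<^sub>R v) = a *\<^sub>R P i x u + b *\<^sub>R P i x v"
proof -
  have "a *\<^sub>R u + b *\<^sub>R v = a *\<^sub>R (\<Sum>i\<in>I. P i x u) + b *\<^sub>R (\<Sum>i\<in>I. P i x v)"
    by (simp only: proj_sum(1)[OF assms(1)] proj_sum(1)[OF assms(2)])
  also have "\<dots> = (\<Sum>i\<in>I. a *\<^sub>R P i x u + b *\<^sub>R P i x v)"
    by (simp only: scaleR_sum_right sum.distrib)
  finally show ?thesis
    using proj_unique[of "\<lambda>i. a *\<^sub>R P i x u + b *\<^sub>R P i x v" x i] assms proj_sum(2) V_subspace
    by (simp add: subspace_add subspace_scale del: plus_fun_apply scaleR_fun_apply)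
qed

lemma delta_linear:
  assumes "u \<in> tangent_space A x" "v \<in> tangent_space A x"
  shows "\<delta> x (a *\<^sub>R u + b *\<^sub>R v) = a *\<^sub>R \<delta> x u + b *\<^sub>R \<delta> x v"
  unfolding witt_delta_def scaleR_sum_right sum.distrib[symmetric]
  by (rule sum.cong[OF refl]) (simp only: proj_linear[OF assms] scaleR_add_right scaleR_scaleR mult.commute)

lemma delta_tangent: "u \<in> tangent_space A x \<Longrightarrow> \<delta> x u \<in> tangent_space A x"
  unfolding witt_delta_def by (rule tangent_sum, rule tangent_scale, rule V_tangent[OF _ proj_sum(2)])

lemma delta_V:
  assumes "i \<in> I" "u \<in> V i x" shows "\<delta> x u = sign i *\<^sub>R u"
proof -
  have "\<delta> x u = (\<Sum>k\<in>I. if k = i then sign i *\<^sub>R u else 0)"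
    unfolding witt_delta_def by (rule sum.cong[OF refl]) (auto simp: proj_V[OF assms])
  then show ?thesis using assms(1) finite_index by simp
qed

text \<open>In exponential coordinates the symmetry is the linear map \<open>\<delta>\<close>, and the exponential map
  has the identity as its differential, so \<open>\<delta>\<close> is the differential of the symmetry at its centre.\<close>

lemma witt_symmetry_differential:
  assumes ed: "exp_diffeo A D x N U" and inv: "\<delta> x ` N = N"
  shows "x \<in> U" and "witt_symmetry A I V D x N x = x"
    and "smooth_at A x f \<Longrightarrow> smooth_at A x (\<lambda>y. f (witt_symmetry A I V D x N y)) \<Longrightarrow> v \<in> tangent_space A x \<Longrightarrow>
      v (\<lambda>y. f (witt_symmetry A I V D x N y)) = \<delta> x v f"
proof -
  let ?\<psi> = "witt_symmetry A I V D x N" and ?e = "exp_map A D x"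
  obtain L :: "'e \<Rightarrow> 'm tangent" and B where L: "linear L" "bij_betw L UNIV (tangent_space A x)"
    and N: "L ` B = N" and d: "diffeo std_atlas A B U (?e \<circ> L)"
    and N0: "0 \<in> L ` B" "L ` B \<subseteq> exp_domain A D x"
    using ed unfolding exp_diffeo_def by blast
  note der = exp_map_derivative(1)[OF N0 L d]
  have exp0: "?e 0 = x" and B0: "0 \<in> B"
    using exp_map_derivative(2,3)[OF N0 L d smooth_at_const] by auto
  have bij: "bij_betw (?e \<circ> L) B U" using d by (simp add: diffeo_def)
  have L0: "L 0 = 0" by (rule linear_0[OF L(1)])
  have T: "L b \<in> tangent_space A x" for b using L(2) bij_betwE by blast
  have "(?e \<circ> L) 0 \<in> U" using bij B0 bij_betwE by blast
  then show "x \<in> U" by (simp add: L0 exp0)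
  have "inj_on ?e N"
    unfolding N[symmetric] using bij by (simp add: bij_betw_def inj_on_imageI)
  then have \<psi>: "?\<psi> (?e w) = ?e (\<delta> x w)" if "w \<in> N" for w
    using that by (simp add: witt_symmetry_def)
  have \<delta>0: "\<delta> x 0 = 0" using delta_linear[of 0 x 0 0 0] by (simp only: tangent_zero scaleR_zero_left add_0_right)
  show "?\<psi> x = x" using \<psi>[of 0] N0(1) N by (simp add: exp0 \<delta>0)
  assume f: "smooth_at A x f" "smooth_at A x (\<lambda>y. f (?\<psi> y))" and v: "v \<in> tangent_space A x"
  define \<Delta> where "\<Delta> = (\<lambda>b. inv L (\<delta> x (L b)))"
  have L\<Delta>: "L (\<Delta> b) = \<delta> x (L b)" for b
    unfolding \<Delta>_def using L(2) delta_tangent[OF T] by (simp add: bij_betw_def f_inv_into_f)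
  have inj: "L b = L b' \<Longrightarrow> b = b'" for b b' using L(2) by (simp add: bij_betw_def inj_eq)
  have lin: "linear \<Delta>"
  proof (rule linearI)
    show "\<Delta> (b + b') = \<Delta> b + \<Delta> b'" for b b'
      by (rule inj) (use delta_linear[OF T T, of 1 b 1 b'] in \<open>simp only: L\<Delta> linear_add[OF L(1)] scaleR_one\<close>)
    show "\<Delta> (a *\<^sub>R b) = a *\<^sub>R \<Delta> b" for a b
      by (rule inj) (use delta_linear[OF T T, of a b 0 b] in
          \<open>simp only: L\<Delta> linear_scale[OF L(1)] scaleR_zero_left add_0_right\<close>)
  qed
  have "(\<Delta> has_derivative \<Delta>) (at 0)"
    using lin by (intro bounded_linear_imp_has_derivative) (simp add: linear_conv_bounded_linear)
  moreover have "((\<lambda>b. f (?e (L b))) has_derivative (\<lambda>b. L b f)) (at (\<Delta> 0))"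
    using der[OF f(1)] by (simp add: linear_0[OF lin])
  ultimately have "((\<lambda>b. f (?e (L (\<Delta> b)))) has_derivative (\<lambda>b. L (\<Delta> b) f)) (at 0)"
    by (rule has_derivative_compose[of \<Delta> \<Delta> 0 UNIV "\<lambda>b. f (?e (L b))"])
  then have "((\<lambda>b. f (?\<psi> (?e (L b)))) has_derivative (\<lambda>b. L (\<Delta> b) f)) (at 0)"
  proof (rule has_derivative_transform_within_open)
    show "open B" "0 \<in> B" using d B0 by (auto simp: diffeo_def)
    show "f (?e (L (\<Delta> b))) = f (?\<psi> (?e (L b)))" if "b \<in> B" for b
    proof -
      have "L b \<in> N" using that N by blast
      from \<psi>[OF this] show ?thesis by (simp only: L\<Delta>)
    qed
  qed
  then have eq: "(\<lambda>b. L b (\<lambda>y. f (?\<psi> y))) = (\<lambda>b. L (\<Delta> b) f)"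
    by (rule has_derivative_unique[OF der[OF f(2)]])
  obtain b where "v = L b" using v L(2) unfolding bij_betw_def by blast
  then show "v (\<lambda>y. f (?\<psi> y)) = \<delta> x v f" using fun_cong[OF eq, of b] by (simp add: L\<Delta>)
qed

end

locale witt_symmetric_space = witt_manifold A D g I star V
  for A :: "('m::{t2_space, second_countable_topology}, 'e::euclidean_space) chart set"
    and D :: "'m connection" and g :: "'m metric_field" and I :: "int set" and star :: "int \<Rightarrow> int"
    and V :: "int \<Rightarrow> 'm \<Rightarrow> 'm tangent set" +
  assumes star_parity: "i \<in> I \<Longrightarrow> even (star i) \<longleftrightarrow> even i"
    and symmetric: "locally_witt_symmetric A g I V D"
begin

lemma symmetry_exists:
  obtains W W' \<psi> \<phi> where "witt_iso A D g I star V W W' \<psi> \<phi>" "x \<in> W" "\<psi> x = x"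
    "\<And>v. v \<in> tangent_space A x \<Longrightarrow> differential A \<psi> x v = \<delta> x v"
proof -
  obtain N U where ed: "exp_diffeo A D x N U" and inv: "\<delta> x ` N = N"
    and iso: "local_witt_isometry A g I V U (witt_symmetry A I V D x N)"
    using symmetric unfolding locally_witt_symmetric_def by blast
  define \<psi> where "\<psi> = witt_symmetry A I V D x N"
  note sd = witt_symmetry_differential[OF ed inv, folded \<psi>_def]
  note iso' = iso[unfolded local_witt_isometry_def local_diffeo_def, folded \<psi>_def]
  obtain W W' where W: "x \<in> W" "W \<subseteq> U" "diffeo A A W W' \<psi>" using iso' sd(1) by blast
  interpret manifold_iso A W W' \<psi> "inv_into W \<psi>" by (rule manifold_iso_diffeo[OF W(3)])
  have wi: "witt_iso A D g I star V W W' \<psi> (inv_into W \<psi>)"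
  proof unfold_locales
    show "g (\<psi> y) (differential A \<psi> y v) (differential A \<psi> y w) = g y v w"
      if "y \<in> W" "v \<in> tangent_space A y" "w \<in> tangent_space A y" for y v w
    proof -
      have "y \<in> U" using that(1) W(2) by blast
      from conjunct1[OF conjunct2[OF iso'], rule_format, OF this that(2,3)] show ?thesis .
    qed
    show "differential A \<psi> y v \<in> V i (\<psi> y)" if "i \<in> I" "y \<in> W" "v \<in> V i y" for i y v
    proof -
      have "y \<in> U" using that(2) W(2) by blast
      from conjunct2[OF conjunct2[OF iso'], rule_format, OF that(1) this] that(3) show ?thesis by blast
    qed
  qed
  have "differential A \<psi> x v = \<delta> x v" if v: "v \<in> tangent_space A x" for v
  proof
    fix f
    show "differential A \<psi> x v f = \<delta> x v f"
    proof (cases "smooth_at A x f")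
      case True
      then have "smooth_at A (\<psi> x) f" using sd(2) by simp
      from differential_apply[OF this] sd(3)[OF True smooth_at_pull[OF W(1) this] v] show ?thesis by simp
    next
      case False
      then show ?thesis using tangent_nonsmooth[OF delta_tangent[OF v]] sd(2) by (simp add: differential_def)
    qed
  qed
  then show thesis using that wi W(1) sd(2) by blast
qed

text \<open>The invariance of the tensors in a form that hides the domains of the symmetry: \<open>F\<close> is the
  pushforward of vector fields by the symmetry at \<open>x\<close>, restricted to a common domain \<open>G\<close>.\<close>

lemma symmetry_push:
  assumes U: "open U" "x \<in> U"
  obtains G F where "open G" "x \<in> G" "G \<subseteq> U"
    "\<And>X. X \<in> vfields A U \<Longrightarrow> F X \<in> vfields A G \<and> F X x = \<delta> x (X x)"
    "\<And>X Y. X \<in> vfields A U \<Longrightarrow> Y \<in> vfields A U \<Longrightarrow>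
       torsion A D (F X) (F Y) x = \<delta> x (torsion A D X Y x)"
    "\<And>X Y Z. X \<in> vfields A U \<Longrightarrow> Y \<in> vfields A U \<Longrightarrow> Z \<in> vfields A U \<Longrightarrow>
       curvature A D (F X) (F Y) (F Z) x = \<delta> x (curvature A D X Y Z x)"
    "\<And>X Y Z. X \<in> vfields A U \<Longrightarrow> Y \<in> vfields A U \<Longrightarrow> Z \<in> vfields A U \<Longrightarrow>
       cov_torsion A D (F X) (F Y) (F Z) x = \<delta> x (cov_torsion A D X Y Z x)"
    "\<And>X Y Z Q. X \<in> vfields A U \<Longrightarrow> Y \<in> vfields A U \<Longrightarrow> Z \<in> vfields A U \<Longrightarrow> Q \<in> vfields A U \<Longrightarrow>
       cov_curvature A D (F X) (F Y) (F Z) (F Q) x = \<delta> x (cov_curvature A D X Y Z Q x)"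
proof -
  obtain W W' \<psi> \<phi> where wi: "witt_iso A D g I star V W W' \<psi> \<phi>" and x: "x \<in> W" "\<psi> x = x"
    and d: "\<And>v. v \<in> tangent_space A x \<Longrightarrow> differential A \<psi> x v = \<delta> x v"
    by (rule symmetry_exists[of x]) (rule that; assumption)
  interpret w: witt_iso A D g I star V W W' \<psi> \<phi> by (rule wi)
  define H where "H = W \<inter> U"
  have H: "open H" "H \<subseteq> W" "H \<subseteq> U" "x \<in> H" using w.open_W U x by (auto simp: H_def)
  interpret r: witt_iso A D g I star V H "W' \<inter> \<phi> -` H" \<psi> \<phi> by (rule w.witt_iso_restrict[OF H(1,2)])
  let ?F = "w.push" and ?G = "(W' \<inter> \<phi> -` H) \<inter> U"
  have G: "open ?G" "x \<in> ?G" "?G \<subseteq> U"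
    using r.open_W' U r.maps[OF H(4)] x(2) by auto
  have rel: "X \<in> vfields A H" "?F X \<in> vfields A (W' \<inter> \<phi> -` H)" "r.related X (?F X)" if "X \<in> vfields A U" for X
    using vfields_subset[OF that H(3)] r.push_vf r.related_push by auto
  have at: "K' x = \<delta> x (K x)" if "r.related K K'" "K x \<in> tangent_space A x" for K K'
    using that(1) H(4) x(2) d[OF that(2)] unfolding r.related_def by metis
  note T = vf_tangent[OF _ U(2)]
  show thesis
  proof (rule that[OF G, of ?F])
    show "?F X \<in> vfields A ?G \<and> ?F X x = \<delta> x (X x)" if "X \<in> vfields A U" for X
      using vfields_subset[OF rel(2)[OF that], of ?G] at[OF rel(3)[OF that] T[OF that]] by blast
    show "torsion A D (?F X) (?F Y) x = \<delta> x (torsion A D X Y x)"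
      if X: "X \<in> vfields A U" and Y: "Y \<in> vfields A U" for X Y
      by (rule at[OF r.related_torsion[OF rel[OF X] rel[OF Y]] T[OF torsion_vf[OF U(1) X Y]]])
    show "curvature A D (?F X) (?F Y) (?F Z) x = \<delta> x (curvature A D X Y Z x)"
      if X: "X \<in> vfields A U" and Y: "Y \<in> vfields A U" and Z: "Z \<in> vfields A U" for X Y Z
      by (rule at[OF r.related_curvature[OF rel[OF X] rel[OF Y] rel[OF Z]] T[OF curvature_vf[OF U(1) X Y Z]]])
    show "cov_torsion A D (?F X) (?F Y) (?F Z) x = \<delta> x (cov_torsion A D X Y Z x)"
      if X: "X \<in> vfields A U" and Y: "Y \<in> vfields A U" and Z: "Z \<in> vfields A U" for X Y Z
      by (rule at[OF r.related_cov_torsion[OF rel[OF X] rel[OF Y] rel[OF Z]]])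
        (unfold cov_torsion_def, intro T vf_minus D_vf torsion_vf U X Y Z)
    show "cov_curvature A D (?F X) (?F Y) (?F Z) (?F Q) x = \<delta> x (cov_curvature A D X Y Z Q x)"
      if X: "X \<in> vfields A U" and Y: "Y \<in> vfields A U" and Z: "Z \<in> vfields A U" and Q: "Q \<in> vfields A U" for X Y Z Q
      by (rule at[OF r.related_cov_curvature[OF rel[OF X] rel[OF Y] rel[OF Z] rel[OF Q]]])
        (unfold cov_curvature_def, intro T vf_minus D_vf curvature_vf U X Y Z Q)
  qed
qed

text \<open>The eigenbundle of \<open>\<delta>\<close> for the eigenvalue \<open>\<epsilon>\<close>.\<close>

definition E :: "real \<Rightarrow> 'm \<Rightarrow> 'm tangent set" where
  "E \<epsilon> x = {v \<in> tangent_space A x. \<delta> x v = \<epsilon> *\<^sub>R v}"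

lemma E_eqs: "V_plus A I V = E 1" "V_minus A I V = E (-1)"
  by (rule ext, simp add: V_plus_def E_def, rule ext, simp only: V_minus_def E_def scaleR_minus_left scaleR_one)

lemma E_subspace: "subspace (E \<epsilon> x)"
  unfolding subspace_def
proof (intro conjI ballI allI)
  have \<delta>0: "\<delta> x 0 = 0" using delta_linear[of 0 x 0 0 0] by (simp only: tangent_zero scaleR_zero_left add_0_right)
  then show "0 \<in> E \<epsilon> x" by (simp only: E_def mem_Collect_eq tangent_zero scaleR_zero_right)
  fix u assume u: "u \<in> E \<epsilon> x"
  {
    fix v assume v: "v \<in> E \<epsilon> x"
    show "u + v \<in> E \<epsilon> x"
      using u v delta_linear[of u x v 1 1] unfolding E_def mem_Collect_eq
      by (simp only: scaleR_one tangent_plus scaleR_add_right)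
  }
  fix a
  show "a *\<^sub>R u \<in> E \<epsilon> x"
    using u delta_linear[of u x u a 0] unfolding E_def mem_Collect_eq
    by (simp only: scaleR_zero_left add_0_right mult_zero_left tangent_scale scaleR_scaleR mult.commute)
qed

lemma V_E: "i \<in> I \<Longrightarrow> V i x \<subseteq> E (sign i) x"
  unfolding E_def using delta_V V_tangent by blast

lemma g_sum_left:
  assumes "\<And>i. i \<in> J \<Longrightarrow> u i \<in> tangent_space A x" "w \<in> tangent_space A x"
  shows "g x (\<Sum>i\<in>J. u i) w = (\<Sum>i\<in>J. g x (u i) w)"
  using assms(1)
  by (induction J rule: infinite_finite_induct)
    (simp_all add: g_zero_left g_add_left tangent_sum assms(2) del: zero_fun_apply plus_fun_apply)

lemma sign_star: "i \<in> I \<Longrightarrow> sign (star i) = sign i"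
  using star_parity[of i] by (cases "even i") simp_all

text \<open>Paired blocks have equal parity, so vectors of different parity are orthogonal.\<close>

lemma g_delta:
  assumes u: "u \<in> tangent_space A x" and j: "j \<in> I" and w: "w \<in> V j x"
  shows "g x (\<delta> x u) w = sign j * g x u w"
proof -
  note P = proj_sum(2)[OF u] and wT = V_tangent[OF j w]
  have PT: "P i x u \<in> tangent_space A x" if "i \<in> I" for i by (rule V_tangent[OF that P[OF that]])
  have "g x (\<delta> x u) w = (\<Sum>i\<in>I. g x (sign i *\<^sub>R P i x u) w)"
    unfolding witt_delta_def by (rule g_sum_left[OF tangent_scale[OF PT] wT])
  also have "\<dots> = (\<Sum>i\<in>I. sign i * g x (P i x u) w)"
    by (rule sum.cong[OF refl]) (rule g_scale_left[OF PT wT])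
  also have "\<dots> = (\<Sum>i\<in>I. sign j * g x (P i x u) w)"
  proof (rule sum.cong[OF refl])
    fix i assume i: "i \<in> I"
    show "sign i * g x (P i x u) w = sign j * g x (P i x u) w"
    proof (cases "j = i \<or> j = star i")
      case True
      then show ?thesis using sign_star[OF i] by auto
    next
      case False
      then show ?thesis using orthogonal[OF i j _ _ P[OF i] w] by simp
    qed
  qed
  also have "\<dots> = sign j * g x (\<Sum>i\<in>I. P i x u) w"
    by (simp only: g_sum_left[OF PT wT] sum_distrib_left)
  finally show ?thesis by (simp only: proj_sum(1)[OF u])
qed

lemma g_zero_V:
  assumes u: "u \<in> tangent_space A x" and zero: "\<And>i w. i \<in> I \<Longrightarrow> w \<in> V i x \<Longrightarrow> g x u w = 0"
  shows "u = 0"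
proof (rule g_nondegenerate[OF u])
  fix w assume w: "w \<in> tangent_space A x"
  have "g x u w = g x w u" by (rule g_sym[OF u w])
  also have "\<dots> = g x (\<Sum>i\<in>I. P i x w) u" by (simp only: proj_sum(1)[OF w])
  also have "\<dots> = (\<Sum>i\<in>I. g x (P i x w) u)"
    using proj_sum(2)[OF w] V_tangent u by (intro g_sum_left) blast+
  also have "\<dots> = 0"
    using proj_sum(2)[OF w] V_tangent u zero g_sym by (intro sum.neutral) metis
  finally show "g x u w = 0" .
qed

text \<open>Each eigenbundle is the orthogonal complement of the other one, so the connection preserves the
  eigenbundles because it is metric and preserves the subbundles \<open>V i\<close>.\<close>

lemma E_orthogonal:
  assumes "u \<in> E \<epsilon> x" "i \<in> I" "w \<in> V i x" "sign i \<noteq> \<epsilon>" shows "g x u w = 0"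
  using g_delta[OF _ assms(2,3), of u] assms g_scale_left[OF _ V_tangent[OF assms(2,3)], of u \<epsilon>]
  by (auto simp: E_def)

lemma E_I:
  assumes u: "u \<in> tangent_space A x" and \<epsilon>: "\<epsilon> = 1 \<or> \<epsilon> = -1"
    and zero: "\<And>i w. i \<in> I \<Longrightarrow> w \<in> V i x \<Longrightarrow> sign i \<noteq> \<epsilon> \<Longrightarrow> g x u w = 0"
  shows "u \<in> E \<epsilon> x"
proof -
  have "\<delta> x u - \<epsilon> *\<^sub>R u = 0"
  proof (rule g_zero_V[OF tangent_minus[OF delta_tangent[OF u] tangent_scale[OF u]]])
    fix i w assume i: "i \<in> I" and w: "w \<in> V i x"
    have "g x (\<delta> x u - \<epsilon> *\<^sub>R u) w = sign i * g x u w - \<epsilon> * g x u w"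
      unfolding g_diff_left[OF delta_tangent[OF u] tangent_scale[OF u] V_tangent[OF i w]]
        g_delta[OF u i w] g_scale_left[OF u V_tangent[OF i w]] ..
    then show "g x (\<delta> x u - \<epsilon> *\<^sub>R u) w = 0" using zero[OF i w] by (cases "sign i = \<epsilon>") auto
  qed
  then show ?thesis using u by (simp only: E_def mem_Collect_eq right_minus_eq)
qed

lemma sections_subset: "X \<in> sections A U F \<Longrightarrow> G \<subseteq> U \<Longrightarrow> X \<in> sections A G F"
  unfolding sections_def using vfields_subset by blast

lemma D_E:
  assumes U: "open U" and X: "X \<in> vfields A U" and Y: "Y \<in> sections A U (E \<epsilon>)" and \<epsilon>: "\<epsilon> = 1 \<or> \<epsilon> = -1"
  shows "D X Y \<in> sections A U (E \<epsilon>)"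
proof -
  have vY: "Y \<in> vfields A U" and eY: "\<And>y. y \<in> U \<Longrightarrow> Y y \<in> E \<epsilon> y" using Y by (auto simp: sections_def)
  have "D X Y x \<in> E \<epsilon> x" if x: "x \<in> U" for x
  proof (rule E_I[OF vf_tangent[OF D_vf[OF U X vY] x] \<epsilon>])
    fix i w assume i: "i \<in> I" and w: "w \<in> V i x" and s: "sign i \<noteq> \<epsilon>"
    obtain G Z where G: "open G" "x \<in> G" "G \<subseteq> U" "Z \<in> sections A G (V i)" "Z x = w"
      using V_section[OF i w U x] .
    have vZ: "Z \<in> vfields A G" and eZ: "\<And>y. y \<in> G \<Longrightarrow> Z y \<in> V i y" using G(4) by (auto simp: sections_def)
    note r = vfields_subset[OF _ G(3)]
    have "X x (\<lambda>y. g y (Y y) (Z y)) = X x (\<lambda>y. 0)"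
      by (rule tangent_germ[OF vf_tangent[OF X x] G(1,2)]) (use E_orthogonal[OF eY i eZ s] G(3) in auto)
    also have "\<dots> = 0" by (rule tangent_const[OF vf_tangent[OF X x]])
    finally have "g x (D X Y x) (Z x) = - g x (Y x) (D X Z x)"
      using D_metric[OF G(1) r[OF X] r[OF vY] vZ G(2)] by simp
    also have "g x (Y x) (D X Z x) = 0"
      by (rule E_orthogonal[OF eY[OF x] i D_preserves[OF i G(1) r[OF X] G(4,2)] s])
    finally show "g x (D X Y x) w = 0" using G(5) by simp
  qed
  then show ?thesis using D_vf[OF U X vY] by (simp add: sections_def)
qed

lemma tensorial_eigen:
  assumes F: "tensorial A U F" and U: "open U" "x \<in> U" and X': "X' \<in> vfields A U" and X: "X \<in> vfields A U"
    and eq: "X' x = \<epsilon> *\<^sub>R X x"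
  shows "F X' x = \<epsilon> *\<^sub>R F X x"
proof -
  have "F X' x = F (\<lambda>y. \<epsilon> *\<^sub>R X y) x"
    by (rule tensorial_pointwise[OF F U X' U vf_scaleR[OF X] U eq])
  also have "\<dots> = \<epsilon> *\<^sub>R F X x"
    by (rule tensorial_scale[OF F U(1) order_refl X smooth_fun_const U(2)])
  finally show ?thesis .
qed

lemma sectionsD: "X \<in> sections A U F \<Longrightarrow> X \<in> vfields A U" "X \<in> sections A U F \<Longrightarrow> x \<in> U \<Longrightarrow> X x \<in> F x"
  by (simp_all add: sections_def)

text \<open>Invariance under the symmetry at \<open>x\<close>, whose differential there is \<open>\<delta>\<close>, forces a tensor to multiply
  the eigenvalues of its arguments.\<close>

lemma torsion_E:
  assumes U: "open U" and X: "X \<in> sections A U (E a)" and Y: "Y \<in> sections A U (E b)"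
  shows "torsion A D X Y \<in> sections A U (E (a * b))"
proof -
  have "torsion A D X Y x \<in> E (a * b) x" if x: "x \<in> U" for x
  proof -
    note v = sectionsD(1)[OF X] sectionsD(1)[OF Y]
    from U x show ?thesis
    proof (rule symmetry_push)
      fix G F assume G: "open G" "x \<in> G" "G \<subseteq> U"
        and F: "\<And>X. X \<in> vfields A U \<Longrightarrow> F X \<in> vfields A G \<and> F X x = \<delta> x (X x)"
        and nat: "\<And>X Y. X \<in> vfields A U \<Longrightarrow> Y \<in> vfields A U \<Longrightarrow>
          torsion A D (F X) (F Y) x = \<delta> x (torsion A D X Y x)"
      have FX: "F X \<in> vfields A G" "F X x = a *\<^sub>R X x" and FY: "F Y \<in> vfields A G" "F Y x = b *\<^sub>R Y x"
        using F[OF v(1)] F[OF v(2)] sectionsD(2)[OF X x] sectionsD(2)[OF Y x] by (auto simp: E_def)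
      note r = vfields_subset[OF _ G(3)]
      note e = tensorial_eigen[OF _ G(1,2)]
      have "\<delta> x (torsion A D X Y x) = torsion A D (F X) (F Y) x" using nat v by simp
      also have "\<dots> = a *\<^sub>R torsion A D X (F Y) x"
        by (rule e[OF torsion_tensorial_left[OF G(1) FY(1)] FX(1) r[OF v(1)] FX(2)])
      also have "\<dots> = a *\<^sub>R (b *\<^sub>R torsion A D X Y x)"
        by (simp only: e[OF torsion_tensorial_right[OF G(1) r[OF v(1)]] FY(1) r[OF v(2)] FY(2)])
      finally show ?thesis
        using vf_tangent[OF torsion_vf[OF U v] x] by (simp only: E_def mem_Collect_eq scaleR_scaleR)
    qed
  qed
  then show ?thesis
    using torsion_vf[OF U sectionsD(1)[OF X] sectionsD(1)[OF Y]] by (simp add: sections_def)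
qed

lemma curvature_E:
  assumes U: "open U" and X: "X \<in> sections A U (E a)" and Y: "Y \<in> sections A U (E b)" and Z: "Z \<in> sections A U (E c)"
  shows "curvature A D X Y Z \<in> sections A U (E (a * (b * c)))"
proof -
  note v = sectionsD(1)[OF X] sectionsD(1)[OF Y] sectionsD(1)[OF Z]
  have "curvature A D X Y Z x \<in> E (a * (b * c)) x" if x: "x \<in> U" for x
    using U x
  proof (rule symmetry_push)
    fix G F assume G: "open G" "x \<in> G" "G \<subseteq> U"
      and F: "\<And>X. X \<in> vfields A U \<Longrightarrow> F X \<in> vfields A G \<and> F X x = \<delta> x (X x)"
      and nat: "\<And>X Y Z. X \<in> vfields A U \<Longrightarrow> Y \<in> vfields A U \<Longrightarrow> Z \<in> vfields A U \<Longrightarrow>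
        curvature A D (F X) (F Y) (F Z) x = \<delta> x (curvature A D X Y Z x)"
    have FX: "F X \<in> vfields A G" "F X x = a *\<^sub>R X x" and FY: "F Y \<in> vfields A G" "F Y x = b *\<^sub>R Y x"
      and FZ: "F Z \<in> vfields A G" "F Z x = c *\<^sub>R Z x"
      using F[OF v(1)] F[OF v(2)] F[OF v(3)] sectionsD(2)[OF X x] sectionsD(2)[OF Y x] sectionsD(2)[OF Z x]
      by (auto simp: E_def)
    note r = vfields_subset[OF _ G(3)]
    note e = tensorial_eigen[OF _ G(1,2)]
    have "\<delta> x (curvature A D X Y Z x) = curvature A D (F X) (F Y) (F Z) x" using nat v by simp
    also have "\<dots> = a *\<^sub>R curvature A D X (F Y) (F Z) x"
      by (rule e[OF curvature_tensorial_1[OF G(1) FY(1) FZ(1)] FX(1) r[OF v(1)] FX(2)])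
    also have "curvature A D X (F Y) (F Z) x = b *\<^sub>R curvature A D X Y (F Z) x"
      by (rule e[OF curvature_tensorial_2[OF G(1) r[OF v(1)] FZ(1)] FY(1) r[OF v(2)] FY(2)])
    also have "curvature A D X Y (F Z) x = c *\<^sub>R curvature A D X Y Z x"
      by (rule e[OF curvature_tensorial_3[OF G(1) r[OF v(1)] r[OF v(2)]] FZ(1) r[OF v(3)] FZ(2)])
    finally show ?thesis
      using vf_tangent[OF curvature_vf[OF U v] x] by (simp only: E_def mem_Collect_eq scaleR_scaleR)
  qed
  then show ?thesis using curvature_vf[OF U v] by (simp add: sections_def)
qed

lemma cov_torsion_delta:
  assumes U: "open U" and x: "x \<in> U" and X: "X \<in> sections A U (E a)" and Y: "Y \<in> sections A U (E b)" and Z: "Z \<in> sections A U (E c)"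
  shows "\<delta> x (cov_torsion A D X Y Z x) = (a * (b * c)) *\<^sub>R cov_torsion A D X Y Z x"
  using U x
proof (rule symmetry_push)
  note v = sectionsD(1)[OF X] sectionsD(1)[OF Y] sectionsD(1)[OF Z]
  fix G F assume G: "open G" "x \<in> G" "G \<subseteq> U"
    and F: "\<And>X. X \<in> vfields A U \<Longrightarrow> F X \<in> vfields A G \<and> F X x = \<delta> x (X x)"
    and nat: "\<And>X Y Z. X \<in> vfields A U \<Longrightarrow> Y \<in> vfields A U \<Longrightarrow> Z \<in> vfields A U \<Longrightarrow>
      cov_torsion A D (F X) (F Y) (F Z) x = \<delta> x (cov_torsion A D X Y Z x)"
  have FX: "F X \<in> vfields A G" "F X x = a *\<^sub>R X x" and FY: "F Y \<in> vfields A G" "F Y x = b *\<^sub>R Y x"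
    and FZ: "F Z \<in> vfields A G" "F Z x = c *\<^sub>R Z x"
    using F[OF v(1)] F[OF v(2)] F[OF v(3)] sectionsD(2)[OF X x] sectionsD(2)[OF Y x] sectionsD(2)[OF Z x]
    by (auto simp: E_def)
  note r = vfields_subset[OF _ G(3)]
  note e = tensorial_eigen[OF _ G(1,2)]
  have "\<delta> x (cov_torsion A D X Y Z x) = cov_torsion A D (F X) (F Y) (F Z) x" using nat v by simp
  also have "\<dots> = a *\<^sub>R cov_torsion A D X (F Y) (F Z) x"
    by (rule e[OF cov_torsion_tensorial(1)[OF G(1) FY(1) FZ(1)] FX(1) r[OF v(1)] FX(2)])
  also have "cov_torsion A D X (F Y) (F Z) x = b *\<^sub>R cov_torsion A D X Y (F Z) x"
    by (rule e[OF cov_torsion_tensorial(2)[OF G(1) r[OF v(1)] FZ(1)] FY(1) r[OF v(2)] FY(2)])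
  also have "cov_torsion A D X Y (F Z) x = c *\<^sub>R cov_torsion A D X Y Z x"
    by (rule e[OF cov_torsion_tensorial(3)[OF G(1) r[OF v(1)] r[OF v(2)]] FZ(1) r[OF v(3)] FZ(2)])
  finally show ?thesis by (simp only: scaleR_scaleR)
qed

lemma cov_curvature_delta:
  assumes U: "open U" and x: "x \<in> U" and X: "X \<in> sections A U (E a)" and Y: "Y \<in> sections A U (E b)" and Z: "Z \<in> sections A U (E c)"
    and Q: "Q \<in> sections A U (E d)"
  shows "\<delta> x (cov_curvature A D X Y Z Q x) = (a * (b * (c * d))) *\<^sub>R cov_curvature A D X Y Z Q x"
  using U x
proof (rule symmetry_push)
  note v = sectionsD(1)[OF X] sectionsD(1)[OF Y] sectionsD(1)[OF Z] sectionsD(1)[OF Q]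
  fix G F assume G: "open G" "x \<in> G" "G \<subseteq> U"
    and F: "\<And>X. X \<in> vfields A U \<Longrightarrow> F X \<in> vfields A G \<and> F X x = \<delta> x (X x)"
    and nat: "\<And>X Y Z Q. X \<in> vfields A U \<Longrightarrow> Y \<in> vfields A U \<Longrightarrow> Z \<in> vfields A U \<Longrightarrow> Q \<in> vfields A U \<Longrightarrow>
      cov_curvature A D (F X) (F Y) (F Z) (F Q) x = \<delta> x (cov_curvature A D X Y Z Q x)"
  have FX: "F X \<in> vfields A G" "F X x = a *\<^sub>R X x" and FY: "F Y \<in> vfields A G" "F Y x = b *\<^sub>R Y x"
    and FZ: "F Z \<in> vfields A G" "F Z x = c *\<^sub>R Z x" and FQ: "F Q \<in> vfields A G" "F Q x = d *\<^sub>R Q x"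
    using F[OF v(1)] F[OF v(2)] F[OF v(3)] F[OF v(4)] sectionsD(2)[OF X x] sectionsD(2)[OF Y x] sectionsD(2)[OF Z x]
      sectionsD(2)[OF Q x]
    by (auto simp: E_def)
  note r = vfields_subset[OF _ G(3)]
  note e = tensorial_eigen[OF _ G(1,2)]
  have "\<delta> x (cov_curvature A D X Y Z Q x) = cov_curvature A D (F X) (F Y) (F Z) (F Q) x" using nat v by simp
  also have "\<dots> = a *\<^sub>R cov_curvature A D X (F Y) (F Z) (F Q) x"
    by (rule e[OF cov_curvature_tensorial(1)[OF G(1) FY(1) FZ(1) FQ(1)] FX(1) r[OF v(1)] FX(2)])
  also have "cov_curvature A D X (F Y) (F Z) (F Q) x = b *\<^sub>R cov_curvature A D X Y (F Z) (F Q) x"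
    by (rule e[OF cov_curvature_tensorial(2)[OF G(1) r[OF v(1)] FZ(1) FQ(1)] FY(1) r[OF v(2)] FY(2)])
  also have "cov_curvature A D X Y (F Z) (F Q) x = c *\<^sub>R cov_curvature A D X Y Z (F Q) x"
    by (rule e[OF cov_curvature_tensorial(3)[OF G(1) r[OF v(1)] r[OF v(2)] FQ(1)] FZ(1) r[OF v(3)] FZ(2)])
  also have "cov_curvature A D X Y Z (F Q) x = d *\<^sub>R cov_curvature A D X Y Z Q x"
    by (rule e[OF cov_curvature_tensorial(4)[OF G(1) r[OF v(1)] r[OF v(2)] r[OF v(3)]] FQ(1) r[OF v(4)] FQ(2)])
  finally show ?thesis by (simp only: scaleR_scaleR)
qed

text \<open>Vanishing theorems arise by computing the eigenvalue of a tensor in two ways: from its invariance,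
  and from the fact that the connection preserves the eigenbundles.\<close>

lemma E_zero:
  assumes "u \<in> E \<epsilon> x" "\<delta> x u = (- \<epsilon>) *\<^sub>R u" "\<epsilon> \<noteq> 0"
  shows "u = 0"
proof -
  have "\<epsilon> *\<^sub>R u = (- \<epsilon>) *\<^sub>R u" using assms(1,2) by (simp only: E_def mem_Collect_eq)
  then have "(\<epsilon> - (- \<epsilon>)) *\<^sub>R u = 0" by (simp only: scaleR_left_diff_distrib diff_self)
  then show ?thesis using assms(3) by (simp only: scaleR_eq_0_iff) simp
qed

lemma V_sections_E: "i \<in> I \<Longrightarrow> Z \<in> sections A G (V i) \<Longrightarrow> Z \<in> sections A G (E (sign i))"
  using V_E unfolding sections_def by blast

lemma lie_bracket_plus:
  assumes U: "open U" and X: "X \<in> sections A U (E 1)" and Y: "Y \<in> sections A U (E 1)"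
  shows "lie_bracket A X Y \<in> sections A U (E 1)"
proof -
  note v = sectionsD(1)[OF X] sectionsD(1)[OF Y]
  have "lie_bracket A X Y x \<in> E 1 x" if x: "x \<in> U" for x
  proof -
    have eq: "lie_bracket A X Y x = (D X Y x - D Y X x) - torsion A D X Y x"
      unfolding torsion_apply by (rule ext) simp
    have "torsion A D X Y x \<in> E 1 x"
      using sectionsD(2)[OF torsion_E[OF U X Y] x] by simp
    then show ?thesis
      unfolding eq using sectionsD(2)[OF D_E[OF U v(1) Y] x] sectionsD(2)[OF D_E[OF U v(2) X] x]
      by (intro subspace_diff[OF E_subspace]) simp_all
  qed
  then show ?thesis using vf_lie_bracket[OF U v] by (simp add: sections_def)
qed

text \<open>Curvature endomorphisms preserve the eigenbundles, while invariance gives a factor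
  \<open>1 * (-1)\<close> from the first two arguments.\<close>

lemma curvature_mixed_zero:
  assumes U: "open U" and X: "X \<in> sections A U (E 1)" and Y: "Y \<in> sections A U (E (-1))"
    and Z: "Z \<in> vfields A U" and x: "x \<in> U"
  shows "curvature A D X Y Z x = 0"
proof (rule tensorial_sections_zero[OF curvature_tensorial_3[OF U sectionsD(1)[OF X] sectionsD(1)[OF Y]] U x _ Z U x])
  fix i G Q assume i: "i \<in> I" and G: "open G" "G \<subseteq> U" "x \<in> G" and Q: "Q \<in> sections A G (V i)"
  note X = sections_subset[OF X G(2)] and Y = sections_subset[OF Y G(2)] and Q = V_sections_E[OF i Q]
  note v = sectionsD(1)[OF X] sectionsD(1)[OF Y]
  note DE = D_E[OF G(1) _ _ sign_cases, THEN sectionsD(2), OF _ _ G(3)]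
    and DES = D_E[OF G(1) _ _ sign_cases]
  have "curvature A D X Y Q x \<in> E (sign i) x"
    unfolding curvature_apply
    by (intro subspace_diff[OF E_subspace] DE DES v Q vf_lie_bracket G(1))
  moreover have "\<delta> x (curvature A D X Y Q x) = (- sign i) *\<^sub>R curvature A D X Y Q x"
    using sectionsD(2)[OF curvature_E[OF G(1) X Y Q] G(3)] by (simp add: E_def)
  ultimately show "curvature A D X Y Q x = 0" by (rule E_zero) simp
qed

text \<open>Differentiating along any direction keeps the eigenvalue \<open>sign i * sign j\<close> of the torsion, while
  invariance gives a further factor \<open>-1\<close> from the direction \<open>X\<close>.\<close>

lemma cov_torsion_zero:
  assumes U: "open U" and X: "X \<in> sections A U (E (-1))" and Y: "Y \<in> vfields A U"
    and Z: "Z \<in> vfields A U" and x: "x \<in> U"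
  shows "cov_torsion A D X Y Z x = 0"
proof (rule tensorial_sections_zero[OF cov_torsion_tensorial(2)[OF U sectionsD(1)[OF X] Z] U x _ Y U x])
  fix i G Y assume i: "i \<in> I" and G: "open G" "G \<subseteq> U" "x \<in> G" and Y: "Y \<in> sections A G (V i)"
  note X = sections_subset[OF X G(2)] and Y = V_sections_E[OF i Y] and Z = vfields_subset[OF Z G(2)]
  show "cov_torsion A D X Y Z x = 0"
  proof (rule tensorial_sections_zero[OF cov_torsion_tensorial(3)[OF G(1) sectionsD(1)[OF X] sectionsD(1)[OF Y]] G(1,3) _ Z G(1,3)])
    fix j H Z assume j: "j \<in> I" and H: "open H" "H \<subseteq> G" "x \<in> H" and Z: "Z \<in> sections A H (V j)"
    note X = sections_subset[OF X H(2)] and Y = sections_subset[OF Y H(2)] and Z = V_sections_E[OF j Z]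
    note vX = sectionsD(1)[OF X]
    have s: "sign i * sign j = 1 \<or> sign i * sign j = -1" using sign_cases[of i] sign_cases[of j] by auto
    note DX = D_E[OF H(1) vX]
    have "cov_torsion A D X Y Z x \<in> E (sign i * sign j) x"
      unfolding cov_torsion_def minus_apply[where x = x]
      by (intro subspace_diff[OF E_subspace] sectionsD(2)[OF DX[OF torsion_E[OF H(1) Y Z] s] H(3)]
          sectionsD(2)[OF torsion_E[OF H(1) DX[OF Y sign_cases] Z] H(3)]
          sectionsD(2)[OF torsion_E[OF H(1) Y DX[OF Z sign_cases]] H(3)])
    moreover have "\<delta> x (cov_torsion A D X Y Z x) = (- (sign i * sign j)) *\<^sub>R cov_torsion A D X Y Z x"
      using cov_torsion_delta[OF H(1,3) X Y Z] by (simp only: mult_minus_left mult_1)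
    ultimately show "cov_torsion A D X Y Z x = 0" by (rule E_zero) simp
  qed
qed

text \<open>The same count of eigenvalues with one more argument.\<close>

lemma cov_curvature_zero:
  assumes U: "open U" and X: "X \<in> sections A U (E (-1))" and Y: "Y \<in> vfields A U"
    and Z: "Z \<in> vfields A U" and Q: "Q \<in> vfields A U" and x: "x \<in> U"
  shows "cov_curvature A D X Y Z Q x = 0"
proof (rule tensorial_sections_zero[OF cov_curvature_tensorial(2)[OF U sectionsD(1)[OF X] Z Q] U x _ Y U x])
  fix i G Y assume i: "i \<in> I" and G: "open G" "G \<subseteq> U" "x \<in> G" and Y: "Y \<in> sections A G (V i)"
  note X = sections_subset[OF X G(2)] and Y = V_sections_E[OF i Y] and Z = vfields_subset[OF Z G(2)]
    and Q = vfields_subset[OF Q G(2)]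
  show "cov_curvature A D X Y Z Q x = 0"
  proof (rule tensorial_sections_zero[OF cov_curvature_tensorial(3)[OF G(1) sectionsD(1)[OF X] sectionsD(1)[OF Y] Q]
        G(1,3) _ Z G(1,3)])
    fix j H Z assume j: "j \<in> I" and H: "open H" "H \<subseteq> G" "x \<in> H" and Z: "Z \<in> sections A H (V j)"
    note X = sections_subset[OF X H(2)] and Y = sections_subset[OF Y H(2)] and Z = V_sections_E[OF j Z]
      and Q = vfields_subset[OF Q H(2)]
    show "cov_curvature A D X Y Z Q x = 0"
    proof (rule tensorial_sections_zero[OF cov_curvature_tensorial(4)[OF H(1) sectionsD(1)[OF X] sectionsD(1)[OF Y]
            sectionsD(1)[OF Z]] H(1,3) _ Q H(1,3)])
      fix k K Q assume k: "k \<in> I" and K: "open K" "K \<subseteq> H" "x \<in> K" and Q: "Q \<in> sections A K (V k)"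
      note X = sections_subset[OF X K(2)] and Y = sections_subset[OF Y K(2)] and Z = sections_subset[OF Z K(2)]
        and Q = V_sections_E[OF k Q]
      let ?s = "sign i * (sign j * sign k)"
      have s: "?s = 1 \<or> ?s = -1" using sign_cases[of i] sign_cases[of j] sign_cases[of k] by auto
      note DX = D_E[OF K(1) sectionsD(1)[OF X]]
      have "cov_curvature A D X Y Z Q x \<in> E ?s x"
        unfolding cov_curvature_def minus_apply[where x = x]
        by (intro subspace_diff[OF E_subspace] sectionsD(2)[OF DX[OF curvature_E[OF K(1) Y Z Q] s] K(3)]
            sectionsD(2)[OF curvature_E[OF K(1) DX[OF Y sign_cases] Z Q] K(3)]
            sectionsD(2)[OF curvature_E[OF K(1) Y DX[OF Z sign_cases] Q] K(3)]
            sectionsD(2)[OF curvature_E[OF K(1) Y Z DX[OF Q sign_cases]] K(3)])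
      moreover have "\<delta> x (cov_curvature A D X Y Z Q x) = (- ?s) *\<^sub>R cov_curvature A D X Y Z Q x"
        using cov_curvature_delta[OF K(1,3) X Y Z Q] by (simp only: mult_minus_left mult_1)
      ultimately show "cov_curvature A D X Y Z Q x = 0" by (rule E_zero) simp
    qed
  qed
qed

end

section \<open>Witt symmetric spaces\<close>

lemma finite_witt_index: "finite (witt_index r s q p ps)"
  by (simp add: witt_index_def)

lemma witt_star_p:
  assumes "witt_indices r s q p ps" "k \<in> {1..s}" shows "witt_star s p ps (p k) = ps k"
  using assms by (simp add: witt_star_def witt_indices_def)

lemma witt_star_ps:
  assumes "witt_indices r s q p ps" "k \<in> {1..s}" shows "witt_star s p ps (ps k) = p k"
proof -
  have "ps k \<notin> p ` {1..s}" using assms unfolding witt_indices_def by blast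
  then show ?thesis using assms by (simp add: witt_star_def witt_indices_def)
qed

lemma witt_star_q:
  assumes "witt_indices r s q p ps" "l \<in> {1..r}" shows "witt_star s p ps (q l) = q l"
proof -
  have neg: "q l < 0" "\<And>k. k \<in> {1..s} \<Longrightarrow> 0 \<le> p k \<and> 0 \<le> ps k" using assms by (auto simp: witt_indices_def)
  then have "q l \<notin> p ` {1..s}" "q l \<notin> ps ` {1..s}" by force+
  then show ?thesis by (simp add: witt_star_def)
qed

lemma witt_index_cases:
  assumes "i \<in> witt_index r s q p ps"
  obtains l where "l \<in> {1..r}" "i = q l" | k where "k \<in> {1..s}" "i = p k" | k where "k \<in> {1..s}" "i = ps k"
  using assms unfolding witt_index_def by blast

text \<open>The involution fixes exactly the anisotropic indices, because these are negative and
  the others are not, and \<open>p k\<close> is never one of the \<open>ps l\<close>.\<close>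

lemma witt_symmetric_spaceI:
  assumes A: "smooth_atlas A" and g: "pseudo_riemannian_metric A g" and w: "witt_structure A g r s q p ps V"
    and I: "I = witt_index r s q p ps" and can: "canonical_witt_connection A g I (witt_star s p ps) V D"
    and sym: "locally_witt_symmetric A g I V D"
  shows "witt_symmetric_space A D g I (witt_star s p ps) V"
proof
  let ?star = "witt_star s p ps"
  have idx: "witt_indices r s q p ps" and sub: "\<forall>i\<in>I. smooth_subbundle A (V i)"
    and dec: "\<forall>x. direct_sum_decomposition I (\<lambda>i. V i x) (tangent_space A x)"
    and orth: "\<forall>i\<in>I. \<forall>j\<in>I. j \<noteq> i \<longrightarrow> j \<noteq> ?star i \<longrightarrow> (\<forall>x. \<forall>u\<in>V i x. \<forall>w\<in>V j x. g x u w = 0)"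
    and hyp: "\<And>k x. k \<in> {1..s} \<Longrightarrow> (\<forall>u\<in>V (p k) x. (\<forall>w\<in>V (ps k) x. g x u w = 0) \<longrightarrow> u = 0) \<and>
        (\<forall>w\<in>V (ps k) x. (\<forall>u\<in>V (p k) x. g x u w = 0) \<longrightarrow> w = 0)"
    and aniso: "\<forall>l\<in>{1..r}. \<forall>x. \<forall>u\<in>V (q l) x. g x u u = 0 \<longrightarrow> u = 0"
    using w unfolding witt_structure_def I by simp_all
  have tan: "V i x \<subseteq> tangent_space A x" if "i \<in> I" for i x
    using dec that unfolding direct_sum_decomposition_def by blast
  have gsym: "g x u v = g x v u" if "u \<in> tangent_space A x" "v \<in> tangent_space A x" for x u v
    using g[unfolded pseudo_riemannian_metric_def, THEN conjunct2, THEN conjunct1, rule_format, OF that] .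
  have ps_ne: "p k \<noteq> ps k'" if "k \<in> {1..s}" "k' \<in> {1..s}" for k k'
    using idx that unfolding witt_indices_def by (metis IntI image_eqI empty_iff)
  show "smooth_atlas A" by (rule A)
  show "\<exists>L::'b \<Rightarrow> 'a tangent. linear L \<and> bij_betw L UNIV (tangent_space A x)" for x
    using sym unfolding locally_witt_symmetric_def exp_diffeo_def by blast
  show "is_connection A D" using can by (simp add: canonical_witt_connection_def)
  show "pseudo_riemannian_metric A g" by (rule g)
  show "finite I" unfolding I by (rule finite_witt_index)
  show "smooth_subbundle A (V i)" if "i \<in> I" for i using sub that by blast
  show "direct_sum_decomposition I (\<lambda>i. V i x) (tangent_space A x)" for x using dec by blast
  show "canonical_witt_connection A g I ?star V D" by (rule can)
  show "locally_witt_symmetric A g I V D" by (rule sym)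
  show "g x u w = 0" if "i \<in> I" "j \<in> I" "j \<noteq> i" "j \<noteq> ?star i" "u \<in> V i x" "w \<in> V j x" for i j x u w
    using orth[rule_format, OF that] .
  have pI: "p k \<in> I" "ps k \<in> I" if "k \<in> {1..s}" for k using that by (auto simp: I witt_index_def)
  show "?star i \<in> I" if "i \<in> I" for i
    using that[unfolded I]
    by (cases rule: witt_index_cases) (use that pI witt_star_p[OF idx] witt_star_ps[OF idx] witt_star_q[OF idx] in auto)
  show "even (?star i) = even i" if "i \<in> I" for i
    using that[unfolded I]
  proof (cases rule: witt_index_cases)
    case (2 k)
    then show ?thesis using idx witt_star_p[OF idx] by (simp add: witt_indices_def)
  next
    case (3 k)
    then show ?thesis using idx witt_star_ps[OF idx] by (simp add: witt_indices_def)
  qed (simp add: witt_star_q[OF idx])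
  show "u = 0" if i: "i \<in> I" and ne: "?star i \<noteq> i" and u: "u \<in> V i x"
    and zero: "\<And>w. w \<in> V (?star i) x \<Longrightarrow> g x u w = 0" for i u x
    using i[unfolded I]
  proof (cases rule: witt_index_cases)
    case (1 l)
    then show ?thesis using ne witt_star_q[OF idx] by simp
  next
    case (2 k)
    then show ?thesis using hyp[OF 2(1), of x] u zero witt_star_p[OF idx 2(1)] by simp
  next
    case (3 k)
    have "g x v u = 0" if v: "v \<in> V (p k) x" for v
    proof -
      have "g x v u = g x u v" by (rule gsym) (use tan pI[OF 3(1)] v u 3(2) in auto)
      then show ?thesis using zero[of v] v 3 witt_star_ps[OF idx 3(1)] by simp
    qed
    then show ?thesis using hyp[OF 3(1), of x] u 3(2) by simp
  qed
  show "u = 0" if i: "i \<in> I" and eq: "?star i = i" and u: "u \<in> V i x" and zero: "g x u u = 0" for i u x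
    using i[unfolded I]
  proof (cases rule: witt_index_cases)
    case (1 l)
    then show ?thesis using aniso u zero by blast
  next
    case (2 k)
    then show ?thesis using eq witt_star_p[OF idx 2(1)] ps_ne[OF 2(1) 2(1)] by simp
  next
    case (3 k)
    then show ?thesis using eq witt_star_ps[OF idx 3(1)] ps_ne[OF 3(1) 3(1)] by simp
  qed
qed

theorem proposition5p1:
  fixes A :: "('m::{t2_space, second_countable_topology}, 'e::euclidean_space) chart set"
    and g :: "'m metric_field"
    and r s :: nat and q p ps :: "nat \<Rightarrow> int"
    and V :: "int \<Rightarrow> 'm \<Rightarrow> 'm tangent set"
    and D :: "'m connection"
    and I :: "int set" and Vp Vm :: "'m \<Rightarrow> 'm tangent set"
  assumes "smooth_atlas A"
    and "pseudo_riemannian_metric A g"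
    and "witt_structure A g r s q p ps V"
    and I: "I = witt_index r s q p ps"
    and "canonical_witt_connection A g I (witt_star s p ps) V D"
    and "locally_witt_symmetric A g I V D"
    and Vp: "Vp = V_plus A I V"
    and Vm: "Vm = V_minus A I V"
  shows "\<forall>U. open U \<longrightarrow>
      (\<forall>X\<in>sections A U Vp. \<forall>Y\<in>sections A U Vp. lie_bracket A X Y \<in> sections A U Vp) \<and>
      (\<forall>X\<in>sections A U Vm. \<forall>Y\<in>sections A U Vm. \<forall>x\<in>U. torsion A D X Y x \<in> Vp x) \<and>
      (\<forall>X\<in>sections A U Vp. \<forall>Y\<in>sections A U Vm. \<forall>x\<in>U. torsion A D X Y x \<in> Vm x) \<and>
      (\<forall>X\<in>sections A U Vp. \<forall>Y\<in>sections A U Vm. \<forall>Z\<in>vfields A U. \<forall>x\<in>U.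
         curvature A D X Y Z x = 0) \<and>
      (\<forall>X\<in>sections A U Vm. \<forall>Y\<in>vfields A U. \<forall>Z\<in>vfields A U. \<forall>W\<in>vfields A U. \<forall>x\<in>U.
         cov_curvature A D X Y Z W x = 0) \<and>
      (\<forall>X\<in>sections A U Vm. \<forall>Y\<in>vfields A U. \<forall>Z\<in>vfields A U. \<forall>x\<in>U.
         cov_torsion A D X Y Z x = 0)"
proof -
  interpret witt_symmetric_space A D g I "witt_star s p ps" V
    by (rule witt_symmetric_spaceI[OF assms(1-6)])
  have Vp: "Vp = E 1" and Vm: "Vm = E (-1)" using Vp Vm E_eqs by simp_all
  have 1: "torsion A D X Y x \<in> E 1 x"
    if "open U" "X \<in> sections A U (E (-1))" "Y \<in> sections A U (E (-1))" "x \<in> U" for U X Y x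
    using sectionsD(2)[OF torsion_E[OF that(1-3)] that(4)] by simp
  have 2: "torsion A D X Y x \<in> E (-1) x"
    if "open U" "X \<in> sections A U (E 1)" "Y \<in> sections A U (E (-1))" "x \<in> U" for U X Y x
    using sectionsD(2)[OF torsion_E[OF that(1-3)] that(4)] by simp
  show ?thesis
    unfolding Vp Vm
    by (intro allI impI conjI ballI lie_bracket_plus 1 2 curvature_mixed_zero cov_curvature_zero cov_torsion_zero)
qed

end
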